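(* Fix $c>0$. Let $q$ be a positive integer and $N$ an integer with \[ \frac{q}{(\log q)^{c+2}}<N<\frac{q}{2(\log q)^{2}}. \] Then for every even non-principal Dirichlet character $\chi$ modulo $q$, \[ \sum_{n=1}^N \chi(n) \ll_c \sqrt{q}\,\log\log q , \] where the implied constant depends only on $c$.
   Context: A Dirichlet character $\chi$ is even if $\chi(-1)=1$. The notation $A\ll_c B$ means $|A|\leqslant K B$ for a constant $K$ depending only on $c$. *)

theory Defs
  imports Complex_Main
begin

text \<open>
  A Dirichlet character modulo \<open>q\<close> is a character of the unit group of the integers modulo \<open>q\<close>,
  extended to the integers by periodicity and by zero off the integers coprime to \<open>q\<close>.
  The value at \<open>1\<close> need not be prescribed: it is nonzero and idempotent, hence \<open>1\<close>.
\<close>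

definition dirichlet_character :: "nat \<Rightarrow> (int \<Rightarrow> complex) \<Rightarrow> bool" where
  "dirichlet_character q \<chi> \<longleftrightarrow>
     (\<forall>m n. \<chi> (m * n) = \<chi> m * \<chi> n) \<and>
     (\<forall>n. \<chi> (n + int q) = \<chi> n) \<and>
     (\<forall>n. \<chi> n \<noteq> 0 \<longleftrightarrow> coprime n (int q))"

definition principal_character :: "nat \<Rightarrow> int \<Rightarrow> complex" where
  "principal_character q n = (if coprime n (int q) then 1 else 0)"

definition even_character :: "(int \<Rightarrow> complex) \<Rightarrow> bool" where
  "even_character \<chi> \<longleftrightarrow> \<chi> (-1) = 1"

end

theory Submission
  imports Defs "HOL-Number_Theory.Number_Theory" "HOL-Analysis.Convex"
begin

text \<open>
  The finite Fourier expansion of \<open>\<chi>\<close> turns the character sum into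
  \<open>\<surd>q \<Sum>\<^sub>k F(k) sin(2\<pi>k\<alpha>)/k\<close> with \<open>\<alpha> = N/q\<close> and normalised Gauss sums \<open>F(k)\<close>. These have mean
  square at most \<open>1\<close> on every initial segment and satisfy \<open>F(pk) = \<chi>(p)\<inverse>F(k)\<close> for primes \<open>p\<close> not
  dividing \<open>q\<close>. The terms \<open>k \<le> \<alpha>\<^sup>-\<^sup>4\<close> contribute \<open>O\<^sub>c(log log q)\<close> by Cauchy--Schwarz. Beyond that point,
  weighting by \<open>ln k = \<Sum>\<^bsub>d|k\<^esub> \<Lambda>(d)\<close> gives bilinear sums over \<open>k = pm\<close>; Cauchy--Schwarz in \<open>m\<close> leaves
  geometric sums attached to pairs of primes, whose differences \<open>h\<close> are counted by Selberg's sieve.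
  As \<open>\<alpha>\<close> is small, few \<open>h\<alpha>\<close> lie near an integer, which saves the factor needed before summing
  by parts. Primes dividing \<open>q\<close> are harmless: if \<open>s\<close> is \<open>q\<close> divided by the conductor, then \<open>F(k) = 0\<close>
  unless \<open>gcd k q\<close> divides \<open>s\<close>, and \<open>|F(k)| \<le> gcd k q / \<surd>s\<close>.
\<close>

section \<open>Selberg's upper bound sieve\<close>

text \<open>Both bounds on N are dictated by where ln ln q may arise. The lower one makes 1/\<alpha>
  at most a power of ln q, so the harmonic sum up to \<alpha>^-4 is O(ln ln q). The upper one serves
  the tail: summation against 1/(k ln k) yields ln ln q from the main part, and ln q times
  sqrt(\<alpha> V) from those h with h\<alpha> within \<alpha> of an integer, where V bounds
  2h/phi(2h). As V is a multiple of (ln ln q)^2, the bound \<alpha> \<le> 1/(2 (ln q)^2) leaves just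
  ln ln q. The sieve enters because squaring produces the prime weights (ln P)^2: counting pairs
  trivially by P would lose this factor, whereas P/(ln P)^2 cancels it, at the price of the factor
  2h/phi(2h). That factor is used in mean square for most h and pointwise only for the few close
  ones. For primes below 1/(2\<alpha>) no h is close and trivial counting is affordable once x \<ge>
  \<alpha>^-4, which explains the exponent 4. Imprimitive characters are treated together with
  primitive ones; their Gauss sums are then not bounded by sqrt q individually, hence the reliance
  on mean squares.\<close>

lemma sum_minus_one_power_card_between:
  assumes "finite B" "M \<subseteq> B"
  shows "(\<Sum>A | M \<subseteq> A \<and> A \<subseteq> B. (-1::real) ^ card A) = (if B = M then (-1) ^ card M else 0)"
proof -
  have fM: "finite M" using assms finite_subset by blast
  have "(\<Sum>A | M \<subseteq> A \<and> A \<subseteq> B. (-1::real) ^ card A) = (\<Sum>X\<in>Pow (B - M). (-1) ^ card (M \<union> X))"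
    by (rule sum.reindex_bij_witness[of _ "\<lambda>X. M \<union> X" "\<lambda>A. A - M"]) (use assms in \<open>auto simp: Un_absorb1\<close>)
  also have "\<dots> = (\<Sum>X\<in>Pow (B - M). (-1) ^ card M * (\<Prod>x\<in>X. -1))"
  proof (rule sum.cong[OF refl])
    fix X assume X: "X \<in> Pow (B - M)"
    then have "finite X" using assms(1) finite_subset by fastforce
    then have "card (M \<union> X) = card M + card X"
      using X fM by (intro card_Un_disjoint) auto
    then show "(-1::real) ^ card (M \<union> X) = (-1) ^ card M * (\<Prod>x\<in>X. -1)"
      by (simp add: power_add)
  qed
  also have "\<dots> = (-1) ^ card M * (\<Sum>X\<in>Pow (B - M). (\<Prod>x\<in>X. -1) * (\<Prod>x\<in>(B - M) - X. 1))"
    by (simp add: sum_distrib_left)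
  \<comment> \<open>The alternating sum over the subsets of B - M is (1 - 1)^|B - M|: Moebius
    inversion on the lattice of subsets.\<close>
  also have "(\<Sum>X\<in>Pow (B - M). (\<Prod>x\<in>X. -1) * (\<Prod>x\<in>(B - M) - X. 1)) = (\<Prod>x\<in>B - M. (-1::real) + 1)"
    using assms(1) by (subst prod_add) auto
  also have "\<dots> = (if B = M then 1 else 0)"
    using assms by auto
  finally show ?thesis by auto
qed

text \<open>Write 1/g as (1/g - 1) + 1 and expand. This separates the variables in the sieve's
  quadratic form, as 1/g(gcd(a,b)) becomes a sum over common divisors.\<close>

lemma prod_inverse_expand:
  fixes g :: "'a \<Rightarrow> real"
  assumes "finite C"
  shows "(\<Prod>p\<in>C. 1 / g p) = (\<Sum>M\<in>Pow C. \<Prod>p\<in>M. 1 / g p - 1)"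
proof -
  have "(\<Prod>p\<in>C. 1 / g p) = (\<Prod>p\<in>C. (1 / g p - 1) + 1)" by simp
  also have "\<dots> = (\<Sum>M\<in>Pow C. \<Prod>p\<in>M. 1 / g p - 1)"
    using assms by (subst prod_add) auto
  finally show ?thesis .
qed

text \<open>Squarefree numbers are encoded as their sets of prime factors: \<open>E n\<close> consists of the primes
  dividing the \<open>n\<close>th sifted number, and \<open>D\<close> is the set of divisors that carry sieve weights.\<close>

theorem selberg_sieve:
  fixes g :: "'a \<Rightarrow> real" and D :: "'a set set" and E :: "'b \<Rightarrow> 'a set" and X :: real
  assumes fin: "finite Pr" "finite N" and D: "D \<subseteq> Pow Pr" "{} \<in> D"
    and down: "\<And>A B. A \<in> D \<Longrightarrow> B \<subseteq> A \<Longrightarrow> B \<in> D"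
    and g: "\<And>p. p \<in> Pr \<Longrightarrow> 0 < g p" "\<And>p. p \<in> Pr \<Longrightarrow> g p < 1"
    and R: "\<And>A B. A \<in> D \<Longrightarrow> B \<in> D \<Longrightarrow>
      \<bar>real (card {n \<in> N. A \<union> B \<subseteq> E n}) - X * (\<Prod>p\<in>A \<union> B. g p)\<bar> \<le> R A B"
  defines "J \<equiv> (\<Sum>A\<in>D. \<Prod>p\<in>A. g p / (1 - g p))"
  shows "real (card {n \<in> N. E n \<inter> Pr = {}}) \<le>
           X / J + (\<Sum>A\<in>D. \<Sum>B\<in>D. (\<Prod>p\<in>A. 1 / g p) * (\<Prod>p\<in>B. 1 / g p) * R A B)"
proof -
  define h where "h A = (\<Prod>p\<in>A. g p / (1 - g p))" for A
  define gg where "gg A = (\<Prod>p\<in>A. g p)" for A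
  \<comment> \<open>The optimal weights: after diagonalisation the form is a sum of y_M^2 / h M
    under the constraint that the sum of (-1)^|M| y_M, which is \<open>l {}\<close>, equals 1. The
    minimum 1/J is attained at y_M = (-1)^|M| h M / J, and \<open>l\<close> is what Moebius
    inversion makes of this choice.\<close>
  define l where "l A = (-1) ^ card A / gg A / J * (\<Sum>B | B \<in> D \<and> A \<subseteq> B. h B)" for A
  have fD: "finite D" using fin D finite_subset by blast
  have finA: "finite A" if "A \<in> D" for A using that D fin finite_subset by blast
  have sub: "A \<subseteq> Pr" if "A \<in> D" for A using that D by auto
  have hpos: "h A > 0" if "A \<in> D" for A
    unfolding h_def using g sub[OF that] by (intro prod_pos) (auto intro!: divide_pos_pos)
  have ggpos: "gg A > 0" if "A \<subseteq> Pr" for A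
    unfolding gg_def using g that by (intro prod_pos) auto
  have Jh: "J = (\<Sum>A\<in>D. h A)" by (simp add: J_def h_def)
  have Jpos: "J > 0" unfolding Jh using fD D hpos by (intro sum_pos) auto
  have l0: "l {} = 1"
    using Jpos by (simp add: l_def gg_def Jh)
  have labs: "\<bar>l A\<bar> \<le> (\<Prod>p\<in>A. 1 / g p)" if A: "A \<in> D" for A
  proof -
    have "(\<Sum>B | B \<in> D \<and> A \<subseteq> B. h B) \<le> J"
      unfolding Jh using fD hpos by (intro sum_mono2) (auto intro: less_imp_le)
    moreover have "(\<Sum>B | B \<in> D \<and> A \<subseteq> B. h B) \<ge> 0"
      using hpos by (intro sum_nonneg) (auto intro: less_imp_le)
    ultimately have "\<bar>l A\<bar> \<le> 1 / gg A"
      using Jpos ggpos[OF sub[OF A]]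
      by (simp add: l_def abs_mult power_abs field_simps)
    then show ?thesis by (simp add: gg_def prod_dividef)
  qed
  \<comment> \<open>The diagonal variables y_M. After the exchange of sums the alternating sum over
    A between M and B leaves only B = M.\<close>
  have y: "(\<Sum>A | A \<in> D \<and> M \<subseteq> A. l A * gg A) = (-1) ^ card M * h M / J" if M: "M \<in> D" for M
  proof -
    have "(\<Sum>A | A \<in> D \<and> M \<subseteq> A. l A * gg A)
        = (\<Sum>A | A \<in> D \<and> M \<subseteq> A. \<Sum>B | B \<in> D \<and> A \<subseteq> B. (-1) ^ card A * h B / J)"
    proof (rule sum.cong[OF refl])
      fix A assume "A \<in> {A. A \<in> D \<and> M \<subseteq> A}"
      then have "gg A > 0" using ggpos sub by auto
      then show "l A * gg A = (\<Sum>B | B \<in> D \<and> A \<subseteq> B. (-1) ^ card A * h B / J)"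
        unfolding l_def by (simp add: sum_distrib_left sum_divide_distrib field_simps)
    qed
    also have "\<dots> = (\<Sum>B\<in>D. \<Sum>A | M \<subseteq> A \<and> A \<subseteq> B. (-1) ^ card A * h B / J)"
    proof -
      have "(\<Sum>A | A \<in> D \<and> M \<subseteq> A. \<Sum>B | B \<in> D \<and> A \<subseteq> B. (-1) ^ card A * h B / J)
        = (\<Sum>B\<in>D. \<Sum>A | A \<in> {A. A \<in> D \<and> M \<subseteq> A} \<and> A \<subseteq> B. (-1) ^ card A * h B / J)"
        by (rule sum.swap_restrict) (use fD in auto)
      also have "\<dots> = (\<Sum>B\<in>D. \<Sum>A | M \<subseteq> A \<and> A \<subseteq> B. (-1) ^ card A * h B / J)"
        by (intro sum.cong refl) (use down in auto)
      finally show ?thesis .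
    qed
    also have "\<dots> = (\<Sum>B\<in>D. if B = M then (-1) ^ card M * h M / J else 0)"
    proof (rule sum.cong[OF refl])
      fix B assume B: "B \<in> D"
      show "(\<Sum>A | M \<subseteq> A \<and> A \<subseteq> B. (-1) ^ card A * h B / J) = (if B = M then (-1) ^ card M * h M / J else 0)"
      proof (cases "M \<subseteq> B")
        case True
        have "(\<Sum>A | M \<subseteq> A \<and> A \<subseteq> B. (-1) ^ card A * h B / J) = (\<Sum>A | M \<subseteq> A \<and> A \<subseteq> B. (-1) ^ card A) * (h B / J)"
          by (simp add: sum_distrib_right sum_divide_distrib)
        also have "\<dots> = (if B = M then (-1) ^ card M else 0) * (h B / J)"
          by (subst sum_minus_one_power_card_between[OF finA[OF B] True]) simp
        finally show ?thesis by auto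
      next
        case False
        then have "{A. M \<subseteq> A \<and> A \<subseteq> B} = {}" by auto
        then show ?thesis using False by (auto simp del: Collect_empty_eq)
      qed
    qed
    also have "\<dots> = (-1) ^ card M * h M / J" using fD M by simp
    finally show ?thesis .
  qed
  have inv_h: "(\<Prod>p\<in>M. 1 / g p - 1) = 1 / h M" if "M \<in> D" for M
  proof -
    have "(\<Prod>p\<in>M. 1 / g p - 1) = (\<Prod>p\<in>M. 1 / (g p / (1 - g p)))"
    proof (rule prod.cong[OF refl])
      fix p assume "p \<in> M"
      then have "g p > 0" "g p < 1" using g sub[OF that] by auto
      then show "1 / g p - 1 = 1 / (g p / (1 - g p))" by (simp add: field_simps)
    qed
    then show ?thesis by (simp add: h_def prod_dividef)
  qed
  have union: "gg (A \<union> B) = gg A * gg B * (\<Sum>M | M \<in> D \<and> M \<subseteq> A \<and> M \<subseteq> B. 1 / h M)"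
    if A: "A \<in> D" and B: "B \<in> D" for A B
  proof -
    have "gg (A \<union> B) * gg (A \<inter> B) = gg A * gg B"
      unfolding gg_def by (rule prod.union_inter) (use finA A B in auto)
    moreover have "gg (A \<inter> B) > 0" using ggpos sub[OF A] by blast
    ultimately have "gg (A \<union> B) = gg A * gg B * (1 / gg (A \<inter> B))" by (simp add: field_simps)
    also have "1 / gg (A \<inter> B) = (\<Prod>p\<in>A \<inter> B. 1 / g p)" by (simp add: gg_def prod_dividef)
    also have "\<dots> = (\<Sum>M\<in>Pow (A \<inter> B). \<Prod>p\<in>M. 1 / g p - 1)"
      by (rule prod_inverse_expand) (use finA A in auto)
    also have "\<dots> = (\<Sum>M | M \<in> D \<and> M \<subseteq> A \<and> M \<subseteq> B. 1 / h M)"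
      by (rule sum.cong) (use down[OF A] inv_h in auto)
    finally show ?thesis .
  qed
  \<comment> \<open>By \<open>union\<close> the form is the sum over M of y_M^2 / h M; by
    \<open>y\<close> each term equals h M / J^2.\<close>
  have main: "(\<Sum>A\<in>D. \<Sum>B\<in>D. l A * l B * gg (A \<union> B)) = 1 / J"
  proof -
    have "(\<Sum>A\<in>D. \<Sum>B\<in>D. l A * l B * gg (A \<union> B))
      = (\<Sum>A\<in>D. \<Sum>B\<in>D. \<Sum>M\<in>D. if M \<subseteq> A \<and> M \<subseteq> B then (l A * gg A) * (l B * gg B) / h M else 0)"
    proof (intro sum.cong refl)
      fix A B assume AB: "A \<in> D" "B \<in> D"
      have "l A * l B * gg (A \<union> B) = (\<Sum>M | M \<in> D \<and> M \<subseteq> A \<and> M \<subseteq> B. (l A * gg A) * (l B * gg B) / h M)"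
        unfolding union[OF AB] by (simp add: sum_distrib_left mult_ac)
      also have "\<dots> = (\<Sum>M\<in>D. if M \<subseteq> A \<and> M \<subseteq> B then (l A * gg A) * (l B * gg B) / h M else 0)"
        by (simp only: sum.inter_filter[OF fD])
      finally show "l A * l B * gg (A \<union> B) = (\<Sum>M\<in>D. if M \<subseteq> A \<and> M \<subseteq> B then (l A * gg A) * (l B * gg B) / h M else 0)" .
    qed
    also have "\<dots> = (\<Sum>A\<in>D. \<Sum>M\<in>D. \<Sum>B\<in>D. if M \<subseteq> A \<and> M \<subseteq> B then (l A * gg A) * (l B * gg B) / h M else 0)"
      by (rule sum.cong[OF refl], rule sum.swap)
    also have "\<dots> = (\<Sum>M\<in>D. \<Sum>A\<in>D. \<Sum>B\<in>D. if M \<subseteq> A \<and> M \<subseteq> B then (l A * gg A) * (l B * gg B) / h M else 0)"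
      by (rule sum.swap)
    also have "\<dots> = (\<Sum>M\<in>D. (\<Sum>A | A \<in> D \<and> M \<subseteq> A. l A * gg A) * (\<Sum>B | B \<in> D \<and> M \<subseteq> B. l B * gg B) / h M)"
    proof (rule sum.cong[OF refl])
      fix M assume "M \<in> D"
      have "(\<Sum>A | A \<in> D \<and> M \<subseteq> A. l A * gg A) * (\<Sum>B | B \<in> D \<and> M \<subseteq> B. l B * gg B) / h M
        = (\<Sum>A\<in>D. if M \<subseteq> A then l A * gg A else 0) * (\<Sum>B\<in>D. if M \<subseteq> B then l B * gg B else 0) / h M"
        by (simp only: sum.inter_filter[OF fD])
      also have "\<dots> = (\<Sum>A\<in>D. \<Sum>B\<in>D. (if M \<subseteq> A then l A * gg A else 0) * (if M \<subseteq> B then l B * gg B else 0) / h M)"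
        by (simp add: sum_product sum_divide_distrib)
      also have "\<dots> = (\<Sum>A\<in>D. \<Sum>B\<in>D. if M \<subseteq> A \<and> M \<subseteq> B then (l A * gg A) * (l B * gg B) / h M else 0)"
        by (intro sum.cong refl) auto
      finally show "(\<Sum>A\<in>D. \<Sum>B\<in>D. if M \<subseteq> A \<and> M \<subseteq> B then (l A * gg A) * (l B * gg B) / h M else 0)
        = (\<Sum>A | A \<in> D \<and> M \<subseteq> A. l A * gg A) * (\<Sum>B | B \<in> D \<and> M \<subseteq> B. l B * gg B) / h M" by simp
    qed
    also have "\<dots> = (\<Sum>M\<in>D. h M / J ^ 2)"
    proof (rule sum.cong[OF refl])
      fix M assume M: "M \<in> D"
      have s: "(-1::real) ^ card M * (-1) ^ card M = 1" by (simp flip: power_add)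
      have "(-1) ^ card M * h M / J * ((-1) ^ card M * h M / J) / h M
          = ((-1::real) ^ card M * (-1) ^ card M) * (h M / J ^ 2)"
        using hpos[OF M] Jpos by (simp add: power2_eq_square field_simps)
      then show "(\<Sum>A | A \<in> D \<and> M \<subseteq> A. l A * gg A) * (\<Sum>B | B \<in> D \<and> M \<subseteq> B. l B * gg B) / h M = h M / J ^ 2"
        unfolding y[OF M] s by simp
    qed
    also have "\<dots> = 1 / J" using Jpos by (simp add: Jh[symmetric] power2_eq_square flip: sum_divide_distrib)
    finally show ?thesis .
  qed
  have "real (card {n \<in> N. E n \<inter> Pr = {}}) = (\<Sum>n\<in>N. if E n \<inter> Pr = {} then 1 else 0)"
    using fin by (simp add: sum.If_cases Int_def)
  \<comment> \<open>The square is nonnegative for every n, and if no sifting prime divides n, only A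
    = {} contributes and it is \<open>(l {})^2 = 1\<close>.\<close>
  also have "\<dots> \<le> (\<Sum>n\<in>N. (\<Sum>A\<in>D. if A \<subseteq> E n then l A else 0) ^ 2)"
  proof (rule sum_mono)
    fix n assume "n \<in> N"
    show "(if E n \<inter> Pr = {} then 1 else 0) \<le> (\<Sum>A\<in>D. if A \<subseteq> E n then l A else 0) ^ 2"
    proof (cases "E n \<inter> Pr = {}")
      case True
      have "(\<Sum>A\<in>D. if A \<subseteq> E n then l A else 0) = (\<Sum>A\<in>D. if A = {} then l {} else 0)"
        by (rule sum.cong) (use True sub in auto)
      also have "\<dots> = 1" using fD D l0 by simp
      finally show ?thesis by simp
    qed auto
  qed
  also have "\<dots> = (\<Sum>n\<in>N. \<Sum>A\<in>D. \<Sum>B\<in>D. if A \<union> B \<subseteq> E n then l A * l B else 0)"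
    by (intro sum.cong refl) (auto simp: power2_eq_square sum_product intro!: sum.cong)
  also have "\<dots> = (\<Sum>A\<in>D. \<Sum>n\<in>N. \<Sum>B\<in>D. if A \<union> B \<subseteq> E n then l A * l B else 0)"
    by (rule sum.swap)
  also have "\<dots> = (\<Sum>A\<in>D. \<Sum>B\<in>D. \<Sum>n\<in>N. if A \<union> B \<subseteq> E n then l A * l B else 0)"
    by (rule sum.cong[OF refl], rule sum.swap)
  also have "\<dots> = (\<Sum>A\<in>D. \<Sum>B\<in>D. l A * l B * real (card {n \<in> N. A \<union> B \<subseteq> E n}))"
    using fin by (intro sum.cong refl) (simp add: sum.If_cases Int_def del: Un_subset_iff)
  also have "\<dots> \<le> (\<Sum>A\<in>D. \<Sum>B\<in>D. X * (l A * l B * gg (A \<union> B))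
        + (\<Prod>p\<in>A. 1 / g p) * (\<Prod>p\<in>B. 1 / g p) * R A B)"
  proof (intro sum_mono)
    fix A B assume AB: "A \<in> D" "B \<in> D"
    define r where "r = real (card {n \<in> N. A \<union> B \<subseteq> E n}) - X * gg (A \<union> B)"
    have r: "\<bar>r\<bar> \<le> R A B" using R[OF AB] by (simp add: r_def gg_def)
    have "l A * l B * r \<le> \<bar>l A\<bar> * \<bar>l B\<bar> * \<bar>r\<bar>"
      by (metis abs_ge_self abs_mult)
    also have "\<dots> \<le> (\<Prod>p\<in>A. 1 / g p) * (\<Prod>p\<in>B. 1 / g p) * R A B"
    proof (intro mult_mono labs AB r)
      show "0 \<le> (\<Prod>p\<in>A. 1 / g p)" using labs[OF AB(1)] by linarith
      then show "0 \<le> (\<Prod>p\<in>A. 1 / g p) * (\<Prod>p\<in>B. 1 / g p)" using labs[OF AB(2)] by (intro mult_nonneg_nonneg) auto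
    qed auto
    finally show "l A * l B * real (card {n \<in> N. A \<union> B \<subseteq> E n}) \<le> X * (l A * l B * gg (A \<union> B))
        + (\<Prod>p\<in>A. 1 / g p) * (\<Prod>p\<in>B. 1 / g p) * R A B"
      by (simp add: r_def algebra_simps)
  qed
  also have "\<dots> = X * (\<Sum>A\<in>D. \<Sum>B\<in>D. l A * l B * gg (A \<union> B))
      + (\<Sum>A\<in>D. \<Sum>B\<in>D. (\<Prod>p\<in>A. 1 / g p) * (\<Prod>p\<in>B. 1 / g p) * R A B)"
    by (simp add: sum.distrib sum_distrib_left)
  finally show ?thesis unfolding main by simp
qed

section \<open>Counting in residue classes\<close>

lemma card_periodic_interval:
  fixes Q :: "nat \<Rightarrow> bool"
  assumes per: "\<And>n. Q (n + e) \<longleftrightarrow> Q n"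
  shows "card {n \<in> {a..<a + e}. Q n} = card {n \<in> {0..<e}. Q n}"
proof (induction a)
  case (Suc a)
  show ?case
  proof (cases "e = 0")
    case False
    have "card {n \<in> {Suc a..<Suc a + e}. Q n} = card ({n \<in> {Suc a..<a + e}. Q n} \<union> {n \<in> {a + e}. Q n})"
      using False by (intro arg_cong[of _ _ card]) auto
    also have "\<dots> = card {n \<in> {Suc a..<a + e}. Q n} + card {n \<in> {a + e}. Q n}"
      by (rule card_Un_disjoint) auto
    also have "card {n \<in> {a + e}. Q n} = card {n \<in> {a}. Q n}"
      using per[of a] by (cases "Q a") (auto simp: Collect_conv_if)
    also have "card {n \<in> {Suc a..<a + e}. Q n} + card {n \<in> {a}. Q n}
       = card ({n \<in> {Suc a..<a + e}. Q n} \<union> {n \<in> {a}. Q n})"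
      by (rule card_Un_disjoint[symmetric]) auto
    also have "{n \<in> {Suc a..<a + e}. Q n} \<union> {n \<in> {a}. Q n} = {n \<in> {a..<a + e}. Q n}"
      using False by auto
    finally show ?thesis using Suc.IH by simp
  qed auto
qed auto

lemma card_periodic_multiple:
  fixes Q :: "nat \<Rightarrow> bool"
  assumes per: "\<And>n. Q (n + e) \<longleftrightarrow> Q n"
  shows "card {n \<in> {a..<a + k * e}. Q n} = k * card {n \<in> {0..<e}. Q n}"
proof (induction k)
  case (Suc k)
  have "{n \<in> {a..<a + Suc k * e}. Q n} = {n \<in> {a..<a + k * e}. Q n} \<union> {n \<in> {a + k * e..<a + k * e + e}. Q n}"
    by auto
  then have "card {n \<in> {a..<a + Suc k * e}. Q n} =
     card {n \<in> {a..<a + k * e}. Q n} + card {n \<in> {a + k * e..<a + k * e + e}. Q n}"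
    by (simp add: card_Un_disjoint disjoint_iff)
  then show ?case using card_periodic_interval[of Q e "a + k * e", OF per] Suc.IH by simp
qed auto

lemma card_periodic_bounds:
  fixes Q :: "nat \<Rightarrow> bool"
  assumes per: "\<And>n. Q (n + e) \<longleftrightarrow> Q n" and e: "e > 0"
  defines "r \<equiv> card {n \<in> {0..<e}. Q n}"
  shows "\<bar>real (card {n \<in> {a..<a + P}. Q n}) - real P * (real r / real e)\<bar> \<le> real e"
proof -
  define k where "k = P div e"
  define c where "c = card {n \<in> {a..<a + P}. Q n}"
  have kP: "k * e \<le> P" "P < Suc k * e"
    unfolding k_def using e by (auto simp: div_times_less_eq_dividend dividend_less_div_times)
  have "k * r \<le> c"
    unfolding c_def r_def card_periodic_multiple[of Q e a k, OF per, symmetric]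
    by (rule card_mono) (use kP in auto)
  moreover have "c \<le> Suc k * r"
    unfolding c_def r_def card_periodic_multiple[of Q e a "Suc k", OF per, symmetric]
    by (rule card_mono) (use kP in auto)
  ultimately have kc: "k * r \<le> c" "c \<le> Suc k * r" by auto
  have c: "real k * real r \<le> real c" "real c \<le> (real k + 1) * real r"
    using kc by (simp_all add: add.commute flip: of_nat_mult of_nat_Suc del: mult_Suc)
  have P: "real k * real e \<le> real P" "real P \<le> (real k + 1) * real e"
    using kP less_imp_le[OF kP(2)] by (simp_all add: add.commute flip: of_nat_mult of_nat_Suc del: mult_Suc)
  have "real k * real r \<le> real P * (real r / real e)"
    using mult_right_mono[OF P(1), of "real r / real e"] e by simp
  moreover have "real P * (real r / real e) \<le> (real k + 1) * real r"
    using mult_right_mono[OF P(2), of "real r / real e"] e by simp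
  moreover have "r \<le> e"
  proof -
    have "r \<le> card {0..<e}" unfolding r_def by (rule card_mono) auto
    then show ?thesis by simp
  qed
  ultimately show ?thesis using c unfolding c_def[symmetric] by (auto simp: abs_le_iff algebra_simps)
qed

text \<open>The Chinese remainder theorem in the form needed for counting: conditions with coprime
  periods are independent.\<close>

lemma card_residues_coprime_mult:
  fixes e p :: nat
  assumes cop: "coprime e p" and pos: "e > 0" "p > 0"
    and per: "\<And>n. Q n \<longleftrightarrow> Q (n mod e)" "\<And>n. S n \<longleftrightarrow> S (n mod p)"
  shows "card {n \<in> {0..<e * p}. Q n \<and> S n} = card {n \<in> {0..<e}. Q n} * card {n \<in> {0..<p}. S n}"
proof -
  have "bij_betw (\<lambda>n. (n mod e, n mod p)) {n \<in> {0..<e * p}. Q n \<and> S n}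
          ({n \<in> {0..<e}. Q n} \<times> {n \<in> {0..<p}. S n})"
  proof (rule bij_betw_imageI)
    show "inj_on (\<lambda>n. (n mod e, n mod p)) {n \<in> {0..<e * p}. Q n \<and> S n}"
    proof (rule inj_onI, clarsimp)
      fix x y assume "x < e * p" "y < e * p" "x mod e = y mod e" "x mod p = y mod p"
      then show "x = y"
        using binary_chinese_remainder_unique_nat[OF cop, of x x] pos
        by (auto simp: cong_def)
    qed
    show "(\<lambda>n. (n mod e, n mod p)) ` {n \<in> {0..<e * p}. Q n \<and> S n} =
        {n \<in> {0..<e}. Q n} \<times> {n \<in> {0..<p}. S n}"
    proof (intro Set.set_eqI iffI)
      fix z assume "z \<in> (\<lambda>n. (n mod e, n mod p)) ` {n \<in> {0..<e * p}. Q n \<and> S n}"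
      then show "z \<in> {n \<in> {0..<e}. Q n} \<times> {n \<in> {0..<p}. S n}"
        using pos per by auto
    next
      fix z assume z: "z \<in> {n \<in> {0..<e}. Q n} \<times> {n \<in> {0..<p}. S n}"
      obtain u v where uv: "z = (u, v)" "u < e" "Q u" "v < p" "S v" using z by auto
      obtain x where x: "x < e * p" "x mod e = u" "x mod p = v"
        using binary_chinese_remainder_unique_nat[OF cop, of u v] pos uv by (auto simp: cong_def)
      then show "z \<in> (\<lambda>n. (n mod e, n mod p)) ` {n \<in> {0..<e * p}. Q n \<and> S n}"
        using uv per by (intro image_eqI[of _ _ x]) auto
    qed
  qed
  from bij_betw_same_card[OF this] show ?thesis by (simp add: card_cartesian_product)
qed

text \<open>For prime p, the number of roots of n (n + h) modulo p: the roots 0 and -h coincide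
  exactly when p divides h.\<close>

definition omega :: "nat \<Rightarrow> nat \<Rightarrow> nat" where
  "omega h p = (if p dvd h then 1 else 2)"

lemma card_roots_mod_prime:
  assumes "prime p"
  shows "card {n \<in> {0..<p}. p dvd n * (n + h)} = omega h p"
proof -
  have p: "p > 0" using assms prime_gt_0_nat by blast
  \<comment> \<open>The representative of -h modulo p among the natural numbers; the outer
    \<open>mod p\<close> is what makes it 0 when p divides h.\<close>
  define m where "m = (p - h mod p) mod p"
  have m: "m < p" using p by (simp add: m_def)
  have *: "p dvd n + h \<longleftrightarrow> n = m" if "n < p" for n
  proof -
    have "[m + h = 0] (mod p)"
    proof -
      have "(m + h) mod p = ((p - h mod p) + h mod p) mod p"
        unfolding m_def by (simp add: mod_add_eq mod_simps)
      also have "\<dots> = 0" using p by (simp add: less_imp_le)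
      finally show ?thesis by (simp add: cong_def)
    qed
    have "p dvd n + h \<longleftrightarrow> [n + h = 0] (mod p)" by (simp add: cong_0_iff)
    also have "\<dots> \<longleftrightarrow> [n + h = m + h] (mod p)"
      using \<open>[m + h = 0] (mod p)\<close> cong_sym cong_trans by blast
    also have "\<dots> \<longleftrightarrow> [n = m] (mod p)" by (rule cong_add_rcancel_nat)
    also have "\<dots> \<longleftrightarrow> n = m" using that m by (simp add: cong_def)
    finally show ?thesis .
  qed
  have set: "{n \<in> {0..<p}. p dvd n * (n + h)} = {0, m}"
  proof -
    have "p dvd n * (n + h) \<longleftrightarrow> n = 0 \<or> n = m" if "n < p" for n
      using that * assms by (auto simp: prime_dvd_mult_iff dvd_imp_le dest: nat_dvd_not_less)
    then show ?thesis using p m by auto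
  qed
  have "m = 0 \<longleftrightarrow> p dvd h"
    using *[of 0] p by auto
  then show ?thesis unfolding set omega_def by auto
qed

lemma card_roots_prod_primes:
  assumes "finite A" "\<And>p. p \<in> A \<Longrightarrow> prime p"
  shows "card {n \<in> {0..<\<Prod>A}. \<forall>p\<in>A. p dvd n * (n + h)} = (\<Prod>p\<in>A. omega h p)"
  using assms
proof (induction A rule: finite_induct)
  case empty
  then show ?case by simp
next
  case (insert p A)
  have pr: "prime p" "\<And>q. q \<in> A \<Longrightarrow> prime q" using insert by auto
  have mod: "p dvd n * (n + h) \<longleftrightarrow> p dvd (n mod e) * (n mod e + h)" if "p dvd e" for p n e :: nat
  proof -
    have "[n mod e = n] (mod p)" using that by (simp add: cong_def mod_mod_cancel)
    then have "[(n mod e) * (n mod e + h) = n * (n + h)] (mod p)"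
      by (intro cong_mult cong_add cong_refl)
    then show ?thesis by (metis cong_dvd_iff)
  qed
  have cop: "coprime (\<Prod>A) p"
  proof (rule prod_coprime_left)
    fix q assume q: "q \<in> A"
    then show "coprime q p" using pr insert.hyps(2) by (metis primes_coprime)
  qed
  have "card {n \<in> {0..<\<Prod>(insert p A)}. \<forall>r\<in>insert p A. r dvd n * (n + h)}
     = card {n \<in> {0..<\<Prod>A * p}. (\<forall>r\<in>A. r dvd n * (n + h)) \<and> p dvd n * (n + h)}"
    using insert.hyps by (intro arg_cong[of _ _ card]) (auto simp: mult.commute)
  also have "\<dots> = card {n \<in> {0..<\<Prod>A}. \<forall>r\<in>A. r dvd n * (n + h)} * card {n \<in> {0..<p}. p dvd n * (n + h)}"
  proof (rule card_residues_coprime_mult[OF cop])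
    show "\<Prod>A > 0" using pr by (auto intro!: prod_pos simp: prime_gt_0_nat)
    show "p > 0" using pr prime_gt_0_nat by blast
    show "(\<forall>r\<in>A. r dvd n * (n + h)) = (\<forall>r\<in>A. r dvd n mod \<Prod>A * (n mod \<Prod>A + h))" for n
      using mod insert.hyps by (meson dvd_prod_eqI)
    show "p dvd n * (n + h) \<longleftrightarrow> p dvd n mod p * (n mod p + h)" for n
      by (rule mod) simp
  qed
  also have "\<dots> = (\<Prod>p\<in>insert p A. omega h p)"
    using insert card_roots_mod_prime[OF pr(1)] by (simp add: mult.commute)
  finally show ?case .
qed

lemma card_roots_interval:
  assumes A: "finite A" "\<And>p. p \<in> A \<Longrightarrow> prime p"
  shows "\<bar>real (card {n \<in> {a..<a + P}. \<forall>p\<in>A. p dvd n * (n + h)}) - real P * (\<Prod>p\<in>A. real (omega h p) / real p)\<bar>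
           \<le> real (\<Prod>A)"
proof -
  have pos: "\<Prod>A > 0" using A by (auto intro!: prod_pos simp: prime_gt_0_nat)
  have per: "(\<forall>p\<in>A. p dvd (n + \<Prod>A) * (n + \<Prod>A + h)) \<longleftrightarrow> (\<forall>p\<in>A. p dvd n * (n + h))" for n
  proof (intro ball_cong refl)
    fix p assume "p \<in> A"
    then have "p dvd \<Prod>A" using A by (meson dvd_prod_eqI)
    then have "[n + \<Prod>A = n] (mod p)" by (simp add: cong_def mod_eq_0_iff_dvd mod_add_right_eq dvd_imp_mod_0 flip: mod_add_right_eq)
    then have "[(n + \<Prod>A) * (n + \<Prod>A + h) = n * (n + h)] (mod p)"
      by (intro cong_mult cong_add cong_refl)
    then show "p dvd (n + \<Prod>A) * (n + \<Prod>A + h) \<longleftrightarrow> p dvd n * (n + h)" by (metis cong_dvd_iff)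
  qed
  have r: "card {n \<in> {0..<\<Prod>A}. \<forall>p\<in>A. p dvd n * (n + h)} = (\<Prod>p\<in>A. omega h p)"
    by (rule card_roots_prod_primes) (use A in auto)
  have eq: "(\<Prod>p\<in>A. real (omega h p) / real p) = real (\<Prod>p\<in>A. omega h p) / real (\<Prod>A)"
    by (simp add: prod_dividef)
  have "\<bar>real (card {n \<in> {a..<a + P}. \<forall>p\<in>A. p dvd n * (n + h)})
      - real P * (real (card {n \<in> {0..<\<Prod>A}. \<forall>p\<in>A. p dvd n * (n + h)}) / real (\<Prod>A))\<bar> \<le> real (\<Prod>A)"
    by (rule card_periodic_bounds[where Q = "\<lambda>n. \<forall>p\<in>A. p dvd n * (n + h)" and e = "\<Prod>A" and a = a, OF per pos])
  then show ?thesis unfolding r eq .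
qed

section \<open>Lower bound for the sieve weights\<close>

text \<open>The completely multiplicative extension of \<open>omega h\<close>, counting prime
  factors with multiplicity. It appears when g/(1 - g) is expanded into a geometric series.\<close>

definition sieve_mult :: "nat \<Rightarrow> nat \<Rightarrow> nat" where
  "sieve_mult h n = prod_mset (image_mset (omega h) (prime_factorization n))"

lemma sieve_mult_1 [simp]: "sieve_mult h (Suc 0) = 1"
  by (simp add: sieve_mult_def)

lemma sieve_mult_prime_times:
  assumes "prime p" "n > 0"
  shows "sieve_mult h (p * n) = omega h p * sieve_mult h n"
proof -
  have "p \<noteq> 0" using assms by auto
  then have "prime_factorization (p * n) = prime_factorization p + prime_factorization n"
    using assms by (intro prime_factorization_mult) auto
  then show ?thesis by (simp add: sieve_mult_def prime_factorization_prime[OF assms(1)])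
qed

text \<open>Multiplying n by a prime p at most doubles the number of divisors, and adds no divisor
  coprime to h if p divides h. The divisor count is what a product of two harmonic sums can be
  compared with.\<close>

lemma card_divisors_coprime_le_sieve_mult:
  assumes "n > 0"
  shows "card {b. b dvd n \<and> coprime b h} \<le> sieve_mult h n"
  using assms
proof (induction n rule: prime_divisors_induct)
  case (factor p n)
  have n: "n > 0" using factor by auto
  let ?D = "\<lambda>n. {b. b dvd n \<and> coprime b h}"
  have fin: "finite (?D n)" using n by auto
  have ph: "p \<noteq> 0" using factor by auto
  have split: "b dvd n \<or> (\<exists>b'. b = p * b' \<and> b' dvd n)" if "b dvd p * n" for b
  proof (cases "p dvd b")
    case True
    then obtain b' where "b = p * b'" by auto
    then show ?thesis using that ph by auto
  next
    case False
    then have "coprime b p" using factor by (metis coprime_commute prime_imp_coprime)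
    then show ?thesis using that coprime_dvd_mult_right_iff by blast
  qed
  have "card (?D (p * n)) \<le> omega h p * card (?D n)"
  proof (cases "p dvd h")
    case True
    have "?D (p * n) \<subseteq> ?D n"
    proof
      fix b assume b: "b \<in> ?D (p * n)"
      have "\<not> p dvd b" using b True factor by (metis (lifting) coprime_common_divisor mem_Collect_eq not_prime_unit)
      then show "b \<in> ?D n" using b split[of b] by auto
    qed
    then show ?thesis using fin True by (simp add: omega_def card_mono)
  next
    case False
    have "?D (p * n) \<subseteq> ?D n \<union> (\<lambda>b. p * b) ` ?D n"
    proof
      fix b assume b: "b \<in> ?D (p * n)"
      then consider "b dvd n" | b' where "b = p * b'" "b' dvd n" using split[of b] by auto
      then show "b \<in> ?D n \<union> (\<lambda>b. p * b) ` ?D n"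
        by cases (use b in auto)
    qed
    then have "card (?D (p * n)) \<le> card (?D n \<union> (\<lambda>b. p * b) ` ?D n)"
      using fin by (intro card_mono) auto
    also have "\<dots> \<le> card (?D n) + card ((\<lambda>b. p * b) ` ?D n)" by (rule card_Un_le)
    also have "\<dots> \<le> card (?D n) + card (?D n)" using fin by (simp add: card_image_le)
    finally show ?thesis using False by (simp add: omega_def)
  qed
  also have "\<dots> \<le> omega h p * sieve_mult h n" using factor n by (intro mult_left_mono) auto
  finally show ?case using sieve_mult_prime_times[of p n h] factor n by simp
next
  case (unit n)
  have "card {b. b dvd n \<and> coprime b h} \<le> card {1::nat}"
    using unit by (intro card_mono) auto
  then show ?case using unit by simp
qed auto

definition sieve_density :: "nat \<Rightarrow> nat \<Rightarrow> real" where
  "sieve_density h p = real (omega h p) / real p"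

text \<open>Only odd primes can sift: for p = 2 and odd h both residues are roots, the density is 1
  and g/(1 - g) degenerates.\<close>

lemma sieve_density_bounds:
  assumes "prime p" "odd p"
  shows "0 < sieve_density h p" "sieve_density h p < 1"
proof -
  have "p \<ge> 2" using assms prime_ge_2_nat by auto
  then have "p \<ge> 3" using assms by (cases "p = 2") auto
  then show "0 < sieve_density h p" "sieve_density h p < 1" by (auto simp: sieve_density_def omega_def)
qed

lemma prod_primes_pos:
  assumes "finite A" "\<And>p. p \<in> A \<Longrightarrow> prime (p::nat)"
  shows "\<Prod>A > 0"
  using assms by (auto intro!: prod_pos simp: prime_gt_0_nat)

text \<open>Expanding g/(1 - g) = g + g^2 + ... in the product over A gives the terms of all n whose
  set of prime factors is A, and the radical of any n \<le> z is at most z. The induction over Q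
  avoids infinite series: only the identity g (1 + c) = c for c = g/(1 - g) is needed.\<close>

lemma sum_sieve_mult_le:
  assumes "finite Q" "\<And>p. p \<in> Q \<Longrightarrow> prime p" "\<And>p. p \<in> Q \<Longrightarrow> odd p"
  shows "(\<Sum>n | n \<in> {1..z} \<and> prime_factors n \<subseteq> Q. real (sieve_mult h n) / real n)
     \<le> (\<Sum>A | A \<subseteq> Q \<and> \<Prod>A \<le> z. \<Prod>p\<in>A. sieve_density h p / (1 - sieve_density h p))"
  using assms
proof (induction Q arbitrary: z rule: finite_induct)
  case empty
  have "{n. n \<in> {1..z} \<and> prime_factors n \<subseteq> {}} = (if z \<ge> 1 then {1} else {})"
    by (auto simp: prime_factorization_empty_iff)
  moreover have "{A. A \<subseteq> {} \<and> \<Prod>A \<le> z} = (if z \<ge> 1 then {{}} else {})" by auto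
  ultimately show ?case by simp
next
  case (insert p Q)
  let ?g = "sieve_density h"
  define c where "c q = ?g q / (1 - ?g q)" for q
  define K where "K Q z = (\<Sum>n | n \<in> {1..z} \<and> prime_factors n \<subseteq> Q. real (sieve_mult h n) / real n)" for Q z
  define J where "J Q z = (\<Sum>A | A \<subseteq> Q \<and> \<Prod>A \<le> z. \<Prod>p\<in>A. c p)" for Q z
  have pr: "prime p" "odd p" and prQ: "\<And>q. q \<in> Q \<Longrightarrow> prime q" "\<And>q. q \<in> Q \<Longrightarrow> odd q" using insert by auto
  have p2: "p \<ge> 2" using pr prime_ge_2_nat by auto
  have IH: "K Q z \<le> J Q z" for z
    unfolding K_def J_def c_def by (rule insert.IH) (use prQ in auto)
  have cpos: "c q > 0" if "q \<in> insert p Q" for q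
    unfolding c_def using sieve_density_bounds[of q h] that pr prQ by (auto intro!: divide_pos_pos)
  have finP: "finite {A. A \<subseteq> Q \<and> \<Prod>A \<le> z}" for z using insert.hyps by auto
  have Jmono: "J Q z \<le> J Q w" if "z \<le> w" for z w
    unfolding J_def using finP that cpos
    by (intro sum_mono2) (auto intro!: prod_nonneg less_imp_le[OF cpos])
  have Jstep: "J (insert p Q) z = J Q z + c p * J Q (z div p)" for z
  proof -
    have eq: "{A. A \<subseteq> insert p Q \<and> \<Prod>A \<le> z} = {A. A \<subseteq> Q \<and> \<Prod>A \<le> z} \<union> insert p ` {A. A \<subseteq> Q \<and> \<Prod>A \<le> z div p}"
      (is "?L = ?R1 \<union> ?R2")
    proof (intro Set.set_eqI iffI)
      fix A assume A: "A \<in> ?L"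
      show "A \<in> ?R1 \<union> ?R2"
      proof (cases "p \<in> A")
        case True
        define B where "B = A - {p}"
        have B: "A = insert p B" "p \<notin> B" "B \<subseteq> Q" using A True by (auto simp: B_def)
        have "finite B" using B insert.hyps finite_subset by blast
        then have "p * \<Prod>B \<le> z" using A B by simp
        then have "\<Prod>B \<le> z div p" using p2 by (simp add: less_eq_div_iff_mult_less_eq mult.commute)
        then show ?thesis using B by blast
      qed (use A in auto)
    next
      fix A assume "A \<in> ?R1 \<union> ?R2"
      then consider "A \<in> ?R1" | B where "A = insert p B" "B \<subseteq> Q" "\<Prod>B \<le> z div p" by auto
      then show "A \<in> ?L"
      proof cases
        case 2
        then have "finite B" "p \<notin> B" using insert.hyps finite_subset by blast+
        moreover have "p * \<Prod>B \<le> z" using 2 p2 by (simp add: less_eq_div_iff_mult_less_eq mult.commute)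
        ultimately show ?thesis using 2 by auto
      qed auto
    qed
    have "J (insert p Q) z = J Q z + (\<Sum>A\<in>?R2. \<Prod>p\<in>A. c p)"
      unfolding J_def eq by (rule sum.union_disjoint) (use finP insert.hyps in auto)
    also have "(\<Sum>A\<in>?R2. \<Prod>p\<in>A. c p) = (\<Sum>A | A \<subseteq> Q \<and> \<Prod>A \<le> z div p. \<Prod>q\<in>insert p A. c q)"
      by (rule sum.reindex_cong[OF _ refl refl]) (use insert.hyps in \<open>auto intro!: inj_onI dest!: insert_ident[THEN iffD1, rotated -1]\<close>)
    also have "\<dots> = (\<Sum>A | A \<subseteq> Q \<and> \<Prod>A \<le> z div p. c p * (\<Prod>q\<in>A. c q))"
    proof (rule sum.cong[OF refl])
      fix A assume "A \<in> {A. A \<subseteq> Q \<and> \<Prod>A \<le> z div p}"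
      then have "finite A" "p \<notin> A" using insert.hyps finite_subset by blast+
      then show "(\<Prod>q\<in>insert p A. c q) = c p * (\<Prod>q\<in>A. c q)" by simp
    qed
    finally show ?thesis by (simp add: J_def sum_distrib_left)
  qed
  \<comment> \<open>Unlike in \<open>Jstep\<close>, the cofactor of p may again be divisible by p,
    so the recursion keeps the set \<open>insert p Q\<close>; this is why an inner induction on z
    follows.\<close>
  have Kstep: "K (insert p Q) z = K Q z + ?g p * K (insert p Q) (z div p)" for z
  proof -
    let ?L = "{n. n \<in> {1..z} \<and> prime_factors n \<subseteq> insert p Q}"
    let ?M = "{n. n \<in> {1..z div p} \<and> prime_factors n \<subseteq> insert p Q}"
    have eq: "?L = {n. n \<in> {1..z} \<and> prime_factors n \<subseteq> Q} \<union> (\<lambda>n. p * n) ` ?M"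
    proof (intro Set.set_eqI iffI)
      fix n assume n: "n \<in> ?L"
      show "n \<in> {n. n \<in> {1..z} \<and> prime_factors n \<subseteq> Q} \<union> (\<lambda>n. p * n) ` ?M"
      proof (cases "p dvd n")
        case True
        then obtain m where m: "n = p * m" by auto
        have "m > 0" using n m by (cases m) auto
        then have "prime_factors m \<subseteq> prime_factors n" using n m by (intro dvd_prime_factors) auto
        moreover have "m \<le> z div p" using n m p2 by (simp add: less_eq_div_iff_mult_less_eq mult.commute)
        ultimately have "m \<in> ?M" using n \<open>m > 0\<close> by auto
        then show ?thesis using m by blast
      next
        case False
        then have "p \<notin> prime_factors n" by auto
        then show ?thesis using n by auto
      qed
    next
      fix n assume "n \<in> {n. n \<in> {1..z} \<and> prime_factors n \<subseteq> Q} \<union> (\<lambda>n. p * n) ` ?M"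
      then consider "n \<in> {n. n \<in> {1..z} \<and> prime_factors n \<subseteq> Q}" | m where "n = p * m" "m \<in> ?M" by auto
      then show "n \<in> ?L"
      proof cases
        case 2
        have "prime_factors (p * m) = insert p (prime_factors m)"
          using 2 pr p2 by (subst prime_factors_product) (auto simp: prime_prime_factors)
        moreover have "p * m \<le> z" using 2 p2 by (simp add: less_eq_div_iff_mult_less_eq mult.commute)
        ultimately show ?thesis using 2 p2 by auto
      qed auto
    qed
    have "K (insert p Q) z = K Q z + (\<Sum>n\<in>(\<lambda>n. p * n) ` ?M. real (sieve_mult h n) / real n)"
      unfolding K_def eq
    proof (rule sum.union_disjoint)
      show "{n \<in> {1..z}. prime_factors n \<subseteq> Q} \<inter> (\<lambda>n. p * n) ` ?M = {}"
      proof (rule equals0I)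
        fix n assume "n \<in> {n \<in> {1..z}. prime_factors n \<subseteq> Q} \<inter> (\<lambda>n. p * n) ` ?M"
        then obtain m where "n = p * m" "n > 0" "prime_factors n \<subseteq> Q" by auto
        then have "p \<in> prime_factors n" using pr by (intro prime_factorsI) auto
        then show False using \<open>prime_factors n \<subseteq> Q\<close> insert.hyps by auto
      qed
    qed auto
    also have "(\<Sum>n\<in>(\<lambda>n. p * n) ` ?M. real (sieve_mult h n) / real n) = (\<Sum>n\<in>?M. real (sieve_mult h (p * n)) / real (p * n))"
      by (rule sum.reindex_cong[OF _ refl refl]) (use p2 in \<open>auto intro!: inj_onI\<close>)
    also have "\<dots> = (\<Sum>n\<in>?M. ?g p * (real (sieve_mult h n) / real n))"
      by (rule sum.cong[OF refl]) (use pr in \<open>auto simp: sieve_mult_prime_times sieve_density_def\<close>)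
    also have "\<dots> = ?g p * K (insert p Q) (z div p)" by (simp add: K_def sum_distrib_left)
    finally show ?thesis .
  qed
  have "K (insert p Q) z \<le> J (insert p Q) z" for z
  proof (induction z rule: less_induct)
    case (less z)
    show ?case
    proof (cases "z = 0")
      case True
      then have "K (insert p Q) z = 0" by (simp add: K_def)
      moreover have "J (insert p Q) z \<ge> 0" unfolding J_def
        by (intro sum_nonneg prod_nonneg) (auto intro: less_imp_le[OF cpos])
      ultimately show ?thesis by simp
    next
      case False
      define w where "w = z div p"
      have "w < z" using False p2 by (simp add: w_def)
      have gb: "0 < ?g p" "?g p < 1" using sieve_density_bounds[OF pr] by auto
      have "K (insert p Q) w \<le> J (insert p Q) w" using less \<open>w < z\<close> by auto
      also have "\<dots> \<le> J Q w + c p * J Q w"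
        unfolding Jstep using cpos[of p] by (intro add_mono mult_left_mono Jmono) auto
      finally have "?g p * K (insert p Q) w \<le> ?g p * (J Q w + c p * J Q w)" using gb by (intro mult_left_mono) auto
      also have "\<dots> = (?g p * (1 + c p)) * J Q w" by (simp add: algebra_simps)
      also have "?g p * (1 + c p) = c p" using gb by (simp add: c_def field_simps)
      finally have "K (insert p Q) z \<le> J Q z + c p * J Q w"
        unfolding Kstep[of z] w_def[symmetric] using IH[of z] by linarith
      then show ?thesis by (simp add: Jstep w_def)
    qed
  qed
  then show ?case by (simp add: K_def J_def c_def)
qed

text \<open>The multiples of p contribute at most 1/p of the sum, so removing them costs at most the
  factor 1 - 1/p. This is applied to one prime after another.\<close>

lemma harmonic_le_sum_coprime:
  assumes "finite S" "\<And>p. p \<in> S \<Longrightarrow> prime p"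
  shows "(\<Sum>b = 1..y. 1 / real b) \<le> (\<Sum>b | b \<in> {1..y} \<and> (\<forall>p\<in>S. \<not> p dvd b). 1 / real b) * (\<Prod>p\<in>S. real p / (real p - 1))"
  using assms
proof (induction S rule: finite_induct)
  case empty
  have "{b. b \<in> {1..y} \<and> (\<forall>p\<in>{}. \<not> p dvd b)} = {1..y}" by auto
  then show ?case by (simp del: Collect_mem_eq)
next
  case (insert p S)
  define H where "H S y = (\<Sum>b | b \<in> {1..y} \<and> (\<forall>p\<in>S. \<not> p dvd b). 1 / real b)" for S y
  have pr: "prime p" "\<And>q. q \<in> S \<Longrightarrow> prime q" using insert by auto
  have p2: "p \<ge> 2" using pr prime_ge_2_nat by auto
  have "H S y = H (insert p S) y + (\<Sum>b | b \<in> {1..y} \<and> (\<forall>p\<in>S. \<not> p dvd b) \<and> p dvd b. 1 / real b)"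
    unfolding H_def by (subst sum.union_disjoint[symmetric]) (auto intro!: sum.cong)
  also have "(\<Sum>b | b \<in> {1..y} \<and> (\<forall>p\<in>S. \<not> p dvd b) \<and> p dvd b. 1 / real b)
     \<le> (\<Sum>b\<in>(\<lambda>b. p * b) ` {b. b \<in> {1..y} \<and> (\<forall>p\<in>S. \<not> p dvd b)}. 1 / real b)"
  proof (rule sum_mono2)
    show "{b \<in> {1..y}. (\<forall>p\<in>S. \<not> p dvd b) \<and> p dvd b} \<subseteq> (\<lambda>b. p * b) ` {b \<in> {1..y}. \<forall>p\<in>S. \<not> p dvd b}"
    proof
      fix b assume b: "b \<in> {b \<in> {1..y}. (\<forall>p\<in>S. \<not> p dvd b) \<and> p dvd b}"
      then obtain m where m: "b = p * m" by auto
      have "m \<ge> 1" using b m by (cases m) auto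
      moreover have "m \<le> y" using b m p2 by (auto intro: order_trans[of m "p * m"])
      ultimately have "m \<in> {b \<in> {1..y}. \<forall>p\<in>S. \<not> p dvd b}" using b m by auto
      then show "b \<in> (\<lambda>b. p * b) ` {b \<in> {1..y}. \<forall>p\<in>S. \<not> p dvd b}" using m by blast
    qed
  qed auto
  also have "(\<Sum>b\<in>(\<lambda>b. p * b) ` {b. b \<in> {1..y} \<and> (\<forall>p\<in>S. \<not> p dvd b)}. 1 / real b)
     = (\<Sum>b | b \<in> {1..y} \<and> (\<forall>p\<in>S. \<not> p dvd b). 1 / real (p * b))"
    by (rule sum.reindex_cong[OF _ refl refl]) (use p2 in \<open>auto intro!: inj_onI\<close>)
  also have "\<dots> = 1 / real p * H S y" by (simp add: H_def sum_distrib_left)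
  finally have "H S y * (1 - 1 / real p) \<le> H (insert p S) y" by (simp add: algebra_simps)
  then have *: "H S y \<le> H (insert p S) y * (real p / (real p - 1))"
    using p2 by (simp add: field_simps)
  have "(\<Prod>p\<in>S. real p / (real p - 1)) \<ge> 0"
  proof (rule prod_nonneg)
    fix q assume "q \<in> S"
    then have "q \<ge> 2" using pr(2) prime_ge_2_nat by auto
    then show "0 \<le> real q / (real q - 1)" by simp
  qed
  then have "H S y * (\<Prod>p\<in>S. real p / (real p - 1)) \<le> H (insert p S) y * (real p / (real p - 1)) * (\<Prod>p\<in>S. real p / (real p - 1))"
    using * by (intro mult_right_mono)
  moreover have "(\<Sum>b = 1..y. 1 / real b) \<le> H S y * (\<Prod>p\<in>S. real p / (real p - 1))"
    unfolding H_def using insert.IH pr by auto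
  ultimately show ?case using insert.hyps by (simp add: H_def mult.assoc)
qed

section \<open>Pairs of primes\<close>

text \<open>For n > 0 this is n / phi(n).\<close>

definition inv_totient_ratio :: "nat \<Rightarrow> real" where
  "inv_totient_ratio n = (\<Prod>p\<in>prime_factors n. real p / (real p - 1))"

lemma inv_totient_ratio_ge_1: "inv_totient_ratio n \<ge> 1"
  unfolding inv_totient_ratio_def
  by (rule prod_ge_1) (auto dest!: in_prime_factors_imp_prime prime_ge_2_nat simp: field_simps)

lemma ln_le_sum_coprime:
  assumes "m > 0"
  shows "ln (real y + 1) \<le> (\<Sum>b | b \<in> {1..y} \<and> coprime b m. 1 / real b) * inv_totient_ratio m"
proof -
  have "ln (real y + 1) \<le> (\<Sum>b = 1..y. 1 / real b)"
  proof (induction y)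
    case (Suc y)
    have "ln (real y + 2) - ln (real y + 1) = ln (1 + 1 / (real y + 1))"
    proof -
      have "1 + 1 / (real y + 1) = (real y + 2) / (real y + 1)" by (simp add: field_simps)
      then show ?thesis by (simp add: ln_div)
    qed
    also have "\<dots> \<le> 1 / (real y + 1)" by (rule ln_add_one_self_le_self) auto
    finally show ?case using Suc by (simp add: add_ac)
  qed auto
  also have "\<dots> \<le> (\<Sum>b | b \<in> {1..y} \<and> (\<forall>p\<in>prime_factors m. \<not> p dvd b). 1 / real b) * inv_totient_ratio m"
    unfolding inv_totient_ratio_def by (rule harmonic_le_sum_coprime) auto
  also have "{b. b \<in> {1..y} \<and> (\<forall>p\<in>prime_factors m. \<not> p dvd b)} = {b. b \<in> {1..y} \<and> coprime b m}"
  proof (intro Set.set_eqI iffI)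
    fix b assume b: "b \<in> {b. b \<in> {1..y} \<and> (\<forall>p\<in>prime_factors m. \<not> p dvd b)}"
    have "coprime b m"
    proof (rule ccontr)
      assume "\<not> coprime b m"
      then obtain p where "prime p" "p dvd gcd b m"
        by (metis coprime_iff_gcd_eq_1 prime_factor_nat)
      then show False using b assms by (auto simp: prime_factors_dvd)
    qed
    then show "b \<in> {b. b \<in> {1..y} \<and> coprime b m}" using b by auto
  next
    fix b assume b: "b \<in> {b. b \<in> {1..y} \<and> coprime b m}"
    have "\<not> p dvd b" if p: "p \<in> prime_factors m" for p
      using b p by (metis (no_types, lifting) coprime_common_divisor in_prime_factors_iff mem_Collect_eq not_prime_unit)
    then show "b \<in> {b. b \<in> {1..y} \<and> (\<forall>p\<in>prime_factors m. \<not> p dvd b)}" using b by auto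
  qed
  finally show ?thesis .
qed

text \<open>An odd n has at most as many factorisations n = a b with b coprime to h as it has such
  divisors b, hence at most \<open>sieve_mult h n\<close>. Each of the two harmonic sums yields a
  logarithm, and only the second one loses the factor 2h/phi(2h).\<close>

lemma sum_product_le_sum_sieve_mult:
  assumes "y * y \<le> z"
  shows "(\<Sum>a | a \<in> {1..y} \<and> odd a. 1 / real a) * (\<Sum>b | b \<in> {1..y} \<and> coprime b (2 * h). 1 / real b)
      \<le> (\<Sum>n | n \<in> {1..z} \<and> odd n. real (sieve_mult h n) / real n)"
proof -
  let ?A = "{a. a \<in> {1..y} \<and> odd a}" and ?B = "{b. b \<in> {1..y} \<and> coprime b (2 * h)}"
  let ?S = "?A \<times> ?B"
  have img: "(\<lambda>(a,b). a * b) ` ?S \<subseteq> {n. n \<in> {1..z} \<and> odd n}"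
  proof -
    have "a * b \<in> {n. n \<in> {1..z} \<and> odd n}" if *: "a \<in> ?A" "b \<in> ?B" for a b
    proof -
      have "a * b \<le> y * y" using * by (intro mult_mono) auto
      moreover have "odd b" using * by (auto simp: coprime_mult_right_iff coprime_right_2_iff_odd)
      ultimately show ?thesis using * assms by auto
    qed
    then show ?thesis by auto
  qed
  have "(\<Sum>a\<in>?A. 1 / real a) * (\<Sum>b\<in>?B. 1 / real b) = (\<Sum>x\<in>?S. 1 / real (fst x * snd x))"
    by (simp add: sum_product sum.cartesian_product case_prod_unfold)
  also have "\<dots> = (\<Sum>n | n \<in> {1..z} \<and> odd n. \<Sum>x | x \<in> ?S \<and> fst x * snd x = n. 1 / real (fst x * snd x))"
    using img by (subst sum.group) (auto simp: case_prod_unfold)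
  also have "\<dots> \<le> (\<Sum>n | n \<in> {1..z} \<and> odd n. real (sieve_mult h n) / real n)"
  proof (rule sum_mono)
    fix n assume n: "n \<in> {n. n \<in> {1..z} \<and> odd n}"
    have "card {x. x \<in> ?S \<and> fst x * snd x = n} \<le> card {b. b dvd n \<and> coprime b h}"
    proof (rule card_inj_on_le[of snd])
      show "inj_on snd {x. x \<in> ?S \<and> fst x * snd x = n}"
        by (auto intro!: inj_onI)
      show "finite {b. b dvd n \<and> coprime b h}" using n by auto
    qed auto
    also have "\<dots> \<le> sieve_mult h n" using n by (intro card_divisors_coprime_le_sieve_mult) auto
    finally have c: "card {x. x \<in> ?S \<and> fst x * snd x = n} \<le> sieve_mult h n" .
    have "(\<Sum>x | x \<in> ?S \<and> fst x * snd x = n. 1 / real (fst x * snd x)) = (\<Sum>x | x \<in> ?S \<and> fst x * snd x = n. 1 / real n)"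
      by (rule sum.cong) auto
    also have "\<dots> = real (card {x. x \<in> ?S \<and> fst x * snd x = n}) / real n" by simp
    also have "\<dots> \<le> real (sieve_mult h n) / real n" using c by (intro divide_right_mono) auto
    finally show "(\<Sum>x | x \<in> ?S \<and> fst x * snd x = n. 1 / real (fst x * snd x)) \<le> real (sieve_mult h n) / real n" .
  qed
  finally show ?thesis .
qed

lemma ex_nat_root_bounds:
  assumes "k > 0"
  shows "\<exists>z::nat. z ^ k \<le> P \<and> P < (z + 1) ^ k"
proof (induction P)
  case 0
  then show ?case using assms by (intro exI[of _ 0]) auto
next
  case (Suc P)
  then obtain z where z: "z ^ k \<le> P" "P < (z + 1) ^ k" by auto
  show ?case
  proof (cases "Suc P < (z + 1) ^ k")
    case False
    then have "Suc P = (z + 1) ^ k" using z by auto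
    moreover have "(z + 1) ^ k < (z + 2) ^ k" using assms by (intro power_strict_mono) auto
    ultimately show ?thesis by (intro exI[of _ "z + 1"]) auto
  qed (use z in \<open>auto intro!: exI[of _ z]\<close>)
qed

lemma ln_square_le_sqrt:
  assumes "x \<ge> (1::real)"
  shows "(ln x)\<^sup>2 \<le> 16 * sqrt x"
proof -
  define t where "t = sqrt (sqrt x)"
  have t: "t \<ge> 1" using assms by (simp add: t_def)
  have x: "sqrt x = t ^ 2" using assms by (simp add: t_def)
  then have "x = t ^ 4"
    using assms by (metis (no_types, lifting) add_self_div_2 numeral_Bit0 power2_eq_square power_add real_sqrt_pow2 zero_le_one order_trans)
  then have "ln x = 4 * ln t" using t by (simp add: ln_realpow)
  moreover have "0 \<le> ln t" "ln t \<le> t" using t ln_le_minus_one[of t] by auto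
  ultimately have "(ln x)\<^sup>2 \<le> (4 * t)\<^sup>2" by (intro power_mono) auto
  then show ?thesis by (simp add: x power_mult_distrib)
qed

text \<open>The Selberg sieve for n (n + h) over the odd primes up to z. The constant is 1152 = 48 *
  24 from the main term plus 16 from the remainder.\<close>

theorem prime_pairs_upper_bound:
  assumes P: "P \<ge> 2" and h: "h > 0"
  shows "real (card {n \<in> {P..<P + P}. prime n \<and> prime (n + h)})
    \<le> 1168 * real P / (ln (real P))\<^sup>2 * inv_totient_ratio (2 * h)"
proof -
  \<comment> \<open>With z about P^(1/12) the remainder, at most z^6, stays below sqrt P. With y
    about sqrt z = P^(1/24) a product of two numbers up to y does not exceed z.\<close>
  obtain z where z: "z ^ 12 \<le> P" "P < (z + 1) ^ 12" using ex_nat_root_bounds[of 12 P] by auto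
  obtain y where y: "y ^ 2 \<le> z" "z < (y + 1) ^ 2" using ex_nat_root_bounds[of 2 z] by auto
  have z1: "z \<ge> 1" using z P by (cases z) auto
  have y1: "y \<ge> 1" using y z1 by (cases y) auto
  have zP: "z < P"
  proof (cases "z = 1")
    case False
    then have "z ^ 1 < z ^ 12" using z1 by (intro power_strict_increasing) auto
    then show ?thesis using z by simp
  qed (use P in auto)
  define Pr where "Pr = {p. prime p \<and> odd p \<and> p \<le> z}"
  define D where "D = {A. A \<subseteq> Pr \<and> \<Prod>A \<le> z}"
  let ?g = "sieve_density h"
  define E where "E n = {p. p dvd n * (n + h)}" for n
  define J where "J = (\<Sum>A\<in>D. \<Prod>p\<in>A. ?g p / (1 - ?g p))"
  define W where "W = inv_totient_ratio (2 * h)"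
  have finPr: "finite Pr" unfolding Pr_def by (rule finite_subset[of _ "{..z}"]) auto
  have prA: "finite A" "\<And>p. p \<in> A \<Longrightarrow> prime p" if "A \<in> D" for A
    using that finite_subset[OF _ finPr, of A] by (auto simp: D_def, auto simp: Pr_def)
  have DPow: "D \<subseteq> Pow Pr" by (auto simp: D_def)
  have finD: "finite D" using DPow finPr finite_subset by blast
  have posA: "\<Prod>A > 0" if "A \<in> D" for A using prod_primes_pos prA[OF that] by blast
  have W1: "W \<ge> 1" unfolding W_def by (rule inv_totient_ratio_ge_1)
  have sieve: "real (card {n \<in> {P..<P + P}. E n \<inter> Pr = {}}) \<le>
           real P / J + (\<Sum>A\<in>D. \<Sum>B\<in>D. (\<Prod>p\<in>A. 1 / ?g p) * (\<Prod>p\<in>B. 1 / ?g p) * (real (\<Prod>A) * real (\<Prod>B)))"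
    unfolding J_def
  proof (rule selberg_sieve[OF finPr])
    show "{} \<in> D" using z1 by (simp add: D_def)
    show "B \<in> D" if "A \<in> D" "B \<subseteq> A" for A B
    proof -
      have "\<Prod>B \<le> \<Prod>A"
        by (intro dvd_imp_le prod_dvd_prod_subset) (use that prA[OF that(1)] posA[OF that(1)] in auto)
      then show ?thesis using that by (auto simp: D_def)
    qed
    show "\<bar>real (card {n \<in> {P..<P + P}. A \<union> B \<subseteq> E n}) - real P * prod ?g (A \<union> B)\<bar> \<le> real (\<Prod>A) * real (\<Prod>B)"
      if AB: "A \<in> D" "B \<in> D" for A B
    proof -
      have fin: "finite (A \<union> B)" and pr: "\<And>p. p \<in> A \<union> B \<Longrightarrow> prime p" using prA AB by auto
      have "\<bar>real (card {n \<in> {P..<P + P}. A \<union> B \<subseteq> E n}) - real P * prod ?g (A \<union> B)\<bar> \<le> real (\<Prod>(A \<union> B))"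
        using card_roots_interval[OF fin pr, of P P h]
        by (simp add: E_def subset_iff sieve_density_def Ball_def)
      also have "\<Prod>(A \<union> B) \<le> \<Prod>A * \<Prod>B"
      proof -
        have "\<Prod>(A \<union> B) * 1 \<le> \<Prod>(A \<union> B) * \<Prod>(A \<inter> B)"
          using prod_primes_pos[of "A \<inter> B"] prA AB by (intro mult_left_mono) (auto simp: Suc_le_eq)
        also have "\<dots> = \<Prod>A * \<Prod>B" by (rule prod.union_inter) (use prA AB in auto)
        finally show ?thesis by simp
      qed
      finally show ?thesis by (simp only: of_nat_mult)
    qed
  qed (use DPow sieve_density_bounds in \<open>auto simp: Pr_def\<close>)
  have cardD: "real (card D) \<le> real z"
  proof -
    have "card D \<le> card {1..z}"
    proof (rule card_inj_on_le[of Prod])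
      show "inj_on \<Prod> D"
      proof (rule inj_onI)
        fix A B assume AB: "A \<in> D" "B \<in> D" "\<Prod>A = \<Prod>B"
        have pf: "prime_factors (\<Prod>A) = A" if "A \<in> D" for A
        proof -
          have "0 \<notin> A" using prA(2)[OF that, of 0] by auto
          then show ?thesis
          using prime_factors_prod[OF prA(1)[OF that], of "\<lambda>x. x"] prA[OF that]
          by (auto simp: prime_prime_factors)
        qed
        show "A = B" using pf[OF AB(1)] pf[OF AB(2)] AB(3) by metis
      qed
      show "Prod ` D \<subseteq> {1..z}" using posA by (auto simp: D_def Suc_le_eq)
    qed auto
    then show ?thesis by simp
  qed
  \<comment> \<open>Each of the four factors of a term is at most z, and D has at most z elements
    because its sets of primes are determined by their products.\<close>
  have rem: "(\<Sum>A\<in>D. \<Sum>B\<in>D. (\<Prod>p\<in>A. 1 / ?g p) * (\<Prod>p\<in>B. 1 / ?g p) * (real (\<Prod>A) * real (\<Prod>B))) \<le> real z ^ 6"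
  proof -
    have b: "(\<Prod>p\<in>A. 1 / ?g p) \<le> real z \<and> (\<Prod>p\<in>A. 1 / ?g p) \<ge> 0" if A: "A \<in> D" for A
    proof -
      have gp: "?g p > 0" "1 / ?g p \<le> real p" if "p \<in> A" for p
        using prA(2)[OF A that] by (auto simp: sieve_density_def omega_def prime_gt_0_nat)
      have "(\<Prod>p\<in>A. 1 / ?g p) \<le> (\<Prod>p\<in>A. real p)"
        using gp by (intro prod_mono) (auto intro: less_imp_le)
      also have "\<dots> = real (\<Prod>A)" by simp
      also have "\<dots> \<le> real z" using A unfolding D_def by (simp del: of_nat_prod)
      finally show ?thesis using gp by (auto intro!: prod_nonneg intro: less_imp_le)
    qed
    have b2: "real (\<Prod>A) \<le> real z" if "A \<in> D" for A using that unfolding D_def by (simp del: of_nat_prod)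
    have "(\<Sum>A\<in>D. \<Sum>B\<in>D. (\<Prod>p\<in>A. 1 / ?g p) * (\<Prod>p\<in>B. 1 / ?g p) * (real (\<Prod>A) * real (\<Prod>B)))
       \<le> (\<Sum>A\<in>D. \<Sum>B\<in>D. (real z * real z) * (real z * real z))"
      using b b2 by (intro sum_mono mult_mono) (auto simp del: of_nat_prod)
    also have "\<dots> = real (card D) * real (card D) * real z ^ 4" by (simp add: eval_nat_numeral)
    also have "\<dots> \<le> real z * real z * real z ^ 4" using cardD by (intro mult_right_mono mult_mono) auto
    finally show ?thesis by (simp add: eval_nat_numeral)
  qed
  \<comment> \<open>Both harmonic sums reach about ln P / 24; restricting to odd a costs a factor 2,
    restricting to b coprime to 2h costs W.\<close>
  have J: "(ln (real P))\<^sup>2 / (1152 * W) \<le> J"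
  proof -
    define S1 where "S1 = (\<Sum>a | a \<in> {1..y} \<and> odd a. 1 / real a)"
    define S2 where "S2 = (\<Sum>b | b \<in> {1..y} \<and> coprime b (2 * h). 1 / real b)"
    have "real P \<le> (real y + 1) ^ 24"
    proof -
      have "z + 1 \<le> (y + 1) ^ 2" using y by simp
      then have "(z + 1) ^ 12 \<le> ((y + 1) ^ 2) ^ 12" by (intro power_mono) auto
      also have "((y + 1) ^ 2) ^ 12 = (y + 1) ^ 24" by (simp only: power_mult[symmetric]) simp
      finally have "P \<le> (y + 1) ^ 24" using z(2) by linarith
      then have "real P \<le> real ((y + 1) ^ 24)" by (simp only: of_nat_le_iff)
      then show ?thesis by (simp add: add.commute)
    qed
    then have "ln (real P) \<le> ln ((real y + 1) ^ 24)" using P by (subst ln_le_cancel_iff) auto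
    then have lnP: "ln (real P) / 24 \<le> ln (real y + 1)" by (simp add: ln_realpow)
    have "inv_totient_ratio 2 = 2" by (simp add: inv_totient_ratio_def prime_factorization_prime)
    then have "ln (real y + 1) \<le> S1 * 2"
      using ln_le_sum_coprime[of 2 y] by (simp add: S1_def coprime_right_2_iff_odd)
    then have l1: "ln (real P) / 48 \<le> S1" using lnP by simp
    have "ln (real y + 1) \<le> S2 * W"
      using ln_le_sum_coprime[of "2 * h" y] h by (simp add: S2_def W_def)
    then have "ln (real P) / 24 \<le> S2 * W" using lnP by linarith
    then have l2: "ln (real P) / (24 * W) \<le> S2" using W1 by (simp add: field_simps)
    have "ln (real P) \<ge> 0" using P by simp
    then have "ln (real P) / 48 * (ln (real P) / (24 * W)) \<le> S1 * S2"
      using l1 l2 W1 by (intro mult_mono) (auto simp: S1_def sum_nonneg)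
    also have "\<dots> \<le> (\<Sum>n | n \<in> {1..z} \<and> odd n. real (sieve_mult h n) / real n)"
      unfolding S1_def S2_def using y by (intro sum_product_le_sum_sieve_mult) (simp add: power2_eq_square)
    also have "{n. n \<in> {1..z} \<and> odd n} = {n. n \<in> {1..z} \<and> prime_factors n \<subseteq> Pr}"
    proof (intro Set.set_eqI iffI)
      fix n assume n: "n \<in> {n. n \<in> {1..z} \<and> odd n}"
      have "p \<in> Pr" if "p \<in> prime_factors n" for p
        using that n dvd_imp_le[of p n] dvd_trans[of 2 p n] by (auto simp: Pr_def prime_factors_dvd)
      then show "n \<in> {n. n \<in> {1..z} \<and> prime_factors n \<subseteq> Pr}" using n by auto
    next
      fix n assume n: "n \<in> {n. n \<in> {1..z} \<and> prime_factors n \<subseteq> Pr}"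
      have "odd n"
      proof
        assume "even n"
        then have "2 \<in> prime_factors n" using n by (intro prime_factorsI) auto
        then show False using n by (auto simp: Pr_def)
      qed
      then show "n \<in> {n. n \<in> {1..z} \<and> odd n}" using n by auto
    qed
    also have "(\<Sum>n | n \<in> {1..z} \<and> prime_factors n \<subseteq> Pr. real (sieve_mult h n) / real n) \<le> J"
      unfolding J_def D_def by (rule sum_sieve_mult_le) (auto simp: finPr, auto simp: Pr_def)
    finally show ?thesis by (simp add: power2_eq_square)
  qed
  have lnP: "ln (real P) > 0" using P by simp
  then have "(ln (real P))\<^sup>2 / (1152 * W) > 0" using W1 by (intro divide_pos_pos) auto
  then have "J > 0" using J by linarith
  have "real P / J \<le> real P / ((ln (real P))\<^sup>2 / (1152 * W))"
    using J lnP W1 \<open>J > 0\<close> by (intro divide_left_mono mult_pos_pos divide_pos_pos) auto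
  then have m: "real P / J \<le> 1152 * (real P / (ln (real P))\<^sup>2 * W)" by (simp add: mult_ac)
  have "real z ^ 6 \<le> sqrt (real P)"
  proof (rule real_le_rsqrt)
    have "real (z ^ 12) \<le> real P" using z by (simp only: of_nat_le_iff)
    then show "(real z ^ 6)\<^sup>2 \<le> real P" by (simp only: power_mult[symmetric] of_nat_power) simp
  qed
  also have "\<dots> \<le> 16 * real P / (ln (real P))\<^sup>2"
  proof -
    have "sqrt (real P) * (ln (real P))\<^sup>2 \<le> sqrt (real P) * (16 * sqrt (real P))"
      using ln_square_le_sqrt[of "real P"] P by (intro mult_left_mono) auto
    also have "\<dots> = 16 * real P" by simp
    finally show ?thesis using lnP by (simp add: field_simps)
  qed
  also have "\<dots> \<le> 16 * (real P / (ln (real P))\<^sup>2 * W)"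
    using W1 mult_left_mono[of 1 W "real P / (ln (real P))\<^sup>2"] by simp
  finally have z6: "real z ^ 6 \<le> 16 * (real P / (ln (real P))\<^sup>2 * W)" .
  have "real (card {n \<in> {P..<P + P}. E n \<inter> Pr = {}})
      \<le> 1152 * (real P / (ln (real P))\<^sup>2 * W) + 16 * (real P / (ln (real P))\<^sup>2 * W)"
    by (rule order_trans[OF sieve add_mono[OF m order_trans[OF rem z6]]])
  also have "\<dots> = 1168 * (real P / (ln (real P))\<^sup>2 * W)"
    by (simp only: distrib_right[symmetric]) simp
  finally have "real (card {n \<in> {P..<P + P}. E n \<inter> Pr = {}}) \<le> 1168 * (real P / (ln (real P))\<^sup>2 * W)" .
  \<comment> \<open>A prime n \<ge> P > z, and likewise n + h, has no prime factor up to z, so the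
    pairs counted survive the sieve.\<close>
  moreover have "real (card {n \<in> {P..<P + P}. prime n \<and> prime (n + h)}) \<le> real (card {n \<in> {P..<P + P}. E n \<inter> Pr = {}})"
  proof (intro of_nat_mono card_mono)
    show "{n \<in> {P..<P + P}. prime n \<and> prime (n + h)} \<subseteq> {n \<in> {P..<P + P}. E n \<inter> Pr = {}}"
    proof clarsimp
      fix n assume n: "P \<le> n" "prime n" "prime (n + h)"
      have "p \<notin> E n" if p: "p \<in> Pr" for p
      proof
        assume "p \<in> E n"
        then have "p dvd n \<or> p dvd n + h" using p by (simp add: E_def Pr_def prime_dvd_mult_iff)
        then have "p = n \<or> p = n + h" using n p by (auto simp: Pr_def primes_dvd_imp_eq)
        then show False using p n zP by (auto simp: Pr_def)
      qed
      then show "E n \<inter> Pr = {}" by auto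
    qed
  qed auto
  ultimately have "real (card {n \<in> {P..<P + P}. prime n \<and> prime (n + h)}) \<le> 1168 * (real P / (ln (real P))\<^sup>2 * W)"
    by linarith
  then show ?thesis by (simp add: W_def)
qed

section \<open>Averages of \<open>n / \<phi>(n)\<close>\<close>

text \<open>Telescopes through k^2 - 1 = (k - 1) (k + 1); what matters later is that the value stays
  below 2.\<close>

lemma prod_squares_ratio:
  "(\<Prod>k=2..Suc n. real k ^ 2 / (real k ^ 2 - 1)) = 2 * (real n + 1) / (real n + 2)"
proof (induction n)
  case (Suc n)
  have pos: "(real n + 2)\<^sup>2 - 1 = (real n + 1) * (real n + 3)" by (simp add: power2_eq_square algebra_simps)
  have "(\<Prod>k=2..Suc (Suc n). real k ^ 2 / (real k ^ 2 - 1))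
     = (\<Prod>k=2..Suc n. real k ^ 2 / (real k ^ 2 - 1)) * ((real n + 2) ^ 2 / ((real n + 2) ^ 2 - 1))"
    by (simp add: add.commute)
  also have "\<dots> = 2 * (real n + 1) / (real n + 2) * ((real n + 2) ^ 2 / ((real n + 1) * (real n + 3)))"
    unfolding Suc.IH pos by simp
  also have "\<dots> = 2 * (real (Suc n) + 1) / (real (Suc n) + 2)"
    by (simp add: divide_simps power2_eq_square) (simp add: algebra_simps)
  finally show ?case .
qed auto

text \<open>p/(p - 1) is (1 + 1/p) times p^2/(p^2 - 1), and the latter factors multiply to less than
  2, even over all integers from 2 on.\<close>

lemma prod_prime_ratio_le:
  assumes S: "finite S" "\<And>p. p \<in> S \<Longrightarrow> (p::nat) \<ge> 2"
  shows "(\<Prod>p\<in>S. real p / (real p - 1)) \<le> 2 * (\<Prod>p\<in>S. 1 + 1 / real p)"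
proof -
  obtain m where m: "S \<subseteq> {2..Suc m}"
  proof
    show "S \<subseteq> {2..Suc (Max (insert 0 S))}" using S by (auto intro!: le_SucI Max_ge)
  qed
  have pos: "real p ^ 2 - 1 > 0" if "p \<ge> 2" for p :: nat
  proof -
    have "(2::real) ^ 2 \<le> real p ^ 2" using that by (intro power_mono) auto
    then show ?thesis by simp
  qed
  have "(\<Prod>p\<in>S. real p / (real p - 1)) = (\<Prod>p\<in>S. (real p ^ 2 / (real p ^ 2 - 1)) * (1 + 1 / real p))"
  proof (rule prod.cong[OF refl])
    fix p assume "p \<in> S"
    then have p: "real p \<ge> 2" using S by auto
    have "real p ^ 2 - 1 = (real p - 1) * (real p + 1)" by (simp add: power2_eq_square algebra_simps)
    then show "real p / (real p - 1) = (real p ^ 2 / (real p ^ 2 - 1)) * (1 + 1 / real p)"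
      using p by (simp add: divide_simps power2_eq_square)
  qed
  also have "\<dots> = (\<Prod>p\<in>S. real p ^ 2 / (real p ^ 2 - 1)) * (\<Prod>p\<in>S. 1 + 1 / real p)" by (rule prod.distrib)
  also have "\<dots> \<le> 2 * (\<Prod>p\<in>S. 1 + 1 / real p)"
  proof (rule mult_right_mono)
    have "(\<Prod>p\<in>S. real p ^ 2 / (real p ^ 2 - 1)) \<le> (\<Prod>p\<in>{2..Suc m}. real p ^ 2 / (real p ^ 2 - 1))"
    proof (rule prod_mono2)
      show "1 \<le> real p ^ 2 / (real p ^ 2 - 1)" if "p \<in> {2..Suc m} - S" for p
        using pos[of p] that by simp
      show "0 \<le> real p ^ 2 / (real p ^ 2 - 1)" if "p \<in> S" for p
        using pos[of p] S(2)[OF that] by simp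
    qed (use m in auto)
    also have "\<dots> \<le> 2" unfolding prod_squares_ratio by (simp add: divide_simps)
    finally show "(\<Prod>p\<in>S. real p ^ 2 / (real p ^ 2 - 1)) \<le> 2" .
  qed (auto intro!: prod_nonneg)
  finally show ?thesis .
qed

text \<open>Expanding the product gives the reciprocals of the squarefree divisors.\<close>

lemma prod_one_plus_inverse_le_sum_divisors:
  assumes "n > 0"
  shows "(\<Prod>p\<in>prime_factors n. 1 + 1 / real p) \<le> (\<Sum>d | d dvd n. 1 / real d)"
proof -
  let ?S = "prime_factors n"
  have pr: "finite A" "\<And>p. p \<in> A \<Longrightarrow> prime p" if "A \<subseteq> ?S" for A
    using that finite_subset[of A ?S] by auto
  have "(\<Prod>p\<in>?S. 1 + 1 / real p) = (\<Prod>p\<in>?S. 1 / real p + 1)" by (simp add: add.commute)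
  also have "\<dots> = (\<Sum>A\<in>Pow ?S. (\<Prod>p\<in>A. 1 / real p) * (\<Prod>p\<in>?S - A. 1))" by (rule prod_add) auto
  also have "\<dots> = (\<Sum>A\<in>Pow ?S. 1 / real (\<Prod>A))" by (simp add: prod_dividef)
  also have "\<dots> = (\<Sum>d\<in>Prod ` Pow ?S. 1 / real d)"
  proof (rule sum.reindex_cong[symmetric, OF _ refl refl])
    show "inj_on \<Prod> (Pow ?S)"
    proof (rule inj_onI)
      fix A B assume AB: "A \<in> Pow ?S" "B \<in> Pow ?S" "\<Prod>A = \<Prod>B"
      have pf: "prime_factors (\<Prod>A) = A" if "A \<in> Pow ?S" for A
      proof -
        have A: "finite A" "\<And>p. p \<in> A \<Longrightarrow> prime p" using pr that by auto
        have "0 \<notin> A" using A(2)[of 0] by auto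
        then show ?thesis using prime_factors_prod[OF A(1), of "\<lambda>x. x"] A
          by (auto simp: prime_prime_factors)
      qed
      show "A = B" using pf[OF AB(1)] pf[OF AB(2)] AB(3) by metis
    qed
  qed
  also have "\<dots> \<le> (\<Sum>d | d dvd n. 1 / real d)"
  proof (rule sum_mono2)
    show "Prod ` Pow ?S \<subseteq> {d. d dvd n}"
    proof clarsimp
      fix A assume A: "A \<subseteq> ?S"
      have "\<Prod>A dvd \<Prod>?S" using A by (intro prod_dvd_prod_subset) auto
      also have "\<Prod>?S dvd n"
      proof -
        have "\<Prod>?S dvd (\<Prod>p\<in>?S. p ^ multiplicity p n)"
          by (intro prod_dvd_prod dvd_power) (auto simp: prime_factors_multiplicity)
        also have "\<dots> = n" using prod_prime_factors[of n] assms by simp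
        finally show ?thesis .
      qed
      finally show "\<Prod>A dvd n" .
    qed
  qed (use assms in auto)
  finally show ?thesis .
qed

lemma inv_totient_ratio_double_le:
  assumes "n > 0"
  shows "inv_totient_ratio (2 * n) \<le> 2 * inv_totient_ratio n"
proof -
  have f2: "prime_factors (2 * n) = insert 2 (prime_factors n)"
    using assms by (subst prime_factors_product) (auto simp: prime_prime_factors)
  have ge: "real p / (real p - 1) \<ge> 0" for p by (cases p) auto
  have nonneg: "inv_totient_ratio n \<ge> 0" unfolding inv_totient_ratio_def using ge by (intro prod_nonneg) auto
  show ?thesis
  proof (cases "2 \<in> prime_factors n")
    case True
    then have "inv_totient_ratio (2 * n) = inv_totient_ratio n" unfolding inv_totient_ratio_def f2 by (simp add: insert_absorb)
    then show ?thesis using nonneg by simp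
  next
    case False
    then show ?thesis unfolding inv_totient_ratio_def f2 by simp
  qed
qed

lemma inv_totient_ratio_le_sum_divisors:
  assumes "n > 0"
  shows "inv_totient_ratio (2 * n) \<le> 4 * (\<Sum>d | d dvd n. 1 / real d)"
proof -
  have "inv_totient_ratio n \<le> 2 * (\<Prod>p\<in>prime_factors n. 1 + 1 / real p)"
    unfolding inv_totient_ratio_def
    by (rule prod_prime_ratio_le) (auto dest!: in_prime_factors_imp_prime intro: prime_ge_2_nat)
  also have "\<dots> \<le> 2 * (\<Sum>d | d dvd n. 1 / real d)"
    using prod_one_plus_inverse_le_sum_divisors[OF assms] by simp
  finally show ?thesis using inv_totient_ratio_double_le[OF assms] by simp
qed

text \<open>Comparison with the integral of t^(-3/2): each term is at most the corresponding
  decrement of 2/sqrt t, so the partial sums stay below 3 - 2/sqrt n.\<close>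

lemma sum_inverse_three_halves_le:
  "(\<Sum>d=1..n. 1 / (real d * sqrt (real d))) \<le> 3"
proof -
  have "(\<Sum>d=1..Suc n. 1 / (real d * sqrt (real d))) \<le> 3 - 2 / sqrt (real (Suc n))" for n
  proof (induction n)
    case (Suc n)
    define u v where "u = sqrt (real (Suc n))" and "v = sqrt (real (Suc (Suc n)))"
    have uv: "u > 0" "v > 0" "u \<le> v" "v * v = u * u + 1" "v * v = real (Suc (Suc n))"
      by (auto simp: u_def v_def)
    have "2 / u - 2 / v = 2 * (v - u) / (u * v)"
      using uv by (simp add: field_simps)
    also have "(v - u) * (u + v) = 1" using uv by (simp add: algebra_simps)
    then have "v - u = 1 / (u + v)" using uv by (simp add: eq_divide_eq)
    finally have e: "2 / u - 2 / v = 2 / (u * v * (u + v))" by simp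
    have "v * v * (v + v) = 2 * (v * v * v)" by (simp add: algebra_simps)
    then have "1 / (v * v * v) = 2 / (v * v * (v + v))" by (simp only:)
    also have "\<dots> \<le> 2 / (u * v * (u + v))"
      using uv by (intro divide_left_mono mult_mono mult_pos_pos add_mono) auto
    finally have "1 / (v * v * v) \<le> 2 / u - 2 / v" by (simp add: e)
    moreover have "(\<Sum>d=1..Suc (Suc n). 1 / (real d * sqrt (real d)))
        = (\<Sum>d=1..Suc n. 1 / (real d * sqrt (real d))) + 1 / (v * v * v)"
      using uv(5) by (simp add: v_def)
    ultimately show ?case using Suc.IH unfolding u_def v_def by linarith
  qed auto
  then have *: "(\<Sum>d=1..Suc m. 1 / (real d * sqrt (real d))) \<le> 3" for m
    by (rule order_trans) simp
  show ?thesis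
  proof (cases n)
    case (Suc m)
    then show ?thesis using *[of m] by (simp only:)
  qed auto
qed

text \<open>The common multiples of d and e up to H number at most H / max(d, e) \<le> H / sqrt(d
  e). This decouples the double sum into the square of a sum of d^(-3/2), which is at most
  3.\<close>

lemma sum_divisors_inverse_square_mean:
  "(\<Sum>h=1..H. (\<Sum>d | d dvd h. 1 / real d)\<^sup>2) \<le> 9 * real H"
proof -
  have cnt: "real (card {h \<in> {1..H}. d dvd h \<and> e dvd h}) \<le> real H / (sqrt (real d) * sqrt (real e))"
    if "d \<ge> 1" "e \<ge> 1" for d e
  proof -
    define m where "m = max d e"
    have "{h \<in> {1..H}. d dvd h \<and> e dvd h} \<subseteq> (\<lambda>k. m * k) ` {1..H div m}"
    proof
      fix h assume h: "h \<in> {h \<in> {1..H}. d dvd h \<and> e dvd h}"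
      then have "m dvd h" by (auto simp: m_def max_def)
      then obtain k where k: "h = m * k" by auto
      have "k \<in> {1..H div m}" using h k that
        by (cases k) (auto simp: less_eq_div_iff_mult_less_eq m_def mult.commute)
      then show "h \<in> (\<lambda>k. m * k) ` {1..H div m}" using k by blast
    qed
    then have "card {h \<in> {1..H}. d dvd h \<and> e dvd h} \<le> card ((\<lambda>k. m * k) ` {1..H div m})"
      by (intro card_mono) auto
    also have "\<dots> \<le> card {1..H div m}" by (rule card_image_le) auto
    finally have "card {h \<in> {1..H}. d dvd h \<and> e dvd h} \<le> H div m" by simp
    then have "real (card {h \<in> {1..H}. d dvd h \<and> e dvd h}) \<le> real (H div m)" by simp
    also have "\<dots> \<le> real H / real m" by (rule of_nat_div_le_of_nat)
    also have "\<dots> \<le> real H / (sqrt (real d) * sqrt (real e))"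
    proof (rule divide_left_mono)
      have "sqrt (real d) * sqrt (real e) \<le> sqrt (real m) * sqrt (real m)"
        by (intro mult_mono) (auto simp: m_def)
      then show "sqrt (real d) * sqrt (real e) \<le> real m" by simp
    qed (use that in \<open>auto simp: m_def\<close>)
    finally show ?thesis .
  qed
  have "(\<Sum>h=1..H. (\<Sum>d | d dvd h. 1 / real d)\<^sup>2)
     = (\<Sum>h=1..H. (\<Sum>d=1..H. if d dvd h then 1 / real d else 0)\<^sup>2)"
  proof (rule sum.cong[OF refl])
    fix h assume h: "h \<in> {1..H}"
    have "(\<Sum>d | d dvd h. 1 / real d) = (\<Sum>d | d \<in> {1..H} \<and> d dvd h. 1 / real d)"
      using h by (intro sum.cong refl) (auto simp: Suc_le_eq dvd_pos_nat intro: order_trans[OF dvd_imp_le])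
    also have "\<dots> = (\<Sum>d=1..H. if d dvd h then 1 / real d else 0)" by (rule sum.inter_filter) auto
    finally show "(\<Sum>d | d dvd h. 1 / real d)\<^sup>2 = (\<Sum>d=1..H. if d dvd h then 1 / real d else 0)\<^sup>2" by simp
  qed
  also have "\<dots> = (\<Sum>h=1..H. \<Sum>d=1..H. \<Sum>e=1..H. if d dvd h \<and> e dvd h then 1 / real d * (1 / real e) else 0)"
    by (simp add: power2_eq_square sum_product if_distrib cong: if_cong) (intro sum.cong refl, auto)
  also have "\<dots> = (\<Sum>d=1..H. \<Sum>h=1..H. \<Sum>e=1..H. if d dvd h \<and> e dvd h then 1 / real d * (1 / real e) else 0)"
    by (rule sum.swap)
  also have "\<dots> = (\<Sum>d=1..H. \<Sum>e=1..H. \<Sum>h=1..H. if d dvd h \<and> e dvd h then 1 / real d * (1 / real e) else 0)"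
    by (rule sum.cong[OF refl], rule sum.swap)
  also have "\<dots> = (\<Sum>d=1..H. \<Sum>e=1..H. 1 / real d * (1 / real e) * real (card {h \<in> {1..H}. d dvd h \<and> e dvd h}))"
    by (intro sum.cong refl) (simp add: sum.If_cases Int_def)
  also have "\<dots> \<le> (\<Sum>d=1..H. \<Sum>e=1..H. 1 / real d * (1 / real e) * (real H / (sqrt (real d) * sqrt (real e))))"
    using cnt by (intro sum_mono mult_left_mono) auto
  also have "\<dots> = real H * ((\<Sum>d=1..H. 1 / (real d * sqrt (real d))) * (\<Sum>d=1..H. 1 / (real d * sqrt (real d))))"
    by (simp add: sum_product sum_distrib_left mult_ac)
  also have "\<dots> \<le> real H * (3 * 3)"
    by (intro mult_left_mono mult_mono sum_inverse_three_halves_le sum_nonneg) auto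
  finally show ?thesis by simp
qed

text \<open>Although n/phi(n) is unbounded, it is bounded in mean square; 144 = 4^2 * 9.\<close>

lemma inv_totient_ratio_square_mean:
  "(\<Sum>h=1..H. (inv_totient_ratio (2 * h))\<^sup>2) \<le> 144 * real H"
proof -
  have ge: "real p / (real p - 1) \<ge> 0" for p by (cases p) auto
  have "(\<Sum>h=1..H. (inv_totient_ratio (2 * h))\<^sup>2) \<le> (\<Sum>h=1..H. (4 * (\<Sum>d | d dvd h. 1 / real d))\<^sup>2)"
    using ge by (intro sum_mono power_mono inv_totient_ratio_le_sum_divisors)
       (auto simp: inv_totient_ratio_def intro!: prod_nonneg)
  also have "\<dots> = (\<Sum>h=1..H. 16 * (\<Sum>d | d dvd h. 1 / real d)\<^sup>2)"
  proof (rule sum.cong[OF refl])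
    fix h
    have "(4 * s)\<^sup>2 = 16 * s\<^sup>2" for s :: real by (simp add: power2_eq_square)
    then show "(4 * (\<Sum>d | d dvd h. 1 / real d))\<^sup>2 = 16 * (\<Sum>d | d dvd h. 1 / real d)\<^sup>2" .
  qed
  also have "\<dots> = 16 * (\<Sum>h=1..H. (\<Sum>d | d dvd h. 1 / real d)\<^sup>2)"
    by (rule sum_distrib_left[symmetric])
  also have "\<dots> \<le> 144 * real H" using sum_divisors_inverse_square_mean[of H] by simp
  finally show ?thesis .
qed


section \<open>Prime counting in dyadic intervals and the pointwise size of n / phi(n)\<close>

lemma prod_primes_dvd:
  assumes "finite A" "\<And>p. p \<in> A \<Longrightarrow> prime (p::nat)" "\<And>p. p \<in> A \<Longrightarrow> p dvd n"
  shows "\<Prod>A dvd n"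
  using assms
proof (induction A rule: finite_induct)
  case (insert p A)
  have "coprime p (\<Prod>A)"
  proof (rule prod_coprime_right)
    fix q assume "q \<in> A"
    then show "coprime p q" using insert.prems insert.hyps by (intro primes_coprime) auto
  qed
  then show ?case using insert by (simp add: divides_mult)
qed auto

text \<open>Every prime in \<open>(n, 2n]\<close> divides the central binomial coefficient, which is at most \<open>4\<^sup>n\<close>.\<close>

lemma card_primes_dyadic:
  "card {p::nat. prime p \<and> 2 ^ i < p \<and> p \<le> 2 ^ Suc i} * i \<le> 2 * 2 ^ i"
proof -
  define n :: nat where "n = 2 ^ i"
  define A where "A = {p. prime p \<and> n < p \<and> p \<le> 2 * n}"
  have fin: "finite A" unfolding A_def by (rule finite_subset[of _ "{..2 * n}"]) auto
  have "p dvd (2 * n) choose n" if "p \<in> A" for p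
  proof -
    have p: "prime p" "n < p" "p \<le> 2 * n" using that by (auto simp: A_def)
    have "fact (2 * n) = fact n * fact n * ((2 * n) choose n)"
      using binomial_fact_lemma[of n "2 * n"] by simp
    moreover have "p dvd fact (2 * n)" using p by (simp add: prime_dvd_fact_iff)
    moreover have "\<not> p dvd fact n" using p by (simp add: prime_dvd_fact_iff)
    ultimately show ?thesis using p by (metis prime_dvd_mult_iff)
  qed
  then have "\<Prod>A dvd (2 * n) choose n" by (intro prod_primes_dvd fin) (auto simp: A_def)
  then have "\<Prod>A \<le> (2 * n) choose n" by (rule dvd_imp_le) simp
  also have "\<dots> \<le> 2 ^ (2 * n)" by (rule binomial_le_pow2)
  finally have "\<Prod>A \<le> 2 ^ (2 * n)" .
  moreover have "n ^ card A \<le> \<Prod>A"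
  proof -
    have "(\<Prod>p\<in>A. n) \<le> \<Prod>A" by (intro prod_mono) (auto simp: A_def)
    then show ?thesis by simp
  qed
  ultimately have "(2::nat) ^ (i * card A) \<le> 2 ^ (2 * n)" by (simp add: n_def power_mult)
  then have "i * card A \<le> 2 * n" by (simp add: power_le_imp_le_exp)
  then show ?thesis by (simp add: A_def n_def mult.commute)
qed

text \<open>The dyadic interval above 2^i contains at most 2 * 2^i / i primes, hence contributes at
  most 2/i; the prime 2 accounts for the 1/2.\<close>

lemma sum_prime_reciprocals_le:
  "(\<Sum>p | prime p \<and> p \<le> 2 ^ Suc k. 1 / real p) \<le> 1 / 2 + 2 * (\<Sum>i=1..k. 1 / real i)"
proof (induction k)
  case 0
  have "{p. prime p \<and> p \<le> 2 ^ Suc 0} = {2::nat}" by (auto dest: prime_ge_2_nat)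
  then show ?case by simp
next
  case (Suc k)
  let ?A = "{p::nat. prime p \<and> p \<le> 2 ^ Suc k}" and ?B = "{p::nat. prime p \<and> 2 ^ Suc k < p \<and> p \<le> 2 ^ Suc (Suc k)}"
  have fin: "finite ?A" "finite ?B"
    by (auto intro: finite_subset[of _ "{..2 ^ Suc k}"] finite_subset[of _ "{..2 ^ Suc (Suc k)}"])
  have "{p::nat. prime p \<and> p \<le> 2 ^ Suc (Suc k)} = ?A \<union> ?B" by auto
  then have split: "(\<Sum>p | prime p \<and> p \<le> 2 ^ Suc (Suc k). 1 / real p) = (\<Sum>p\<in>?A. 1 / real p) + (\<Sum>p\<in>?B. 1 / real p)"
    using fin by (simp only:) (rule sum.union_disjoint, auto)
  define c where "c = card ?B"
  have cB: "real c * real (Suc k) \<le> 2 * 2 ^ Suc k"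
  proof -
    have "real (c * Suc k) \<le> real (2 * 2 ^ Suc k)" unfolding c_def using card_primes_dyadic[of "Suc k"] by (simp only: of_nat_le_iff)
    then show ?thesis by (simp only: of_nat_mult of_nat_power of_nat_numeral)
  qed
  have "(\<Sum>p\<in>?B. 1 / real p) \<le> (\<Sum>p\<in>?B. 1 / 2 ^ Suc k)"
  proof (rule sum_mono)
    fix p assume "p \<in> ?B"
    then have "2 ^ Suc k \<le> p" by simp
    then have "real (2 ^ Suc k) \<le> real p" by (simp only: of_nat_le_iff)
    then have p: "2 ^ Suc k \<le> real p" by simp
    have "(0::real) < 2 ^ Suc k" by simp
    then have "0 < real p" using p by linarith
    then show "1 / real p \<le> 1 / 2 ^ Suc k" using p by (intro divide_left_mono mult_pos_pos) auto
  qed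
  then have B1: "(\<Sum>p\<in>?B. 1 / real p) \<le> real c * (1 / 2 ^ Suc k)" by (simp only: sum_constant c_def)
  have "c / w \<le> 2 / t" if "c * t \<le> 2 * w" "w > 0" "t > 0" for c w t :: real
    using that by (simp add: field_simps)
  from this[OF cB] have "real c * (1 / 2 ^ Suc k) \<le> 2 / real (Suc k)" by simp
  with B1 have B2: "(\<Sum>p\<in>?B. 1 / real p) \<le> 2 / real (Suc k)" by (rule order_trans)
  have "1 / 2 + 2 * (\<Sum>i=1..Suc k. 1 / real i) = 1 / 2 + 2 * (\<Sum>i=1..k. 1 / real i) + 2 / real (Suc k)" by simp
  then show ?case unfolding split using add_mono[OF Suc.IH B2] by (simp only:)
qed

lemma sum_inverse_le_ln: "(\<Sum>i=1..n. 1 / real i) \<le> 1 + ln (real n + 1)"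
proof -
  have "(\<Sum>i=1..n. 1 / real i) \<le> 1 + ln (max 1 (real n))"
  proof (induction n)
    case (Suc n)
    show ?case
    proof (cases "n = 0")
      case False
      have "1 / real (Suc n) \<le> ln (real (Suc n)) - ln (real n)"
      proof -
        have "ln (real n / real (Suc n)) \<le> real n / real (Suc n) - 1"
          using False by (intro ln_le_minus_one) simp
        then show ?thesis using False by (simp add: ln_div field_simps)
      qed
      then show ?thesis using Suc False by (simp add: max_def)
    qed auto
  qed auto
  also have "\<dots> \<le> 1 + ln (real n + 1)" by simp
  finally show ?thesis .
qed

text \<open>The prime factors of h are split at y = ln q. For those up to y the sum of reciprocals
  is at most 2 ln ln y + O(1). Of the m larger ones y^m \<le> q, so m \<le> 2 y and their product of
  p/(p - 1) is bounded. The constant 2 of the prime count makes the result (ln ln q)^2 instead of ln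
  ln q, which is harmless because this bound will only enter under a square root.\<close>

lemma inv_totient_ratio_le_ln_ln_square:
  assumes q: "q \<ge> 16" and h: "0 < h" "h \<le> q"
  shows "inv_totient_ratio (2 * h) \<le> 64 * exp (13 / 2) * (ln (ln (real q)))\<^sup>2"
proof -
  define y where "y = ln (real q)"
  have ln2: "ln (2::real) \<ge> 1 / 2"
    using ln_le_minus_one[of "1 / 2 :: real"] by (simp add: ln_div)
  have "ln (16::real) = 4 * ln 2" using ln_realpow[of 2 4] by simp
  then have "ln (16::real) \<ge> 2" using ln2 by simp
  moreover have "ln 16 \<le> ln (real q)" using q by simp
  ultimately have y: "y \<ge> 2" by (simp add: y_def)
  have lny: "ln y \<ge> 1 / 2"
  proof -
    have "ln (1 / y) \<le> 1 / y - 1" using y by (intro ln_le_minus_one) simp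
    moreover have "1 / y \<le> 1 / 2" using y by (simp add: field_simps)
    moreover have "ln (1 / y) = - ln y" using y by (simp add: ln_div)
    ultimately show ?thesis by linarith
  qed
  define k where "k = nat \<lfloor>log 2 y\<rfloor>"
  have log0: "log 2 y \<ge> 0" using y by simp
  have k: "real k \<le> log 2 y" "log 2 y < real k + 1"
    using log0 by (auto simp: k_def)
  have y2: "y \<le> 2 ^ Suc k"
  proof -
    have "y = 2 powr (log 2 y)" using y by simp
    also have "\<dots> \<le> 2 powr (real (Suc k))" using k by (intro powr_mono) auto
    finally show ?thesis by (simp only: powr_realpow)
  qed
  have k1: "real k + 1 \<le> 4 * ln y"
  proof -
    have "log 2 y = ln y / ln 2" by (simp add: log_def)
    also have "\<dots> \<le> ln y / (1 / 2)" using lny ln2 by (intro divide_left_mono) auto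
    finally show ?thesis using k lny by simp
  qed
  define S where "S = {p \<in> prime_factors h. real p \<le> y}"
  define T where "T = {p \<in> prime_factors h. real p > y}"
  have pr: "p \<ge> 2" if "p \<in> prime_factors h" for p using that by (auto dest: in_prime_factors_imp_prime intro: prime_ge_2_nat)
  have fin: "finite S" "finite T" by (auto simp: S_def T_def)
  have "inv_totient_ratio h = (\<Prod>p\<in>S. real p / (real p - 1)) * (\<Prod>p\<in>T. real p / (real p - 1))"
  proof -
    have "prime_factors h = S \<union> T" by (auto simp: S_def T_def)
    then show ?thesis unfolding inv_totient_ratio_def
      by (simp only:) (rule prod.union_disjoint, use fin in \<open>auto simp: S_def T_def\<close>)
  qed
  moreover have "(\<Prod>p\<in>S. real p / (real p - 1)) \<le> 2 * (exp (5 / 2) * (4 * ln y)\<^sup>2)"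
  proof -
    have "(\<Prod>p\<in>S. real p / (real p - 1)) \<le> 2 * (\<Prod>p\<in>S. 1 + 1 / real p)"
      by (rule prod_prime_ratio_le) (use fin pr in \<open>auto simp: S_def\<close>)
    also have "(\<Prod>p\<in>S. 1 + 1 / real p) \<le> (\<Prod>p\<in>S. exp (1 / real p))"
      by (intro prod_mono) auto
    also have "\<dots> = exp (\<Sum>p\<in>S. 1 / real p)" using fin by (simp add: exp_sum)
    also have "(\<Sum>p\<in>S. 1 / real p) \<le> (\<Sum>p | prime p \<and> p \<le> 2 ^ Suc k. 1 / real p)"
    proof (rule sum_mono2)
      show "finite {p::nat. prime p \<and> p \<le> 2 ^ Suc k}" by (rule finite_subset[of _ "{..2 ^ Suc k}"]) auto
      show "S \<subseteq> {p::nat. prime p \<and> p \<le> 2 ^ Suc k}"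
      proof
        fix p assume p: "p \<in> S"
        then have "real p \<le> 2 ^ Suc k" using y2 by (auto simp: S_def)
        then have "real p \<le> real (2 ^ Suc k)" by simp
        then have "p \<le> 2 ^ Suc k" by (simp only: of_nat_le_iff)
        then show "p \<in> {p::nat. prime p \<and> p \<le> 2 ^ Suc k}" using p by (auto simp: S_def)
      qed
    qed auto
    also have "\<dots> \<le> 1 / 2 + 2 * (1 + ln (real k + 1))"
      by (rule order_trans[OF sum_prime_reciprocals_le]) (use sum_inverse_le_ln[of k] in simp)
    also have "\<dots> = 5 / 2 + 2 * ln (real k + 1)" by simp
    also have "exp \<dots> = exp (5 / 2) * (real k + 1)\<^sup>2" by (simp add: exp_add exp_double)
    also have "\<dots> \<le> exp (5 / 2) * (4 * ln y)\<^sup>2" using k1 by (intro mult_left_mono power_mono) auto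
    finally show ?thesis by simp
  qed
  moreover have "(\<Prod>p\<in>T. real p / (real p - 1)) \<le> exp 4"
  proof -
    define m where "m = card T"
    have "(\<Prod>p\<in>T. real p / (real p - 1)) \<le> (\<Prod>p\<in>T. exp (1 / (y - 1)))"
    proof (rule prod_mono)
      fix p assume "p \<in> T"
      then have p: "real p > y" by (simp add: T_def)
      have "real p / (real p - 1) = 1 + 1 / (real p - 1)" using p y by (simp add: field_simps)
      also have "\<dots> \<le> exp (1 / (real p - 1))" by simp
      also have "\<dots> \<le> exp (1 / (y - 1))" using p y by (simp add: divide_left_mono)
      finally show "0 \<le> real p / (real p - 1) \<and> real p / (real p - 1) \<le> exp (1 / (y - 1))" using p y by simp
    qed
    also have "\<dots> = exp (real m / (y - 1))" by (simp add: m_def exp_of_nat_mult[symmetric])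
    also have "real m / (y - 1) \<le> 4"
    proof -
      have "\<Prod>T \<le> h"
        using h by (intro dvd_imp_le prod_primes_dvd fin) (auto simp: T_def)
      then have "real (\<Prod>T) \<le> real q" using h by (simp only: of_nat_le_iff)
      moreover have "y ^ m \<le> real (\<Prod>T)"
      proof -
        have "(\<Prod>p\<in>T. y) \<le> (\<Prod>p\<in>T. real p)" using y by (intro prod_mono) (auto simp: T_def)
        then show ?thesis by (simp add: m_def)
      qed
      ultimately have "y ^ m \<le> real q" by linarith
      then have "ln (y ^ m) \<le> y" unfolding y_def[symmetric] using y q by (subst y_def, subst ln_le_cancel_iff) auto
      then have "real m * ln y \<le> y" using y by (simp add: ln_realpow)
      moreover have "real m * (1 / 2) \<le> real m * ln y" using lny by (intro mult_left_mono) auto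
      ultimately show ?thesis using y by (simp add: field_simps)
    qed
    finally show ?thesis by simp
  qed
  ultimately have "inv_totient_ratio h \<le> 2 * (exp (5 / 2) * (4 * ln y)\<^sup>2) * exp 4"
  proof (simp only:, intro mult_mono)
    show "0 \<le> (\<Prod>p\<in>T. real p / (real p - 1))"
    proof (rule prod_nonneg)
      fix p assume "p \<in> T"
      then have "p \<ge> 2" using pr by (simp add: T_def)
      then show "0 \<le> real p / (real p - 1)" by simp
    qed
  qed auto
  also have "\<dots> = 32 * (exp (5 / 2) * exp 4) * (ln y)\<^sup>2" by (simp add: power_mult_distrib)
  also have "exp (5 / 2) * exp 4 = exp (13 / 2 :: real)" by (simp flip: exp_add)
  finally show ?thesis using inv_totient_ratio_double_le[OF h(1)] by (simp add: y_def)
qed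

section \<open>Bilinear forms over primes\<close>

definition ee :: "real \<Rightarrow> complex" where "ee t = cis (2 * pi * t)"

lemma ee_add: "ee (s + t) = ee s * ee t"
  by (simp add: ee_def cis_mult ring_distribs)

lemma norm_ee [simp]: "norm (ee t) = 1"
  by (simp add: ee_def)

lemma ee_int [simp]: "ee (of_int n) = 1"
  by (simp add: ee_def cis_multiple_2pi)

lemma ee_uminus: "ee (- t) = cnj (ee t)"
  by (simp add: ee_def cis_cnj)

lemma ee_power: "ee t ^ n = ee (real n * t)"
  by (simp add: ee_def DeMoivre mult_ac)

definition int_dist :: "real \<Rightarrow> real" where
  "int_dist t = \<bar>t - of_int (round t)\<bar>"

lemma int_dist_nonneg [simp]: "int_dist t \<ge> 0" by (simp add: int_dist_def)

lemma int_dist_le_half: "int_dist t \<le> 1 / 2"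
  using of_int_round_abs_le[of t] by (simp add: int_dist_def abs_minus_commute)

lemma int_dist_le: "int_dist t \<le> \<bar>t - of_int m\<bar>"
  unfolding int_dist_def by (rule round_diff_minimal)

lemma int_dist_uminus [simp]: "int_dist (- t) = int_dist t"
proof -
  have "int_dist (- t) \<le> int_dist t" for t
    using int_dist_le[of "- t" "- round t"] by (simp add: int_dist_def)
  from this[of t] this[of "- t"] show ?thesis by simp
qed

text \<open>A weak form of Jordan's inequality, with slope 1/pi in place of 2/pi. Up to pi/3 the
  mean value theorem applies with cosine at least 1/2; beyond it the sine is at least sin(pi/3) >
  1/2.\<close>

lemma div_pi_le_sin:
  assumes "0 \<le> x" "x \<le> pi / 2"
  shows "x / pi \<le> sin x"
proof (cases "x \<le> pi / 3")
  case True
  have "x / 2 \<le> sin x"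
  proof (cases "x = 0")
    case False
    then have "x > 0" using assms by simp
    then obtain y where y: "y > 0" "y < x" "sin x - sin 0 = (x - 0) * cos y"
      using MVT2[of 0 x sin cos] by (auto intro: derivative_eq_intros)
    have "cos y \<ge> cos (pi / 3)" using y True by (intro cos_monotone_0_pi_le) auto
    then have "cos y \<ge> 1 / 2" by (simp add: cos_60)
    then have "x * (1 / 2) \<le> x * cos y" using \<open>x > 0\<close> by (intro mult_left_mono) auto
    then show ?thesis using y by simp
  qed auto
  moreover have "x / pi \<le> x / 2" using assms pi_ge_two by (intro divide_left_mono) auto
  ultimately show ?thesis by linarith
next
  case False
  have "sin (pi / 3) \<le> sin x" using False assms by (intro sin_monotone_2pi_le) auto
  moreover have "sin (pi / 3) \<ge> 1 / 2" by (simp add: sin_60)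
  moreover have "x / pi \<le> 1 / 2" using assms by (simp add: field_simps)
  ultimately show ?thesis by linarith
qed

lemma norm_one_minus_ee: "norm (1 - ee t) = 2 * \<bar>sin (pi * t)\<bar>"
proof -
  define s c where "s = sin (pi * t)" and "c = cos (pi * t)"
  have sc: "s\<^sup>2 + c\<^sup>2 = 1" by (simp add: s_def c_def)
  have "(norm (1 - ee t))\<^sup>2 = (1 - cos (2 * (pi * t)))\<^sup>2 + (sin (2 * (pi * t)))\<^sup>2"
    by (simp add: ee_def cmod_power2 mult.assoc)
  also have "\<dots> = 4 * s\<^sup>2 * (s\<^sup>2 + c\<^sup>2)"
    unfolding cos_double_sin sin_double s_def[symmetric] c_def[symmetric]
    by (simp add: power2_eq_square algebra_simps)
  also have "\<dots> = (2 * \<bar>sin (pi * t)\<bar>)\<^sup>2" unfolding sc by (simp add: s_def)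
  finally show ?thesis by (simp only: power2_eq_iff_nonneg norm_ge_zero)
qed

lemma int_dist_le_norm_one_minus_ee: "2 * int_dist t \<le> norm (1 - ee t)"
proof -
  define u where "u = t - of_int (round t)"
  have u: "\<bar>u\<bar> = int_dist t" by (simp add: u_def int_dist_def)
  have "ee t = ee (u + of_int (round t))" by (simp add: u_def)
  also have "\<dots> = ee u" by (simp only: ee_add ee_int mult_1_right)
  finally have "norm (1 - ee t) = 2 * \<bar>sin (pi * u)\<bar>" by (simp add: norm_one_minus_ee)
  moreover have "\<bar>sin (pi * u)\<bar> = \<bar>sin (pi * \<bar>u\<bar>)\<bar>" by (cases "u \<ge> 0") auto
  moreover have "\<bar>sin (pi * \<bar>u\<bar>)\<bar> \<ge> \<bar>u\<bar>"
  proof -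
    have "\<bar>u\<bar> \<le> 1 / 2" using int_dist_le_half[of t] u by simp
    then have "pi * \<bar>u\<bar> / pi \<le> sin (pi * \<bar>u\<bar>)" by (intro div_pi_le_sin) auto
    then show ?thesis by simp
  qed
  ultimately show ?thesis using u by linarith
qed

text \<open>This is min(M, 1/|t|) with |t| the distance to the nearest integer. The case distinction
  gives the value M at integers, where division by zero would give 0.\<close>

definition kap :: "real \<Rightarrow> real \<Rightarrow> real" where
  "kap M t = (if M * int_dist t \<le> 1 then M else 1 / int_dist t)"

lemma kap_le: "M \<ge> 0 \<Longrightarrow> kap M t \<le> M"
  using int_dist_nonneg[of t] less_le[of 0 "int_dist t"]
  by (cases "int_dist t = 0") (auto simp: kap_def divide_simps not_le mult.commute)

lemma kap_nonneg: "M \<ge> 0 \<Longrightarrow> kap M t \<ge> 0"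
  by (simp add: kap_def)

lemma kap_0 [simp]: "kap M 0 = M"
  by (simp add: kap_def int_dist_def)

lemma kap_uminus [simp]: "kap M (- t) = kap M t"
  by (simp add: kap_def)

lemma kap_le_inverse:
  assumes "int_dist t \<ge> d" "d > 0"
  shows "kap M t \<le> 1 / d"
proof -
  have "1 / int_dist t \<le> 1 / d" using assms by (intro divide_left_mono mult_pos_pos) auto
  moreover have "M \<le> 1 / int_dist t" if "M * int_dist t \<le> 1" using that assms by (simp add: field_simps)
  ultimately show ?thesis by (auto simp: kap_def)
qed

lemma norm_exp_sum_le_kap:
  assumes "real n \<le> M"
  shows "norm (\<Sum>m=1..n. ee (real m * t)) \<le> kap M t"
proof (cases "M * int_dist t \<le> 1")
  case True
  have "norm (\<Sum>m=1..n. ee (real m * t)) \<le> (\<Sum>m=1..n. 1)"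
    by (intro sum_norm_le) auto
  then show ?thesis using True assms by (simp add: kap_def)
next
  case False
  define z where "z = ee t"
  have M0: "M \<ge> 0" using assms by (meson of_nat_0_le_iff order_trans)
  then have pos: "int_dist t > 0" using False int_dist_nonneg[of t] less_le[of 0 "int_dist t"] by (cases "int_dist t = 0") auto
  have le: "2 * int_dist t \<le> norm (1 - z)" unfolding z_def by (rule int_dist_le_norm_one_minus_ee)
  then have z1: "z \<noteq> 1" using pos by auto
  have "(\<Sum>m=1..n. ee (real m * t)) = (\<Sum>m<n. z * z ^ m)"
    by (rule sum.reindex_bij_witness[of _ Suc "\<lambda>m. m - 1"])
       (auto simp: z_def ee_power ee_add[symmetric] algebra_simps of_nat_diff)
  also have "\<dots> = z * ((1 - z ^ n) / (1 - z))"
    using z1 by (simp add: sum_gp_strict flip: sum_distrib_left)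
  finally have "norm (\<Sum>m=1..n. ee (real m * t)) = norm (1 - z ^ n) / norm (1 - z)"
    by (simp add: norm_mult norm_divide z_def)
  also have "\<dots> \<le> 2 / norm (1 - z)"
    by (intro divide_right_mono order_trans[OF norm_triangle_ineq4]) (auto simp: z_def norm_power)
  finally have a: "norm (\<Sum>m=1..n. ee (real m * t)) \<le> 2 / norm (1 - z)" .
  have "2 / norm (1 - z) \<le> 2 / (2 * int_dist t)" using pos le by (intro divide_left_mono mult_pos_pos) auto
  then show ?thesis using a False by (simp add: kap_def)
qed

section \<open>Cauchy-Schwarz over a dyadic block and the sum over pairs of primes\<close>

lemma bilinear_cauchy:
  fixes F a :: "nat \<Rightarrow> complex" and x P :: nat and A \<alpha> :: real
  assumes P: "P > 0" and R: "finite R" "\<And>p. p \<in> R \<Longrightarrow> P \<le> p"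
    and A: "\<And>p. p \<in> R \<Longrightarrow> norm (a p) \<le> A"
    and F: "\<And>n. (\<Sum>m=1..n. (norm (F m))\<^sup>2) \<le> real n"
  defines "M \<equiv> real x / real P"
  shows "(norm (\<Sum>p\<in>R. \<Sum>m=1..x div p. a p * F m * ee (real p * real m * \<alpha>)))\<^sup>2
     \<le> M * A\<^sup>2 * (\<Sum>p\<in>R. \<Sum>p'\<in>R. kap M ((real p - real p') * \<alpha>))"
proof -
  define X where "X = x div P"
  \<comment> \<open>The range of m depends on p. An indicator moves this dependence into the inner
    sum, so that Cauchy-Schwarz can be applied over the common range \<open>1..X\<close> and F
    enters through its mean square only.\<close>
  define I where "I m = (\<Sum>p\<in>R. if m \<le> x div p then a p * ee (real p * real m * \<alpha>) else 0)" for m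
  have XM: "real X \<le> M" unfolding X_def M_def by (rule of_nat_div_le_of_nat)
  have M0: "M \<ge> 0" by (simp add: M_def)
  have div: "x div p \<le> X" if "p \<in> R" for p
    unfolding X_def using R(2)[OF that] P by (rule div_le_mono2[rotated])
  have "(\<Sum>p\<in>R. \<Sum>m=1..x div p. a p * F m * ee (real p * real m * \<alpha>))
     = (\<Sum>p\<in>R. \<Sum>m=1..X. if m \<le> x div p then a p * F m * ee (real p * real m * \<alpha>) else 0)"
  proof (rule sum.cong[OF refl])
    fix p assume "p \<in> R"
    then have "{1..x div p} = {m \<in> {1..X}. m \<le> x div p}" using div by (auto intro: order_trans)
    then have "(\<Sum>m=1..x div p. a p * F m * ee (real p * real m * \<alpha>))
       = (\<Sum>m | m \<in> {1..X} \<and> m \<le> x div p. a p * F m * ee (real p * real m * \<alpha>))" by (simp only:)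
    also have "\<dots> = (\<Sum>m=1..X. if m \<le> x div p then a p * F m * ee (real p * real m * \<alpha>) else 0)"
      by (rule sum.inter_filter) auto
    finally show "(\<Sum>m=1..x div p. a p * F m * ee (real p * real m * \<alpha>))
       = (\<Sum>m=1..X. if m \<le> x div p then a p * F m * ee (real p * real m * \<alpha>) else 0)" .
  qed
  also have "\<dots> = (\<Sum>m=1..X. \<Sum>p\<in>R. if m \<le> x div p then a p * F m * ee (real p * real m * \<alpha>) else 0)"
    by (rule sum.swap)
  also have "\<dots> = (\<Sum>m=1..X. F m * I m)"
    unfolding I_def by (intro sum.cong refl) (auto simp: sum_distrib_left intro!: sum.cong)
  finally have eq: "(\<Sum>p\<in>R. \<Sum>m=1..x div p. a p * F m * ee (real p * real m * \<alpha>)) = (\<Sum>m=1..X. F m * I m)" .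
  have "norm (\<Sum>m=1..X. F m * I m) \<le> (\<Sum>m=1..X. norm (F m) * norm (I m))"
    by (intro sum_norm_le) (simp add: norm_mult)
  then have "(norm (\<Sum>m=1..X. F m * I m))\<^sup>2 \<le> (\<Sum>m=1..X. norm (F m) * norm (I m))\<^sup>2"
    by (intro power_mono) auto
  also have "\<dots> \<le> (\<Sum>m=1..X. (norm (F m))\<^sup>2) * (\<Sum>m=1..X. (norm (I m))\<^sup>2)"
    by (rule Cauchy_Schwarz_ineq_sum)
  also have "\<dots> \<le> M * (\<Sum>m=1..X. (norm (I m))\<^sup>2)"
    using F[of X] XM by (intro mult_right_mono sum_nonneg) auto
  also have "\<dots> \<le> M * (A\<^sup>2 * (\<Sum>p\<in>R. \<Sum>p'\<in>R. kap M ((real p - real p') * \<alpha>)))"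
  proof (rule mult_left_mono[OF _ M0])
    define G where "G p p' = a p * cnj (a p') * (\<Sum>m=1..min (x div p) (x div p'). ee (real m * ((real p - real p') * \<alpha>)))" for p p'
    have "complex_of_real (\<Sum>m=1..X. (norm (I m))\<^sup>2) = (\<Sum>m=1..X. I m * cnj (I m))"
      by (simp only: of_real_sum complex_norm_square)
    also have "\<dots> = (\<Sum>m=1..X. \<Sum>p\<in>R. \<Sum>p'\<in>R. if m \<le> min (x div p) (x div p') then a p * cnj (a p') * ee (real m * ((real p - real p') * \<alpha>)) else 0)"
    proof (rule sum.cong[OF refl])
      fix m assume "m \<in> {1..X}"
      have "I m * cnj (I m) = (\<Sum>p\<in>R. \<Sum>p'\<in>R. (if m \<le> x div p then a p * ee (real p * real m * \<alpha>) else 0) *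
          cnj (if m \<le> x div p' then a p' * ee (real p' * real m * \<alpha>) else 0))"
        by (simp add: I_def sum_product)
      also have "\<dots> = (\<Sum>p\<in>R. \<Sum>p'\<in>R. if m \<le> min (x div p) (x div p') then a p * cnj (a p') * ee (real m * ((real p - real p') * \<alpha>)) else 0)"
      proof (intro sum.cong refl)
        fix p p'
        have "real m * ((real p - real p') * \<alpha>) = real p * real m * \<alpha> + - (real p' * real m * \<alpha>)"
          by (simp add: algebra_simps)
        then have "ee (real m * ((real p - real p') * \<alpha>)) = ee (real p * real m * \<alpha>) * cnj (ee (real p' * real m * \<alpha>))"
          by (simp only: ee_add ee_uminus)
        then show "(if m \<le> x div p then a p * ee (real p * real m * \<alpha>) else 0) *
          cnj (if m \<le> x div p' then a p' * ee (real p' * real m * \<alpha>) else 0) =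
          (if m \<le> min (x div p) (x div p') then a p * cnj (a p') * ee (real m * ((real p - real p') * \<alpha>)) else 0)"
          by simp
      qed
      finally show "I m * cnj (I m) = (\<Sum>p\<in>R. \<Sum>p'\<in>R. if m \<le> min (x div p) (x div p') then a p * cnj (a p') * ee (real m * ((real p - real p') * \<alpha>)) else 0)" .
    qed
    also have "\<dots> = (\<Sum>p\<in>R. \<Sum>m=1..X. \<Sum>p'\<in>R. if m \<le> min (x div p) (x div p') then a p * cnj (a p') * ee (real m * ((real p - real p') * \<alpha>)) else 0)"
      by (rule sum.swap)
    also have "\<dots> = (\<Sum>p\<in>R. \<Sum>p'\<in>R. \<Sum>m=1..X. if m \<le> min (x div p) (x div p') then a p * cnj (a p') * ee (real m * ((real p - real p') * \<alpha>)) else 0)"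
      by (rule sum.cong[OF refl], rule sum.swap)
    also have "\<dots> = (\<Sum>p\<in>R. \<Sum>p'\<in>R. G p p')"
    proof (intro sum.cong refl)
      fix p p' assume pp: "p \<in> R" "p' \<in> R"
      have set: "{m \<in> {1..X}. m \<le> min (x div p) (x div p')} = {1..min (x div p) (x div p')}"
        using div[OF pp(1)] by auto
      have "(\<Sum>m=1..X. if m \<le> min (x div p) (x div p') then a p * cnj (a p') * ee (real m * ((real p - real p') * \<alpha>)) else 0)
        = (\<Sum>m\<in>{m \<in> {1..X}. m \<le> min (x div p) (x div p')}. a p * cnj (a p') * ee (real m * ((real p - real p') * \<alpha>)))"
        by (rule sum.inter_filter[symmetric]) auto
      also have "\<dots> = G p p'" unfolding set G_def by (rule sum_distrib_left[symmetric])
      finally show "(\<Sum>m=1..X. if m \<le> min (x div p) (x div p') then a p * cnj (a p') * ee (real m * ((real p - real p') * \<alpha>)) else 0) = G p p'" .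
    qed
    finally have eq2: "complex_of_real (\<Sum>m=1..X. (norm (I m))\<^sup>2) = (\<Sum>p\<in>R. \<Sum>p'\<in>R. G p p')" .
    have "(\<Sum>m=1..X. (norm (I m))\<^sup>2) = norm (complex_of_real (\<Sum>m=1..X. (norm (I m))\<^sup>2))"
      by (simp only: norm_of_real) (simp add: sum_nonneg)
    also have "\<dots> \<le> (\<Sum>p\<in>R. \<Sum>p'\<in>R. norm (G p p'))"
      unfolding eq2 by (intro sum_norm_le order_refl)
    also have "\<dots> \<le> (\<Sum>p\<in>R. \<Sum>p'\<in>R. A\<^sup>2 * kap M ((real p - real p') * \<alpha>))"
    proof (intro sum_mono)
      fix p p' assume pp: "p \<in> R" "p' \<in> R"
      have A0: "A \<ge> 0" using A[OF pp(1)] norm_ge_zero order_trans by blast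
      have "real (min (x div p) (x div p')) \<le> M"
        using div[OF pp(1)] XM by (auto intro: order_trans[OF _ XM])
      from norm_exp_sum_le_kap[OF this]
      have "norm (G p p') \<le> (A * A) * kap M ((real p - real p') * \<alpha>)"
        unfolding G_def norm_mult complex_mod_cnj using A pp A0
        by (intro mult_mono) auto
      then show "norm (G p p') \<le> A\<^sup>2 * kap M ((real p - real p') * \<alpha>)" by (simp add: power2_eq_square)
    qed
    also have "\<dots> = A\<^sup>2 * (\<Sum>p\<in>R. \<Sum>p'\<in>R. kap M ((real p - real p') * \<alpha>))"
      by (simp add: sum_distrib_left)
    finally show "(\<Sum>m=1..X. (norm (I m))\<^sup>2) \<le> A\<^sup>2 * (\<Sum>p\<in>R. \<Sum>p'\<in>R. kap M ((real p - real p') * \<alpha>))" .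
  qed
  finally show ?thesis unfolding eq by (simp add: mult.assoc)
qed

text \<open>The diagonal contributes M for each of at most P primes. By symmetry the other pairs are
  counted twice with p < p' and grouped by their difference h < P.\<close>

lemma sum_kap_pairs_le:
  fixes R :: "nat set" and P :: nat and M \<alpha> :: real
  assumes P: "P > 0" and R: "R \<subseteq> {p \<in> {P..<P + P}. prime p}" and M: "M \<ge> 0"
  shows "(\<Sum>p\<in>R. \<Sum>p'\<in>R. kap M ((real p - real p') * \<alpha>))
      \<le> real P * M + 2 * (\<Sum>h=1..<P. real (card {n \<in> {P..<P + P}. prime n \<and> prime (n + h)}) * kap M (real h * \<alpha>))"
proof -
  let ?k = "\<lambda>p p'. kap M ((real p - real p') * \<alpha>)"
  have finR: "finite R" using R by (rule finite_subset) auto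
  have sym: "?k p p' = ?k p' p" for p p' :: nat
    using kap_uminus[of M "(real p - real p') * \<alpha>"] by (simp add: algebra_simps)
  have lt: "(\<Sum>p\<in>R. \<Sum>p'\<in>{p'\<in>R. p < p'}. ?k p p')
     \<le> (\<Sum>h=1..<P. real (card {n \<in> {P..<P + P}. prime n \<and> prime (n + h)}) * kap M (real h * \<alpha>))"
  proof -
    have "(\<Sum>p\<in>R. \<Sum>p'\<in>{p'\<in>R. p < p'}. ?k p p') \<le> (\<Sum>p\<in>R. \<Sum>h=1..<P. if prime (p + h) then kap M (real h * \<alpha>) else 0)"
    proof (rule sum_mono)
      fix p assume p: "p \<in> R"
      have "(\<Sum>p'\<in>{p'\<in>R. p < p'}. ?k p p') = (\<Sum>h\<in>(\<lambda>p'. p' - p) ` {p'\<in>R. p < p'}. kap M (real h * \<alpha>))"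
      proof (rule sum.reindex_cong[symmetric, of "\<lambda>p'. p' - p"])
        show "inj_on (\<lambda>p'. p' - p) {p'\<in>R. p < p'}" by (auto intro!: inj_onI)
        show "kap M (real (p' - p) * \<alpha>) = ?k p p'" if "p' \<in> {p'\<in>R. p < p'}" for p'
          using that sym[of p p'] by (simp add: of_nat_diff)
      qed auto
      also have "\<dots> \<le> (\<Sum>h\<in>{h\<in>{1..<P}. prime (p + h)}. kap M (real h * \<alpha>))"
      proof (rule sum_mono2)
        show "(\<lambda>p'. p' - p) ` {p'\<in>R. p < p'} \<subseteq> {h\<in>{1..<P}. prime (p + h)}"
        proof (intro image_subsetI)
          fix p' assume "p' \<in> {p'\<in>R. p < p'}"
          moreover then have "p' < P + P" "prime p'" "P \<le> p" using R p by auto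
          ultimately show "p' - p \<in> {h\<in>{1..<P}. prime (p + h)}" by auto
        qed
      qed (use M in \<open>auto simp: kap_nonneg\<close>)
      also have "\<dots> = (\<Sum>h=1..<P. if prime (p + h) then kap M (real h * \<alpha>) else 0)"
        by (rule sum.inter_filter) auto
      finally show "(\<Sum>p'\<in>{p'\<in>R. p < p'}. ?k p p') \<le> (\<Sum>h=1..<P. if prime (p + h) then kap M (real h * \<alpha>) else 0)" .
    qed
    also have "\<dots> \<le> (\<Sum>p\<in>{p \<in> {P..<P + P}. prime p}. \<Sum>h=1..<P. if prime (p + h) then kap M (real h * \<alpha>) else 0)"
      using R M by (intro sum_mono2 sum_nonneg) (auto simp: kap_nonneg)
    also have "\<dots> = (\<Sum>h=1..<P. \<Sum>p\<in>{p \<in> {P..<P + P}. prime p}. if prime (p + h) then kap M (real h * \<alpha>) else 0)"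
      by (rule sum.swap)
    also have "\<dots> = (\<Sum>h=1..<P. real (card {n \<in> {P..<P + P}. prime n \<and> prime (n + h)}) * kap M (real h * \<alpha>))"
    proof (rule sum.cong[OF refl])
      fix h
      have "(\<Sum>p\<in>{p \<in> {P..<P + P}. prime p}. if prime (p + h) then kap M (real h * \<alpha>) else 0)
         = (\<Sum>p\<in>{p \<in> {p \<in> {P..<P + P}. prime p}. prime (p + h)}. kap M (real h * \<alpha>))"
        by (rule sum.inter_filter[symmetric]) auto
      also have "{p \<in> {p \<in> {P..<P + P}. prime p}. prime (p + h)} = {n \<in> {P..<P + P}. prime n \<and> prime (n + h)}" by auto
      finally show "(\<Sum>p\<in>{p \<in> {P..<P + P}. prime p}. if prime (p + h) then kap M (real h * \<alpha>) else 0)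
        = real (card {n \<in> {P..<P + P}. prime n \<and> prime (n + h)}) * kap M (real h * \<alpha>)" by simp
    qed
    finally show ?thesis .
  qed
  have gt: "(\<Sum>p\<in>R. \<Sum>p'\<in>{p'\<in>R. p' < p}. ?k p p') = (\<Sum>p\<in>R. \<Sum>p'\<in>{p'\<in>R. p < p'}. ?k p p')"
  proof -
    have "(\<Sum>p\<in>R. \<Sum>p'\<in>{p'\<in>R. p' < p}. ?k p p') = (\<Sum>p'\<in>R. \<Sum>p\<in>{p\<in>R. p' < p}. ?k p p')"
      by (rule sum.swap_restrict) (use finR in auto)
    then show ?thesis by (simp only: sym)
  qed
  have "(\<Sum>p\<in>R. \<Sum>p'\<in>R. ?k p p') = (\<Sum>p\<in>R. M + (\<Sum>p'\<in>{p'\<in>R. p < p'}. ?k p p') + (\<Sum>p'\<in>{p'\<in>R. p' < p}. ?k p p'))"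
  proof (rule sum.cong[OF refl])
    fix p assume p: "p \<in> R"
    have "R = ({p} \<union> {p'\<in>R. p < p'}) \<union> {p'\<in>R. p' < p}" using p by auto
    then have "(\<Sum>p'\<in>R. ?k p p') = (\<Sum>p'\<in>({p} \<union> {p'\<in>R. p < p'}) \<union> {p'\<in>R. p' < p}. ?k p p')" by (rule arg_cong)
    also have "\<dots> = (\<Sum>p'\<in>{p} \<union> {p'\<in>R. p < p'}. ?k p p') + (\<Sum>p'\<in>{p'\<in>R. p' < p}. ?k p p')"
      by (rule sum.union_disjoint) (use finR in auto)
    also have "(\<Sum>p'\<in>{p} \<union> {p'\<in>R. p < p'}. ?k p p') = M + (\<Sum>p'\<in>{p'\<in>R. p < p'}. ?k p p')"
      by (subst sum.union_disjoint) (use finR in auto)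
    finally show "(\<Sum>p'\<in>R. ?k p p') = M + (\<Sum>p'\<in>{p'\<in>R. p < p'}. ?k p p') + (\<Sum>p'\<in>{p'\<in>R. p' < p}. ?k p p')" .
  qed
  also have "\<dots> = real (card R) * M + (\<Sum>p\<in>R. \<Sum>p'\<in>{p'\<in>R. p < p'}. ?k p p') + (\<Sum>p\<in>R. \<Sum>p'\<in>{p'\<in>R. p' < p}. ?k p p')"
    by (simp only: sum.distrib sum_constant)
  also have "real (card R) * M \<le> real P * M"
  proof (rule mult_right_mono[OF _ M])
    have "card R \<le> card {P..<P + P}" using R by (intro card_mono) auto
    then show "real (card R) \<le> real P" by simp
  qed
  finally show ?thesis using lt unfolding gt by simp
qed

text \<open>The position of \<open>h\<alpha>\<close> relative to the nearest integer, measured in multiples of \<open>\<alpha>\<close>, determines \<open>h\<close>.\<close>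

lemma inj_on_cell:
  fixes \<alpha> :: real
  assumes "\<alpha> > 0"
  shows "inj_on (\<lambda>h::nat. (round (real h * \<alpha>), real h * \<alpha> \<ge> of_int (round (real h * \<alpha>)), nat \<lfloor>int_dist (real h * \<alpha>) / \<alpha>\<rfloor>)) UNIV"
proof (rule inj_onI)
  fix h h' :: nat
  define t where "t h = real h * \<alpha> - of_int (round (real h * \<alpha>))" for h
  assume "(round (real h * \<alpha>), real h * \<alpha> \<ge> of_int (round (real h * \<alpha>)), nat \<lfloor>int_dist (real h * \<alpha>) / \<alpha>\<rfloor>)
     = (round (real h' * \<alpha>), real h' * \<alpha> \<ge> of_int (round (real h' * \<alpha>)), nat \<lfloor>int_dist (real h' * \<alpha>) / \<alpha>\<rfloor>)"
  then have r: "round (real h * \<alpha>) = round (real h' * \<alpha>)" and s: "t h \<ge> 0 \<longleftrightarrow> t h' \<ge> 0"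
    and f: "nat \<lfloor>\<bar>t h\<bar> / \<alpha>\<rfloor> = nat \<lfloor>\<bar>t h'\<bar> / \<alpha>\<rfloor>"
    by (auto simp: t_def int_dist_def)
  have "\<lfloor>\<bar>t h\<bar> / \<alpha>\<rfloor> = \<lfloor>\<bar>t h'\<bar> / \<alpha>\<rfloor>"
    using f assms by (simp add: eq_nat_nat_iff)
  then have "\<bar>\<bar>t h\<bar> / \<alpha> - \<bar>t h'\<bar> / \<alpha>\<bar> < 1" by linarith
  moreover have "\<bar>\<bar>t h\<bar> / \<alpha> - \<bar>t h'\<bar> / \<alpha>\<bar> = \<bar>real h - real h'\<bar>"
  proof -
    have "\<bar>\<bar>t h\<bar> - \<bar>t h'\<bar>\<bar> = \<bar>t h - t h'\<bar>" using s by (auto simp: abs_if)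
    also have "t h - t h' = (real h - real h') * \<alpha>" using r by (simp add: t_def algebra_simps)
    finally have "\<bar>\<bar>t h\<bar> - \<bar>t h'\<bar>\<bar> = \<bar>real h - real h'\<bar> * \<alpha>" using assms by (simp add: abs_mult)
    moreover have "\<bar>\<bar>t h\<bar> / \<alpha> - \<bar>t h'\<bar> / \<alpha>\<bar> = \<bar>\<bar>t h\<bar> - \<bar>t h'\<bar>\<bar> / \<alpha>"
      using assms by (simp add: diff_divide_distrib[symmetric])
    ultimately show ?thesis using assms by simp
  qed
  ultimately show "h = h'" by linarith
qed

lemma sum_snd_Times: "(\<Sum>z\<in>A \<times> C. f (snd z)) = real (card A) * sum f C"
proof -
  have "(\<Sum>z\<in>A \<times> C. f (snd z)) = (\<Sum>(a, c)\<in>A \<times> C. f c)" by (rule sum.cong) auto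
  also have "\<dots> = (\<Sum>a\<in>A. \<Sum>c\<in>C. f c)" by (rule sum.cartesian_product[symmetric])
  finally show ?thesis by simp
qed

text \<open>By \<open>inj_on_cell\<close> each i is taken by at most 2 (K + 1) values of h: the
  nearest integer lies in 0..K and there are two sides of it. Here K + 1 \<le> P\<alpha> + 2 \<le> 5
  P\<alpha> because P\<alpha> \<ge> 1/2.\<close>

lemma sum_over_cells_le:
  fixes \<alpha> :: real and g :: "nat \<Rightarrow> real"
  assumes \<alpha>: "0 < \<alpha>" "\<alpha> \<le> 1 / 2" and P: "real P * \<alpha> \<ge> 1 / 2" and I: "finite I"
    and g: "\<And>i. i \<in> I \<Longrightarrow> g i \<ge> 0"
  shows "(\<Sum>h | h \<in> {1..<P} \<and> nat \<lfloor>int_dist (real h * \<alpha>) / \<alpha>\<rfloor> \<in> I. g (nat \<lfloor>int_dist (real h * \<alpha>) / \<alpha>\<rfloor>))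
      \<le> 10 * (real P * \<alpha>) * (\<Sum>i\<in>I. g i)"
proof -
  let ?c = "\<lambda>h::nat. (round (real h * \<alpha>), real h * \<alpha> \<ge> of_int (round (real h * \<alpha>)), nat \<lfloor>int_dist (real h * \<alpha>) / \<alpha>\<rfloor>)"
  let ?H = "{h. h \<in> {1..<P} \<and> nat \<lfloor>int_dist (real h * \<alpha>) / \<alpha>\<rfloor> \<in> I}"
  define K where "K = \<lfloor>real P * \<alpha>\<rfloor> + 1"
  have "?c ` ?H \<subseteq> {0..K} \<times> (UNIV :: bool set) \<times> I"
  proof
    fix z assume "z \<in> ?c ` ?H"
    then obtain h where h: "h \<in> ?H" "z = ?c h" by auto
    have "real h * \<alpha> \<le> real P * \<alpha>" using h \<alpha> by (intro mult_right_mono) auto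
    then have "round (real h * \<alpha>) \<le> K" unfolding K_def round_def by linarith
    moreover have "round (real h * \<alpha>) \<ge> 0" using \<alpha> by (simp add: round_def)
    ultimately show "z \<in> {0..K} \<times> (UNIV :: bool set) \<times> I" using h by auto
  qed
  then have "(\<Sum>z\<in>?c ` ?H. g (snd (snd z))) \<le> (\<Sum>z\<in>{0..K} \<times> (UNIV :: bool set) \<times> I. g (snd (snd z)))"
    by (rule sum_mono2[rotated]) (use g I in auto)
  also have "\<dots> = real_of_int (K + 1) * 2 * (\<Sum>i\<in>I. g i)"
  proof -
    have "K \<ge> 0" unfolding K_def using \<alpha> by simp
    then show ?thesis by (simp add: sum_snd_Times[of "\<lambda>z. g (snd z)"] sum_snd_Times[of g])
  qed
  also have "\<dots> \<le> 5 * (real P * \<alpha>) * 2 * (\<Sum>i\<in>I. g i)"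
  proof (intro mult_right_mono sum_nonneg g)
    show "real_of_int (K + 1) \<le> 5 * (real P * \<alpha>)" unfolding K_def using P by linarith
  qed auto
  also have "(\<Sum>z\<in>?c ` ?H. g (snd (snd z))) = (\<Sum>h\<in>?H. g (nat \<lfloor>int_dist (real h * \<alpha>) / \<alpha>\<rfloor>))"
    by (rule sum.reindex_cong[OF _ refl]) (use inj_on_cell[OF \<alpha>(1)] in \<open>auto intro: inj_on_subset\<close>)
  finally show ?thesis by simp
qed

lemma card_close_le:
  fixes \<alpha> :: real
  assumes \<alpha>: "0 < \<alpha>" "\<alpha> \<le> 1 / 2" and P: "real P * \<alpha> \<ge> 1 / 2"
  shows "real (card {h \<in> {1..<P}. int_dist (real h * \<alpha>) < \<alpha>}) \<le> 10 * (real P * \<alpha>)"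
proof -
  have "{h \<in> {1..<P}. int_dist (real h * \<alpha>) < \<alpha>} = {h. h \<in> {1..<P} \<and> nat \<lfloor>int_dist (real h * \<alpha>) / \<alpha>\<rfloor> \<in> {0}}"
  proof (intro Collect_cong conj_cong refl)
    fix h :: nat
    have "int_dist (real h * \<alpha>) / \<alpha> \<ge> 0" using \<alpha> by simp
    moreover have "int_dist (real h * \<alpha>) < \<alpha> \<longleftrightarrow> int_dist (real h * \<alpha>) / \<alpha> < 1" using \<alpha> by (simp add: field_simps)
    ultimately show "int_dist (real h * \<alpha>) < \<alpha> \<longleftrightarrow> nat \<lfloor>int_dist (real h * \<alpha>) / \<alpha>\<rfloor> \<in> {0}" by (auto simp: nat_eq_iff floor_eq_iff)
  qed
  then have "real (card {h \<in> {1..<P}. int_dist (real h * \<alpha>) < \<alpha>})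
     = (\<Sum>h | h \<in> {1..<P} \<and> nat \<lfloor>int_dist (real h * \<alpha>) / \<alpha>\<rfloor> \<in> {0}. (\<lambda>_. 1) (nat \<lfloor>int_dist (real h * \<alpha>) / \<alpha>\<rfloor>))"
    by (simp only: sum_constant mult_1_right)
  also have "\<dots> \<le> 10 * (real P * \<alpha>) * (\<Sum>i\<in>{0::nat}. 1)"
    by (rule sum_over_cells_le[OF \<alpha> P]) auto
  finally show ?thesis by simp
qed

text \<open>With v = u/M the minimum is at most 2u/(i + v). The squares are then dominated by a
  telescoping series with sum 1/v, and 4 u^2 / v = 4 u M.\<close>

lemma sum_min_square_le:
  fixes M u :: real
  assumes "M > 0" "u > 0"
  shows "(\<Sum>i=1..n. (min M (u / real i))\<^sup>2) \<le> 4 * u * M"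
proof -
  define v where "v = u / M"
  have v: "v > 0" using assms by (simp add: v_def)
  have tm: "(min M (u / real i))\<^sup>2 \<le> 4 * u\<^sup>2 * (1 / (real i - 1 + v) - 1 / (real i + v))" if i: "i \<ge> 1" for i
  proof -
    have i0: "real i \<ge> 1" using i by simp
    have "min M (u / real i) \<le> 2 * u / (real i + v)"
    proof (cases "real i \<le> v")
      case True
      have "M * (real i + v) \<le> M * (v + v)" using True assms by (intro mult_left_mono) auto
      also have "\<dots> = 2 * u" using assms by (simp add: v_def)
      finally have "M \<le> 2 * u / (real i + v)" using v i0 by (simp add: field_simps)
      then show ?thesis by simp
    next
      case False
      have "u / real i \<le> 2 * u / (real i + v)" using False v i0 assms by (simp add: field_simps)
      then show ?thesis by simp
    qed
    then have "(min M (u / real i))\<^sup>2 \<le> (2 * u / (real i + v))\<^sup>2"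
      using assms by (intro power_mono) auto
    also have "\<dots> = 4 * u\<^sup>2 * (1 / ((real i + v) * (real i + v)))" by (simp add: power2_eq_square)
    also have "\<dots> \<le> 4 * u\<^sup>2 * (1 / ((real i - 1 + v) * (real i + v)))"
      using v i0 by (intro mult_left_mono divide_left_mono mult_right_mono mult_pos_pos) auto
    also have "1 / ((real i - 1 + v) * (real i + v)) = 1 / (real i - 1 + v) - 1 / (real i + v)"
      using v i0 by (simp add: field_simps)
    finally show ?thesis .
  qed
  have "(\<Sum>i=1..n. (min M (u / real i))\<^sup>2) \<le> (\<Sum>i=1..n. 4 * u\<^sup>2 * (1 / (real i - 1 + v) - 1 / (real i + v)))"
    using tm by (intro sum_mono) auto
  also have "\<dots> = 4 * u\<^sup>2 * (\<Sum>i=1..n. 1 / (real i - 1 + v) - 1 / (real i + v))" by (rule sum_distrib_left[symmetric])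
  also have "(\<Sum>i=1..n. 1 / (real i - 1 + v) - 1 / (real i + v)) = 1 / v - 1 / (real n + v)"
    by (induction n) auto
  also have "4 * u\<^sup>2 * (1 / v - 1 / (real n + v)) \<le> 4 * u\<^sup>2 * (1 / v)"
    using v by (intro mult_left_mono) auto
  also have "\<dots> = 4 * u * M" using assms by (simp add: v_def power2_eq_square)
  finally show ?thesis .
qed

text \<open>An h in cell i \<ge> 1 has distance at least i\<alpha> from the integers, so
  \<open>kap\<close> is at most min(M, 1/(i\<alpha>)). Each cell holds at most 10 P\<alpha> values
  of h, and the factor \<alpha> cancels against 1/\<alpha>.\<close>

lemma sum_kap_square_le:
  fixes \<alpha> M :: real
  assumes \<alpha>: "0 < \<alpha>" "\<alpha> \<le> 1 / 2" and P: "real P * \<alpha> \<ge> 1 / 2" and M: "M > 0"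
  shows "(\<Sum>h | h \<in> {1..<P} \<and> int_dist (real h * \<alpha>) \<ge> \<alpha>. (kap M (real h * \<alpha>))\<^sup>2) \<le> 40 * real P * M"
proof -
  let ?i = "\<lambda>h::nat. nat \<lfloor>int_dist (real h * \<alpha>) / \<alpha>\<rfloor>"
  define n where "n = nat \<lfloor>1 / \<alpha>\<rfloor>"
  have i: "?i h \<ge> 1 \<and> ?i h \<le> n \<and> kap M (real h * \<alpha>) \<le> min M (1 / \<alpha> / real (?i h))" if h: "int_dist (real h * \<alpha>) \<ge> \<alpha>" for h
  proof -
    define d where "d = int_dist (real h * \<alpha>)"
    have d: "d / \<alpha> \<ge> 1" "d \<ge> \<alpha>" using h \<alpha> by (auto simp: d_def field_simps)
    have i1: "nat \<lfloor>d / \<alpha>\<rfloor> \<ge> 1" using d by (simp add: le_nat_iff le_floor_iff)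
    have "d / \<alpha> \<le> 1 / \<alpha>" using int_dist_le_half[of "real h * \<alpha>"] \<alpha> by (intro divide_right_mono) (auto simp: d_def)
    then have n: "nat \<lfloor>d / \<alpha>\<rfloor> \<le> n" unfolding n_def by (intro nat_mono floor_mono)
    have "real (nat \<lfloor>d / \<alpha>\<rfloor>) \<le> d / \<alpha>" using d by simp
    then have "real (nat \<lfloor>d / \<alpha>\<rfloor>) * \<alpha> \<le> d" using \<alpha> by (simp add: field_simps)
    moreover have "real (nat \<lfloor>d / \<alpha>\<rfloor>) \<ge> 1" using i1 by linarith
    then have "real (nat \<lfloor>d / \<alpha>\<rfloor>) * \<alpha> > 0" using \<alpha> by (intro mult_pos_pos) linarith+
    ultimately have "kap M (real h * \<alpha>) \<le> 1 / (real (nat \<lfloor>d / \<alpha>\<rfloor>) * \<alpha>)"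
      unfolding d_def by (rule kap_le_inverse)
    then have "kap M (real h * \<alpha>) \<le> 1 / \<alpha> / real (nat \<lfloor>d / \<alpha>\<rfloor>)" by (simp add: mult.commute)
    then show ?thesis using i1 n kap_le[of M "real h * \<alpha>"] M by (simp add: d_def)
  qed
  have "(\<Sum>h | h \<in> {1..<P} \<and> int_dist (real h * \<alpha>) \<ge> \<alpha>. (kap M (real h * \<alpha>))\<^sup>2)
     \<le> (\<Sum>h | h \<in> {1..<P} \<and> int_dist (real h * \<alpha>) \<ge> \<alpha>. (min M (1 / \<alpha> / real (?i h)))\<^sup>2)"
    using i kap_nonneg[of M] M by (intro sum_mono power_mono) auto
  also have "\<dots> \<le> (\<Sum>h | h \<in> {1..<P} \<and> ?i h \<in> {1..n}. (min M (1 / \<alpha> / real (?i h)))\<^sup>2)"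
    using i by (intro sum_mono2) auto
  also have "\<dots> \<le> 10 * (real P * \<alpha>) * (\<Sum>i\<in>{1..n}. (min M (1 / \<alpha> / real i))\<^sup>2)"
    by (rule sum_over_cells_le[OF \<alpha> P]) auto
  also have "\<dots> \<le> 10 * (real P * \<alpha>) * (4 * (1 / \<alpha>) * M)"
    using \<alpha> M by (intro mult_left_mono sum_min_square_le) auto
  also have "\<dots> = 40 * real P * M" using \<alpha> by simp
  finally show ?thesis .
qed

section \<open>One dyadic block of primes, and the sum over all blocks\<close>

lemma sqrt_add3_le:
  assumes "0 \<le> a" "0 \<le> b" "0 \<le> c"
  shows "sqrt (a + b + c) \<le> sqrt a + sqrt b + sqrt c"
  using sqrt_add_le_add_sqrt[of "a + b" c] sqrt_add_le_add_sqrt[of a b] assms by linarith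

text \<open>The three terms are the square roots of three contributions: the diagonal; the at most
  10 P\<alpha> differences h closer than \<alpha> to an integer, where only the pointwise bounds V
  and M are available; and all other h, where Cauchy-Schwarz plays the mean square of 2h/phi(2h)
  against that of \<open>kap\<close>.\<close>

lemma block_bound_large:
  fixes F a :: "nat \<Rightarrow> complex" and x P :: nat and \<alpha> V :: real
  assumes P: "P \<ge> 2" "P \<le> x" and \<alpha>: "0 < \<alpha>" "\<alpha> \<le> 1 / 2" and P\<alpha>: "real P * \<alpha> \<ge> 1 / 2"
    and R: "R \<subseteq> {p \<in> {P..<P + P}. prime p}"
    and a: "\<And>p. p \<in> R \<Longrightarrow> norm (a p) \<le> ln (real p)"
    and F: "\<And>n. (\<Sum>m=1..n. (norm (F m))\<^sup>2) \<le> real n"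
    and V: "\<And>h. 0 < h \<Longrightarrow> h \<le> x \<Longrightarrow> inv_totient_ratio (2 * h) \<le> V"
  shows "norm (\<Sum>p\<in>R. \<Sum>m=1..x div p. a p * F m * ee (real p * real m * \<alpha>))
     \<le> 1000 * real x * (ln (real P) / sqrt (real P) + sqrt (\<alpha> * V) + sqrt (sqrt (real P / real x)))"
proof -
  define M where "M = real x / real P"
  define L where "L = ln (real P)"
  define W where "W h = inv_totient_ratio (2 * h)" for h
  define r where "r h = real (card {n \<in> {P..<P + P}. prime n \<and> prime (n + h)})" for h
  define B where "B = norm (\<Sum>p\<in>R. \<Sum>m=1..x div p. a p * F m * ee (real p * real m * \<alpha>))"
  have Ppos: "real P > 0" and xpos: "real x > 0" using P by auto
  have M1: "M \<ge> 1" using P by (simp add: M_def)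
  have MP: "M * real P = real x" using P by (simp add: M_def)
  have Lpos: "L > 0" using P by (simp add: L_def)
  have V1: "V \<ge> 1" using V[of 1] inv_totient_ratio_ge_1[of 2] P by simp
  have W0: "W h \<ge> 0" for h using inv_totient_ratio_ge_1[of "2 * h"] by (simp add: W_def)
  have finR: "finite R" using R by (rule finite_subset) auto
  have ln2P: "ln (2 * real P) \<le> 2 * L"
  proof -
    have "ln (2 * real P) = ln 2 + L" using Ppos by (simp add: L_def ln_mult)
    moreover have "ln 2 \<le> L" using P by (simp add: L_def)
    ultimately show ?thesis by simp
  qed
  have "B\<^sup>2 \<le> M * (2 * L)\<^sup>2 * (\<Sum>p\<in>R. \<Sum>p'\<in>R. kap M ((real p - real p') * \<alpha>))"
    unfolding B_def M_def
  proof (rule bilinear_cauchy[OF _ finR _ _ F])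
    show "norm (a p) \<le> 2 * L" if "p \<in> R" for p
    proof -
      have "p \<le> 2 * P" "p \<ge> 1" using R that P by auto
      then have "ln (real p) \<le> ln (2 * real P)" by (subst ln_le_cancel_iff) auto
      then show ?thesis using a[OF that] ln2P by linarith
    qed
  qed (use P R in auto)
  also have "\<dots> \<le> M * (2 * L)\<^sup>2 * (real P * M + 2 * (\<Sum>h=1..<P. r h * kap M (real h * \<alpha>)))"
    unfolding r_def using P R M1 by (intro mult_left_mono sum_kap_pairs_le) auto
  also have "\<dots> \<le> M * (2 * L)\<^sup>2 * (real P * M + 2 * (1168 * real P / L\<^sup>2 * (10 * real P * \<alpha> * V * M + 76 * real P * sqrt M)))"
  proof (intro mult_left_mono add_left_mono)
    have "(\<Sum>h=1..<P. r h * kap M (real h * \<alpha>)) \<le> (\<Sum>h=1..<P. 1168 * real P / L\<^sup>2 * (W h * kap M (real h * \<alpha>)))"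
    proof (rule sum_mono)
      fix h assume "h \<in> {1..<P}"
      then have "r h \<le> 1168 * real P / L\<^sup>2 * W h"
        unfolding r_def W_def L_def using P by (intro prime_pairs_upper_bound) auto
      then have "r h * kap M (real h * \<alpha>) \<le> 1168 * real P / L\<^sup>2 * W h * kap M (real h * \<alpha>)"
        using M1 by (intro mult_right_mono kap_nonneg) auto
      then show "r h * kap M (real h * \<alpha>) \<le> 1168 * real P / L\<^sup>2 * (W h * kap M (real h * \<alpha>))" by (simp only: mult.assoc)
    qed
    also have "\<dots> = 1168 * real P / L\<^sup>2 * (\<Sum>h=1..<P. W h * kap M (real h * \<alpha>))" by (rule sum_distrib_left[symmetric])
    also have "\<dots> \<le> 1168 * real P / L\<^sup>2 * (10 * real P * \<alpha> * V * M + 76 * real P * sqrt M)"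
    proof (rule mult_left_mono)
      let ?C = "{h \<in> {1..<P}. int_dist (real h * \<alpha>) < \<alpha>}" and ?D = "{h. h \<in> {1..<P} \<and> int_dist (real h * \<alpha>) \<ge> \<alpha>}"
      have "{1..<P} = ?C \<union> ?D" by auto
      then have "(\<Sum>h=1..<P. W h * kap M (real h * \<alpha>)) = (\<Sum>h\<in>?C \<union> ?D. W h * kap M (real h * \<alpha>))" by (rule arg_cong)
      also have "\<dots> = (\<Sum>h\<in>?C. W h * kap M (real h * \<alpha>)) + (\<Sum>h\<in>?D. W h * kap M (real h * \<alpha>))"
        by (rule sum.union_disjoint) auto
      finally have split: "(\<Sum>h=1..<P. W h * kap M (real h * \<alpha>)) = (\<Sum>h\<in>?C. W h * kap M (real h * \<alpha>)) + (\<Sum>h\<in>?D. W h * kap M (real h * \<alpha>))" .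
      have "(\<Sum>h\<in>?C. W h * kap M (real h * \<alpha>)) \<le> (\<Sum>h\<in>?C. V * M)"
      proof (rule sum_mono)
        fix h assume "h \<in> ?C"
        then have "W h \<le> V" unfolding W_def using V P by auto
        then show "W h * kap M (real h * \<alpha>) \<le> V * M"
          using M1 V1 by (intro mult_mono kap_le kap_nonneg) auto
      qed
      also have "\<dots> = real (card ?C) * (V * M)" by simp
      also have "\<dots> \<le> 10 * (real P * \<alpha>) * (V * M)"
        using M1 V1 by (intro mult_right_mono card_close_le \<alpha> P\<alpha>) auto
      finally have c: "(\<Sum>h\<in>?C. W h * kap M (real h * \<alpha>)) \<le> 10 * real P * \<alpha> * V * M" by (simp only: mult.assoc)
      have "(\<Sum>h\<in>?D. W h * kap M (real h * \<alpha>))\<^sup>2 \<le> (\<Sum>h\<in>?D. (W h)\<^sup>2) * (\<Sum>h\<in>?D. (kap M (real h * \<alpha>))\<^sup>2)"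
        by (rule Cauchy_Schwarz_ineq_sum)
      also have "\<dots> \<le> (144 * real P) * (40 * real P * M)"
      proof (intro mult_mono sum_nonneg)
        have "(\<Sum>h\<in>?D. (W h)\<^sup>2) \<le> (\<Sum>h=1..P. (W h)\<^sup>2)" by (rule sum_mono2) auto
        also have "\<dots> \<le> 144 * real P" unfolding W_def by (rule inv_totient_ratio_square_mean)
        finally show "(\<Sum>h\<in>?D. (W h)\<^sup>2) \<le> 144 * real P" .
        show "(\<Sum>h\<in>?D. (kap M (real h * \<alpha>))\<^sup>2) \<le> 40 * real P * M"
          using M1 by (intro sum_kap_square_le \<alpha> P\<alpha>) auto
      qed auto
      \<comment> \<open>144 * 40 = 5760 is just below 76^2 = 5776.\<close>
      also have "\<dots> \<le> (76 * real P * sqrt M)\<^sup>2"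
        using M1 by (simp add: power_mult_distrib power2_eq_square mult_mono)
      finally have "(\<Sum>h\<in>?D. W h * kap M (real h * \<alpha>)) \<le> 76 * real P * sqrt M"
        by (rule power2_le_imp_le) (use M1 in auto)
      then show "(\<Sum>h=1..<P. W h * kap M (real h * \<alpha>)) \<le> 10 * real P * \<alpha> * V * M + 76 * real P * sqrt M"
        using c split by linarith
    qed simp
    finally show "(\<Sum>h=1..<P. r h * kap M (real h * \<alpha>)) \<le> 1168 * real P / L\<^sup>2 * (10 * real P * \<alpha> * V * M + 76 * real P * sqrt M)" .
  qed (use M1 in auto)
  \<comment> \<open>The 1/L^2 of the sieve cancels the squared prime weights off the diagonal. Here
    93440 = 8 * 1168 * 10 and 710144 = 8 * 1168 * 76, both below 1000^2.\<close>
  also have "M * (2 * L)\<^sup>2 * (real P * M + 2 * (1168 * real P / L\<^sup>2 * (10 * real P * \<alpha> * V * M + 76 * real P * sqrt M)))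
     = (2 * L * real x / sqrt (real P))\<^sup>2 + 93440 * real x ^ 2 * (\<alpha> * V) + 710144 * (M * real P) * real P * sqrt M"
  proof -
    have "(2 * L * real x / sqrt (real P))\<^sup>2 = 4 * L\<^sup>2 * (M * real P)\<^sup>2 / real P"
      unfolding MP using Ppos by (simp add: power_divide power_mult_distrib)
    also have "\<dots> = 4 * L\<^sup>2 * M\<^sup>2 * real P" using Ppos by (simp add: power2_eq_square)
    finally show ?thesis unfolding MP[symmetric] using Lpos
      by (simp add: power2_eq_square field_simps)
  qed
  also have "710144 * (M * real P) * real P * sqrt M = 710144 * ((M * real P) * real P * sqrt M)" by simp
  also have "(M * real P) * real P * sqrt M = real x ^ 2 * sqrt (real P / real x)"
  proof -
    have "real P * sqrt M * sqrt (real P) = real P * sqrt (real x)"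
      using MP by (simp flip: real_sqrt_mult)
    then have "sqrt M * real P = real x * sqrt (real P / real x)"
      using Ppos xpos MP
      by (simp add: M_def real_sqrt_divide field_simps)
    then show ?thesis unfolding MP by (simp add: power2_eq_square mult_ac)
  qed
  finally have "B\<^sup>2 \<le> (2 * L * real x / sqrt (real P))\<^sup>2 + 93440 * real x ^ 2 * (\<alpha> * V) + 710144 * (real x ^ 2 * sqrt (real P / real x))"
    by (simp only: mult.assoc)
  then have "B \<le> sqrt ((2 * L * real x / sqrt (real P))\<^sup>2 + 93440 * real x ^ 2 * (\<alpha> * V) + 710144 * (real x ^ 2 * sqrt (real P / real x)))"
    by (rule real_le_rsqrt)
  also have "\<dots> \<le> sqrt ((2 * L * real x / sqrt (real P))\<^sup>2) + sqrt (93440 * real x ^ 2 * (\<alpha> * V)) + sqrt (710144 * (real x ^ 2 * sqrt (real P / real x)))"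
    using \<alpha> V1 by (intro sqrt_add3_le) auto
  also have "\<dots> \<le> 1000 * real x * (L / sqrt (real P)) + 1000 * real x * sqrt (\<alpha> * V) + 1000 * real x * sqrt (sqrt (real P / real x))"
  proof (intro add_mono)
    show "sqrt ((2 * L * real x / sqrt (real P))\<^sup>2) \<le> 1000 * real x * (L / sqrt (real P))"
      using Lpos xpos Ppos by (simp add: abs_mult divide_right_mono)
    show "sqrt (93440 * real x ^ 2 * (\<alpha> * V)) \<le> 1000 * real x * sqrt (\<alpha> * V)"
      using \<alpha> V1 by (intro real_le_lsqrt) (auto simp: power_mult_distrib mult_right_mono)
    show "sqrt (710144 * (real x ^ 2 * sqrt (real P / real x))) \<le> 1000 * real x * sqrt (sqrt (real P / real x))"
      by (intro real_le_lsqrt) (auto simp: power_mult_distrib mult_right_mono)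
  qed
  finally show ?thesis unfolding B_def L_def by (simp only: distrib_left)
qed

text \<open>For h < P now h\<alpha> < 1/2, so h\<alpha> is its own distance to the nearest integer
  and is at least \<alpha>. Bounding every pair count by P leaves L^2 P/\<alpha>, which is at most
  16 \<alpha>^-3 since P \<le> 1/\<alpha>, and the assumption on x turns this into 16 \<alpha>
  x.\<close>

lemma block_bound_small:
  fixes F a :: "nat \<Rightarrow> complex" and x P :: nat and \<alpha> :: real
  assumes P: "P \<ge> 2" "P \<le> x" and \<alpha>: "0 < \<alpha>" "\<alpha> \<le> 1 / 2" and P\<alpha>: "real P * \<alpha> < 1 / 2"
    and R: "R \<subseteq> {p \<in> {P..<P + P}. prime p}"
    and a: "\<And>p. p \<in> R \<Longrightarrow> norm (a p) \<le> ln (real p)"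
    and F: "\<And>n. (\<Sum>m=1..n. (norm (F m))\<^sup>2) \<le> real n"
    and x: "1 / \<alpha> ^ 4 \<le> real x"
  shows "norm (\<Sum>p\<in>R. \<Sum>m=1..x div p. a p * F m * ee (real p * real m * \<alpha>))
     \<le> 1000 * real x * (ln (real P) / sqrt (real P) + sqrt \<alpha>)"
proof -
  define M where "M = real x / real P"
  define L where "L = ln (real P)"
  define r where "r h = real (card {n \<in> {P..<P + P}. prime n \<and> prime (n + h)})" for h
  define B where "B = norm (\<Sum>p\<in>R. \<Sum>m=1..x div p. a p * F m * ee (real p * real m * \<alpha>))"
  have Ppos: "real P > 0" and xpos: "real x > 0" using P by auto
  have M1: "M \<ge> 1" using P by (simp add: M_def)
  have MP: "M * real P = real x" using P by (simp add: M_def)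
  have Lpos: "L > 0" using P by (simp add: L_def)
  have finR: "finite R" using R by (rule finite_subset) auto
  have ln2P: "ln (2 * real P) \<le> 2 * L"
  proof -
    have "ln (2 * real P) = ln 2 + L" using Ppos by (simp add: L_def ln_mult)
    moreover have "ln 2 \<le> L" using P by (simp add: L_def)
    ultimately show ?thesis by simp
  qed
  have "B\<^sup>2 \<le> M * (2 * L)\<^sup>2 * (\<Sum>p\<in>R. \<Sum>p'\<in>R. kap M ((real p - real p') * \<alpha>))"
    unfolding B_def M_def
  proof (rule bilinear_cauchy[OF _ finR _ _ F])
    show "norm (a p) \<le> 2 * L" if "p \<in> R" for p
    proof -
      have "p \<le> 2 * P" "p \<ge> 1" using R that P by auto
      then have "ln (real p) \<le> ln (2 * real P)" by (subst ln_le_cancel_iff) auto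
      then show ?thesis using a[OF that] ln2P by linarith
    qed
  qed (use P R in auto)
  also have "\<dots> \<le> M * (2 * L)\<^sup>2 * (real P * M + 2 * (\<Sum>h=1..<P. r h * kap M (real h * \<alpha>)))"
    unfolding r_def using P R M1 by (intro mult_left_mono sum_kap_pairs_le) auto
  also have "\<dots> \<le> M * (2 * L)\<^sup>2 * (real P * M + 2 * (\<Sum>h=1..<P. real P * (1 / \<alpha>)))"
  proof (intro mult_left_mono add_left_mono sum_mono)
    fix h assume h: "h \<in> {1..<P}"
    have "card {n \<in> {P..<P + P}. prime n \<and> prime (n + h)} \<le> card {P..<P + P}" by (intro card_mono) auto
    then have "r h \<le> real P" by (simp add: r_def)
    moreover have "kap M (real h * \<alpha>) \<le> 1 / \<alpha>"
    proof (rule kap_le_inverse)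
      have "real h * \<alpha> \<le> real P * \<alpha>" using h \<alpha> by (intro mult_right_mono) auto
      then have "real h * \<alpha> < 1 / 2" using P\<alpha> by linarith
      then have "round (real h * \<alpha>) = 0" using \<alpha> by (intro round_unique') auto
      then have "int_dist (real h * \<alpha>) = real h * \<alpha>" using \<alpha> by (simp add: int_dist_def)
      then show "\<alpha> \<le> int_dist (real h * \<alpha>)" using h \<alpha> by simp
    qed (use \<alpha> in auto)
    ultimately show "r h * kap M (real h * \<alpha>) \<le> real P * (1 / \<alpha>)"
      using M1 by (intro mult_mono kap_nonneg) auto
  qed (use M1 in auto)
  also have "\<dots> \<le> M * (2 * L)\<^sup>2 * (real P * M + 2 * (real P * (real P * (1 / \<alpha>))))"
  proof (intro mult_left_mono add_left_mono)
    show "(\<Sum>h=1..<P. real P * (1 / \<alpha>)) \<le> real P * (real P * (1 / \<alpha>))"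
      using P \<alpha> by (simp add: of_nat_diff mult_right_mono divide_right_mono)
  qed (use M1 in auto)
  also have "M * (2 * L)\<^sup>2 * (real P * M + 2 * (real P * (real P * (1 / \<alpha>))))
     = (2 * L * real x / sqrt (real P))\<^sup>2 + 8 * (M * real P) * (L\<^sup>2 * (real P / \<alpha>))"
  proof -
    have "(2 * L * real x / sqrt (real P))\<^sup>2 = 4 * L\<^sup>2 * (M * real P)\<^sup>2 / real P"
      unfolding MP using Ppos by (simp add: power_divide power_mult_distrib)
    also have "\<dots> = 4 * L\<^sup>2 * M\<^sup>2 * real P" using Ppos by (simp add: power2_eq_square)
    finally show ?thesis using \<alpha>
      by (simp add: power2_eq_square field_simps)
  qed
  finally have B2: "B\<^sup>2 \<le> (2 * L * real x / sqrt (real P))\<^sup>2 + 8 * real x * (L\<^sup>2 * (real P / \<alpha>))"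
    unfolding MP .
  have P1: "real P \<le> 1 / \<alpha>" using P\<alpha> \<alpha> by (simp add: field_simps)
  have "L\<^sup>2 * (real P / \<alpha>) \<le> 16 * (1 / \<alpha>) * ((1 / \<alpha>) / \<alpha>)"
  proof (rule mult_mono)
    have "L\<^sup>2 \<le> 16 * sqrt (real P)" unfolding L_def using P by (intro ln_square_le_sqrt) auto
    also have "sqrt (real P) \<le> real P" using P by (intro real_le_lsqrt) (auto simp: power2_eq_square)
    finally show "L\<^sup>2 \<le> 16 * (1 / \<alpha>)" using P1 by linarith
    show "real P / \<alpha> \<le> (1 / \<alpha>) / \<alpha>" using P1 \<alpha> by (intro divide_right_mono) auto
  qed (use \<alpha> in auto)
  also have "\<dots> = 16 * \<alpha> * (1 / \<alpha> ^ 4)" using \<alpha> by (simp add: power_eq_if field_simps)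
  also have "\<dots> \<le> 16 * \<alpha> * real x" using x \<alpha> by (intro mult_left_mono) auto
  finally have "8 * real x * (L\<^sup>2 * (real P / \<alpha>)) \<le> 128 * real x ^ 2 * \<alpha>"
    using mult_left_mono[of "L\<^sup>2 * (real P / \<alpha>)" "16 * \<alpha> * real x" "8 * real x"] by (simp add: power2_eq_square mult_ac)
  then have "B\<^sup>2 \<le> (2 * L * real x / sqrt (real P))\<^sup>2 + 128 * real x ^ 2 * \<alpha>" using B2 by linarith
  then have "B \<le> sqrt ((2 * L * real x / sqrt (real P))\<^sup>2 + 128 * real x ^ 2 * \<alpha>)"
    by (rule real_le_rsqrt)
  also have "\<dots> \<le> sqrt ((2 * L * real x / sqrt (real P))\<^sup>2) + sqrt (128 * real x ^ 2 * \<alpha>)"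
    using \<alpha> by (intro sqrt_add_le_add_sqrt) auto
  also have "\<dots> \<le> 1000 * real x * (L / sqrt (real P)) + 1000 * real x * sqrt \<alpha>"
  proof (intro add_mono)
    show "sqrt ((2 * L * real x / sqrt (real P))\<^sup>2) \<le> 1000 * real x * (L / sqrt (real P))"
      using Lpos xpos Ppos by (simp add: abs_mult divide_right_mono)
    show "sqrt (128 * real x ^ 2 * \<alpha>) \<le> 1000 * real x * sqrt \<alpha>"
      using \<alpha> by (intro real_le_lsqrt) (auto simp: power_mult_distrib mult_right_mono)
  qed
  finally show ?thesis unfolding B_def L_def by (simp only: distrib_left)
qed

text \<open>The ratio is 2^(-1/4). It is at most 6/7 because (6/7)^4 = 1296/2401 exceeds 1/2, so the
  geometric series stays below 7.\<close>

lemma sum_geometric_quarter_le: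
  defines "\<rho> \<equiv> sqrt (sqrt (1 / 2 :: real))"
  shows "(\<Sum>i\<le>k. \<rho> ^ i) \<le> 7" and "\<rho> ^ 4 = 1 / 2" and "0 < \<rho>" and "\<rho> \<le> 6 / 7"
proof -
  show r4: "\<rho> ^ 4 = 1 / 2"
  proof -
    have "\<rho> ^ 4 = (\<rho>\<^sup>2)\<^sup>2" by (simp flip: power_mult)
    also have "\<rho>\<^sup>2 = sqrt (1 / 2)" unfolding \<rho>_def by (rule real_sqrt_pow2) simp
    also have "(sqrt (1 / 2))\<^sup>2 = (1 / 2 :: real)" by (rule real_sqrt_pow2) simp
    finally show ?thesis .
  qed
  show pos: "0 < \<rho>" by (simp add: \<rho>_def)
  show le: "\<rho> \<le> 6 / 7"
  proof (rule power_le_imp_le_base[of _ 3])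
    show "\<rho> ^ Suc 3 \<le> (6 / 7) ^ Suc 3" using r4 by (simp add: eval_nat_numeral)
  qed auto
  have "(\<Sum>i\<le>k. \<rho> ^ i) = (1 - \<rho> ^ Suc k) / (1 - \<rho>)"
    using le by (simp add: sum_gp0)
  also have "\<dots> \<le> 1 / (1 - \<rho>)" using pos le by (intro divide_right_mono) auto
  also have "\<dots> \<le> 1 / (1 / 7)" using le by (intro divide_left_mono) auto
  finally show "(\<Sum>i\<le>k. \<rho> ^ i) \<le> 7" by simp
qed

text \<open>The first term decays geometrically in i and the third in k - i, so together they
  contribute at most 6 * 7 + 7 = 49 for any number of blocks. Only \<delta> is paid once per block,
  and k \<le> 2 ln x.\<close>

lemma dyadic_sum_bound:
  fixes x k :: nat
  assumes k: "2 ^ k \<le> x" and x: "x \<ge> 2" and \<delta>: "\<delta> \<ge> 0"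
  shows "(\<Sum>i=1..k. ln (real (2 ^ i)) / sqrt (real (2 ^ i)) + \<delta> + sqrt (sqrt (real (2 ^ i) / real x)))
      \<le> 50 + 2 * ln (real x) * \<delta>"
proof -
  define \<rho> where "\<rho> = sqrt (sqrt (1 / 2 :: real))"
  note \<rho> = sum_geometric_quarter_le[folded \<rho>_def]
  have half: "(1 / 2 :: real) ^ i = (\<rho> ^ i) ^ 4" for i
  proof -
    have "(1 / 2 :: real) ^ i = (\<rho> ^ 4) ^ i" by (simp only: \<rho>(2))
    also have "\<dots> = \<rho> ^ (4 * i)" by (rule power_mult[symmetric])
    also have "\<dots> = \<rho> ^ (i * 4)" by (simp add: mult.commute)
    also have "\<dots> = (\<rho> ^ i) ^ 4" by (rule power_mult)
    finally show ?thesis .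
  qed
  have s: "sqrt ((1 / 2 :: real) ^ i) = (\<rho> ^ i)\<^sup>2" "sqrt (sqrt ((1 / 2 :: real) ^ i)) = \<rho> ^ i" for i
  proof -
    have "y ^ 4 = (y\<^sup>2)\<^sup>2" for y :: real by (simp flip: power_mult)
    then have "(\<rho> ^ i) ^ 4 = ((\<rho> ^ i)\<^sup>2)\<^sup>2" .
    then show "sqrt ((1 / 2 :: real) ^ i) = (\<rho> ^ i)\<^sup>2" unfolding half by (simp only: real_sqrt_abs abs_power2)
    then show "sqrt (sqrt ((1 / 2 :: real) ^ i)) = \<rho> ^ i" using \<rho>(3) by simp
  qed
  have t1: "ln (real (2 ^ i)) / sqrt (real (2 ^ i)) \<le> 6 * \<rho> ^ i" for i
  proof -
    have ln2: "ln (2::real) \<le> 1" using ln_le_minus_one[of "2::real"] by simp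
    have "ln (real (2 ^ i)) / sqrt (real (2 ^ i)) = real i * ln 2 * sqrt ((1 / 2) ^ i)"
      by (simp add: ln_realpow real_sqrt_divide power_one_over)
    also have "\<dots> \<le> real i * 1 * sqrt ((1 / 2) ^ i)" using ln2 by (intro mult_right_mono mult_left_mono) auto
    also have "\<dots> = (real i * \<rho> ^ i) * \<rho> ^ i" unfolding s by (simp add: power2_eq_square)
    also have "\<dots> \<le> 6 * \<rho> ^ i"
    proof (rule mult_right_mono)
      have "1 + real i * (1 / 6) \<le> (1 + 1 / 6) ^ i" by (rule Bernoulli_inequality) simp
      then have "real i \<le> 6 * (7 / 6 :: real) ^ i" by simp
      then have "real i * \<rho> ^ i \<le> 6 * (7 / 6 :: real) ^ i * (6 / 7) ^ i"
        using \<rho> by (intro mult_mono power_mono) auto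
      also have "\<dots> = 6" by (simp flip: power_mult_distrib)
      finally show "real i * \<rho> ^ i \<le> 6" .
    qed (use \<rho>(3) in auto)
    finally show ?thesis .
  qed
  have t3: "sqrt (sqrt (real (2 ^ i) / real x)) \<le> \<rho> ^ (k - i)" if "i \<le> k" for i
  proof -
    have "real (2 ^ k) \<le> real x" using k by (simp only: of_nat_le_iff)
    then have "real (2 ^ i) / real x \<le> 2 ^ i / 2 ^ k" using x by (simp add: divide_left_mono)
    also have "\<dots> = (1 / 2) ^ (k - i)" using that by (simp add: power_diff power_one_over)
    finally have "sqrt (sqrt (real (2 ^ i) / real x)) \<le> sqrt (sqrt ((1 / 2) ^ (k - i)))" by (intro real_sqrt_le_mono)
    then show ?thesis unfolding s(2) .
  qed
  have "(\<Sum>i=1..k. ln (real (2 ^ i)) / sqrt (real (2 ^ i)) + \<delta> + sqrt (sqrt (real (2 ^ i) / real x)))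
     \<le> (\<Sum>i=1..k. 6 * \<rho> ^ i + \<delta> + \<rho> ^ (k - i))"
    using t1 t3 by (intro sum_mono add_mono) auto
  also have "\<dots> = 6 * (\<Sum>i=1..k. \<rho> ^ i) + real k * \<delta> + (\<Sum>i=1..k. \<rho> ^ (k - i))"
    by (simp add: sum.distrib sum_distrib_left)
  also have "(\<Sum>i=1..k. \<rho> ^ i) \<le> (\<Sum>i\<le>k. \<rho> ^ i)" using \<rho>(3) by (intro sum_mono2) auto
  also have "(\<Sum>i=1..k. \<rho> ^ (k - i)) = (\<Sum>i<k. \<rho> ^ i)"
    by (rule sum.reindex_bij_witness[of _ "\<lambda>i. k - i" "\<lambda>i. k - i"]) auto
  also have "(\<Sum>i<k. \<rho> ^ i) \<le> (\<Sum>i\<le>k. \<rho> ^ i)" using \<rho>(3) by (intro sum_mono2) auto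
  finally have "(\<Sum>i=1..k. ln (real (2 ^ i)) / sqrt (real (2 ^ i)) + \<delta> + sqrt (sqrt (real (2 ^ i) / real x)))
     \<le> 6 * (\<Sum>i\<le>k. \<rho> ^ i) + real k * \<delta> + (\<Sum>i\<le>k. \<rho> ^ i)" by simp
  moreover have "(\<Sum>i\<le>k. \<rho> ^ i) \<le> 7" by (rule \<rho>(1))
  moreover have "real k * \<delta> \<le> 2 * ln (real x) * \<delta>"
  proof (rule mult_right_mono[OF _ \<delta>])
    have "ln (1 / 2 :: real) \<le> 1 / 2 - 1" by (rule ln_le_minus_one) simp
    then have ln2: "ln (2 :: real) \<ge> 1 / 2" by (simp add: ln_div)
    have "real (2 ^ k) \<le> real x" using k by (simp only: of_nat_le_iff)
    then have "ln (2 ^ k) \<le> ln (real x)" using x by (subst ln_le_cancel_iff) auto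
    then have "real k * ln 2 \<le> ln (real x)" by (simp add: ln_realpow)
    moreover have "real k * (1 / 2) \<le> real k * ln 2" using ln2 by (intro mult_left_mono) auto
    ultimately show "real k \<le> 2 * ln (real x)" by linarith
  qed
  ultimately show ?thesis by linarith
qed

text \<open>The free predicate Q serves to leave out the primes dividing the modulus. In the blocks
  with P\<alpha> < 1/2 the bound with sqrt \<alpha> is weakened to sqrt(\<alpha> V), using V \<ge>
  1, so that all blocks have the same shape.\<close>

lemma bilinear_prime_sum_bound:
  fixes F a :: "nat \<Rightarrow> complex" and x :: nat and \<alpha> V :: real
  assumes \<alpha>: "0 < \<alpha>" "\<alpha> \<le> 1 / 2" and x: "1 / \<alpha> ^ 4 \<le> real x"
    and a: "\<And>p. norm (a p) \<le> ln (real p)"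
    and F: "\<And>n. (\<Sum>m=1..n. (norm (F m))\<^sup>2) \<le> real n"
    and V: "\<And>h. 0 < h \<Longrightarrow> h \<le> x \<Longrightarrow> inv_totient_ratio (2 * h) \<le> V"
  shows "norm (\<Sum>p | prime p \<and> p \<le> x \<and> Q p. \<Sum>m=1..x div p. a p * F m * ee (real p * real m * \<alpha>))
     \<le> 50000 * real x * (1 + ln (real x) * sqrt (\<alpha> * V))"
proof -
  have x2: "x \<ge> 2"
  proof -
    have "\<alpha> ^ 4 \<le> (1 / 2) ^ 4" using \<alpha> by (intro power_mono) auto
    then have "1 / (1 / 2) ^ 4 \<le> 1 / \<alpha> ^ 4" using \<alpha> by (intro divide_left_mono) auto
    then have "16 \<le> real x" using x by (simp add: power_one_over)
    then show ?thesis by linarith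
  qed
  define S where "S p = (\<Sum>m=1..x div p. a p * F m * ee (real p * real m * \<alpha>))" for p
  define R where "R i = {p. prime p \<and> p \<le> x \<and> Q p \<and> 2 ^ i \<le> p \<and> p < 2 * 2 ^ i}" for i :: nat
  have finR: "finite (R i)" for i unfolding R_def by (rule finite_subset[of _ "{..x}"]) auto
  define k where "k = nat \<lfloor>log 2 (real x)\<rfloor>"
  have k1: "2 ^ k \<le> x"
  proof -
    have "real k \<le> log 2 (real x)" using x2 by (simp add: k_def)
    then have "2 powr (real k) \<le> 2 powr (log 2 (real x))" by (intro powr_mono) auto
    then have "real (2 ^ k) \<le> real x" using x2 by (simp add: powr_realpow)
    then show ?thesis by (simp only: of_nat_le_iff)
  qed
  have k2: "x < 2 ^ Suc k"
  proof -
    have "log 2 (real x) < real (Suc k)"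
      unfolding k_def using x2 real_of_int_floor_add_one_gt[of "log 2 (real x)"] by (simp add: add.commute)
    then have "2 powr (log 2 (real x)) < 2 powr (real (Suc k))" by (intro powr_less_mono) auto
    then have "real x < real (2 ^ Suc k)" using x2 by (simp only: powr_realpow) (simp add: powr_realpow del: power_Suc)
    then show ?thesis by (simp only: of_nat_less_iff)
  qed
  have V1: "V \<ge> 1" using V[of 1] inv_totient_ratio_ge_1[of 2] x2 by simp
  have "{p. prime p \<and> p \<le> x \<and> Q p} = (\<Union>i\<in>{1..k}. R i)"
  proof (intro Set.set_eqI iffI)
    fix p assume p: "p \<in> {p. prime p \<and> p \<le> x \<and> Q p}"
    define i where "i = nat \<lfloor>log 2 (real p)\<rfloor>"
    have p2: "p \<ge> 2" using p prime_ge_2_nat by auto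
    have "real i \<le> log 2 (real p)" "log 2 (real p) < real (Suc i)"
      using p2 real_of_int_floor_add_one_gt[of "log 2 (real p)"] unfolding i_def
      by (auto simp: le_nat_iff add.commute)
    then have "2 powr (real i) \<le> 2 powr (log 2 (real p))" "2 powr (log 2 (real p)) < 2 powr (real (Suc i))"
      by (auto intro: powr_mono powr_less_mono)
    then have "real (2 ^ i) \<le> real p" "real p < real (2 ^ Suc i)"
      using p2 by (auto simp: powr_realpow powr_add)
    then have i: "2 ^ i \<le> p" "p < 2 ^ Suc i" by (simp_all only: of_nat_le_iff of_nat_less_iff)
    have "i \<ge> 1" using i p2 by (cases i) auto
    moreover have "i \<le> k"
    proof -
      have "(2::nat) ^ i < 2 ^ Suc k" using i p k2 by simp
      then have "i < Suc k" by (rule power_less_imp_less_exp[rotated]) simp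
      then show ?thesis by simp
    qed
    ultimately show "p \<in> (\<Union>i\<in>{1..k}. R i)" using i p by (auto simp: R_def)
  qed (auto simp: R_def)
  then have "(\<Sum>p | prime p \<and> p \<le> x \<and> Q p. S p) = (\<Sum>p\<in>(\<Union>i\<in>{1..k}. R i). S p)" by (simp only:)
  also have "\<dots> = (\<Sum>i=1..k. \<Sum>p\<in>R i. S p)"
  proof (rule sum.UNION_disjoint)
    show "\<forall>i\<in>{1..k}. \<forall>j\<in>{1..k}. i \<noteq> j \<longrightarrow> R i \<inter> R j = {}"
    proof (intro ballI impI)
      fix i j :: nat assume "i \<noteq> j"
      have "R i \<inter> R j = {}" if "i < j" for i j
      proof -
        have "(2::nat) * 2 ^ i \<le> 2 ^ j" using that power_increasing[of "Suc i" j "2::nat"] by simp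
        then show ?thesis by (auto simp: R_def)
      qed
      then show "R i \<inter> R j = {}" using \<open>i \<noteq> j\<close> by (metis inf_commute linorder_neqE_nat)
    qed
  qed (use finR in auto)
  finally have "norm (\<Sum>p | prime p \<and> p \<le> x \<and> Q p. S p) \<le> (\<Sum>i=1..k. norm (\<Sum>p\<in>R i. S p))"
    by (simp only: norm_sum)
  also have "\<dots> \<le> (\<Sum>i=1..k. 1000 * real x * (ln (real (2 ^ i)) / sqrt (real (2 ^ i)) + sqrt (\<alpha> * V) + sqrt (sqrt (real (2 ^ i) / real x))))"
  proof (rule sum_mono)
    fix i assume i: "i \<in> {1..k}"
    define P :: nat where "P = 2 ^ i"
    have "(2::nat) ^ 1 \<le> 2 ^ i" using i by (intro power_increasing) auto
    then have P2: "P \<ge> 2" by (simp add: P_def)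
    have "(2::nat) ^ i \<le> 2 ^ k" using i by (intro power_increasing) auto
    then have Px: "P \<le> x" unfolding P_def using k1 by (rule order_trans)
    have R: "R i \<subseteq> {p \<in> {P..<P + P}. prime p}" by (auto simp: R_def P_def)
    have "norm (\<Sum>p\<in>R i. S p) \<le> 1000 * real x * (ln (real P) / sqrt (real P) + sqrt (\<alpha> * V) + sqrt (sqrt (real P / real x)))"
    proof (cases "real P * \<alpha> \<ge> 1 / 2")
      case True
      show ?thesis unfolding S_def
        by (rule block_bound_large[OF P2 Px \<alpha> True R a F V])
    next
      case False
      then have "norm (\<Sum>p\<in>R i. S p) \<le> 1000 * real x * (ln (real P) / sqrt (real P) + sqrt \<alpha>)"
        unfolding S_def by (intro block_bound_small[OF P2 Px \<alpha> _ R a F x]) auto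
      also have "\<dots> \<le> 1000 * real x * (ln (real P) / sqrt (real P) + sqrt (\<alpha> * V) + sqrt (sqrt (real P / real x)))"
      proof (rule mult_left_mono)
        have "sqrt \<alpha> \<le> sqrt (\<alpha> * V)" using V1 \<alpha> mult_left_mono[of 1 V \<alpha>] by simp
        moreover have "sqrt (sqrt (real P / real x)) \<ge> 0" by simp
        ultimately show "ln (real P) / sqrt (real P) + sqrt \<alpha> \<le> ln (real P) / sqrt (real P) + sqrt (\<alpha> * V) + sqrt (sqrt (real P / real x))"
          by linarith
      qed auto
      finally show ?thesis .
    qed
    then show "norm (\<Sum>p\<in>R i. S p) \<le> 1000 * real x * (ln (real (2 ^ i)) / sqrt (real (2 ^ i)) + sqrt (\<alpha> * V) + sqrt (sqrt (real (2 ^ i) / real x)))"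
      by (simp only: P_def)
  qed
  also have "\<dots> = 1000 * real x * (\<Sum>i=1..k. ln (real (2 ^ i)) / sqrt (real (2 ^ i)) + sqrt (\<alpha> * V) + sqrt (sqrt (real (2 ^ i) / real x)))"
    by (rule sum_distrib_left[symmetric])
  also have "\<dots> \<le> 1000 * real x * (50 + 2 * ln (real x) * sqrt (\<alpha> * V))"
    using \<alpha> V1 by (intro mult_left_mono dyadic_sum_bound k1 x2) auto
  also have "\<dots> \<le> 50000 * real x * (1 + ln (real x) * sqrt (\<alpha> * V))"
  proof -
    have "0 \<le> real x * (ln (real x) * sqrt (\<alpha> * V))" using x2 \<alpha> V1 by (intro mult_nonneg_nonneg) auto
    then show ?thesis by (simp add: algebra_simps)
  qed
  finally show ?thesis unfolding S_def .
qed

section \<open>Logarithmically weighted sums\<close>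

lemma sum_divisors_swap:
  fixes f :: "nat \<Rightarrow> nat \<Rightarrow> 'a :: comm_monoid_add"
  shows "(\<Sum>k=1..x. \<Sum>d | d dvd k \<and> Q d. f d k) = (\<Sum>d | d \<in> {1..x} \<and> Q d. \<Sum>m=1..x div d. f d (d * m))"
proof -
  have "(\<Sum>k=1..x. \<Sum>d | d dvd k \<and> Q d. f d k) = (\<Sum>k=1..x. \<Sum>d | d \<in> {d \<in> {1..x}. Q d} \<and> d dvd k. f d k)"
  proof (intro sum.cong refl)
    fix k assume "k \<in> {1..x}"
    then show "{d. d dvd k \<and> Q d} = {d. d \<in> {d \<in> {1..x}. Q d} \<and> d dvd k}"
      by (auto simp: Suc_le_eq dvd_pos_nat intro: order_trans[OF dvd_imp_le])
  qed
  also have "\<dots> = (\<Sum>d\<in>{d \<in> {1..x}. Q d}. \<Sum>k | k \<in> {1..x} \<and> d dvd k. f d k)"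
    by (rule sum.swap_restrict) auto
  also have "\<dots> = (\<Sum>d | d \<in> {1..x} \<and> Q d. \<Sum>m=1..x div d. f d (d * m))"
  proof (rule sum.cong)
    fix d assume d: "d \<in> {d. d \<in> {1..x} \<and> Q d}"
    then have d0: "d > 0" by auto
    show "(\<Sum>k | k \<in> {1..x} \<and> d dvd k. f d k) = (\<Sum>m=1..x div d. f d (d * m))"
    proof (rule sum.reindex_bij_witness[of _ "\<lambda>m. d * m" "\<lambda>k. k div d"])
      fix m assume "m \<in> {1..x div d}"
      then show "d * m \<in> {k. k \<in> {1..x} \<and> d dvd k}" using d0
        by (auto simp: less_eq_div_iff_mult_less_eq mult.commute Suc_le_eq)
    next
      fix k assume k: "k \<in> {k. k \<in> {1..x} \<and> d dvd k}"
      then have "k div d \<ge> 1" using d0 by (auto simp: Suc_le_eq div_greater_zero_iff dvd_imp_le)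
      then show "k div d \<in> {1..x div d}" using k by (auto intro: div_le_mono)
    qed (use d0 in auto)
  qed auto
  finally show ?thesis .
qed

lemma mangoldt_real_nonneg: "mangoldt d \<ge> (0::real)"
proof (cases "primepow d")
  case True
  then have "aprimedivisor d > 0" using primepow_gt_Suc_0 by (intro aprimedivisor_gt_0_nat) auto
  then show ?thesis using True by (simp add: mangoldt_def)
qed (simp add: mangoldt_def)

lemma ln_le_two_sqrt:
  assumes "x \<ge> (1::real)"
  shows "ln x \<le> 2 * sqrt x"
proof -
  have "ln (sqrt x) \<le> sqrt x - 1" using assms by (intro ln_le_minus_one) auto
  then show ?thesis using assms by (simp add: ln_sqrt)
qed

text \<open>For fixed p the powers from p^2 on give at most 2 ln p / p^2, which ln p \<le> 2 sqrt p
  bounds by 4 p^(-3/2); the sum over p is at most 4 * 3.\<close>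

lemma sum_mangoldt_higher_prime_powers:
  "(\<Sum>d | d \<in> {1..x} \<and> \<not> prime d. mangoldt d / real d) \<le> (12 :: real)"
proof -
  let ?A = "{p. prime p \<and> p \<in> {1..x}} \<times> {..x}"
  let ?f = "\<lambda>(p, j). p ^ (j + 2) :: nat"
  have "(\<Sum>d | d \<in> {1..x} \<and> \<not> prime d. mangoldt d / real d) = (\<Sum>d | d \<in> {1..x} \<and> \<not> prime d \<and> primepow d. mangoldt d / real d :: real)"
    by (rule sum.mono_neutral_right) (auto simp: mangoldt_def)
  also have "\<dots> \<le> (\<Sum>d\<in>?f ` ?A. mangoldt d / real d)"
  proof (rule sum_mono2)
    show "{d. d \<in> {1..x} \<and> \<not> prime d \<and> primepow d} \<subseteq> ?f ` ?A"
    proof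
      fix d assume d: "d \<in> {d. d \<in> {1..x} \<and> \<not> prime d \<and> primepow d}"
      then obtain p k where pk: "prime p" "k > 0" "d = p ^ k" by (auto simp: primepow_def)
      have k2: "k \<ge> 2" using d pk by (cases "k = 1") auto
      have p2: "p \<ge> 2" using pk prime_ge_2_nat by blast
      have "p ^ 1 \<le> p ^ k" using p2 pk by (intro power_increasing) auto
      then have "p \<le> x" using d pk by auto
      moreover have "k \<le> x"
      proof -
        have "k < 2 ^ k" by (rule less_exp)
        also have "(2::nat) ^ k \<le> p ^ k" using p2 by (intro power_mono) auto
        also have "p ^ k \<le> x" using d pk by simp
        finally show ?thesis by simp
      qed
      ultimately have "(p, k - 2) \<in> ?A" using d pk p2 by auto
      moreover have "d = ?f (p, k - 2)" using pk k2 by (simp only: prod.case le_add_diff_inverse2)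
      ultimately show "d \<in> ?f ` ?A" by (rule rev_image_eqI)
    qed
  qed (auto simp: mangoldt_real_nonneg)
  also have "\<dots> \<le> (\<Sum>z\<in>?A. mangoldt (?f z) / real (?f z))"
    using sum_image_le[of ?A "\<lambda>d. mangoldt d / real d :: real" ?f] by (simp add: mangoldt_real_nonneg comp_def)
  also have "\<dots> = (\<Sum>p | prime p \<and> p \<in> {1..x}. \<Sum>j\<le>x. mangoldt (p ^ (j + 2)) / real (p ^ (j + 2)))"
    by (subst sum.cartesian_product) (simp add: case_prod_unfold)
  also have "\<dots> \<le> (\<Sum>p | prime p \<and> p \<in> {1..x}. 4 / (real p * sqrt (real p)))"
  proof (rule sum_mono)
    fix p assume "p \<in> {p. prime p \<and> p \<in> {1..x}}"
    then have p: "prime p" "p \<ge> 2" using prime_ge_2_nat by auto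
    define t where "t = 1 / real p"
    have t: "0 < t" "t \<le> 1 / 2" using p by (auto simp: t_def field_simps)
    have "(\<Sum>j\<le>x. mangoldt (p ^ (j + 2)) / real (p ^ (j + 2))) = (\<Sum>j\<le>x. ln (real p) * t\<^sup>2 * t ^ j)"
    proof (intro sum.cong refl)
      fix j
      have "mangoldt (p ^ (j + 2)) = ln (real p)" by (subst mangoldt_primepow'[OF p(1)]) simp_all
      moreover have "1 / real (p ^ (j + 2)) = t\<^sup>2 * t ^ j" by (simp add: t_def power_one_over power_add power2_eq_square)
      ultimately show "mangoldt (p ^ (j + 2)) / real (p ^ (j + 2)) = ln (real p) * t\<^sup>2 * t ^ j"
        by (metis (no_types, lifting) mult.assoc mult.right_neutral times_divide_eq_right)
    qed
    also have "\<dots> = ln (real p) * t\<^sup>2 * (\<Sum>j\<le>x. t ^ j)" by (rule sum_distrib_left[symmetric])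
    also have "(\<Sum>j\<le>x. t ^ j) = (1 - t ^ Suc x) / (1 - t)" using t by (simp add: sum_gp0)
    also have "ln (real p) * t\<^sup>2 * ((1 - t ^ Suc x) / (1 - t)) \<le> (2 * sqrt (real p)) * t\<^sup>2 * (1 / (1 / 2))"
    proof (intro mult_mono frac_le ln_le_two_sqrt)
      show "0 \<le> (1 - t ^ Suc x) / (1 - t)" using t by (intro divide_nonneg_nonneg) (auto intro!: mult_le_one power_le_one)
    qed (use t p in auto)
    also have "\<dots> = 4 / (real p * sqrt (real p))"
    proof -
      have "sqrt (real p) * (sqrt (real p)) = real p" by simp
      then show ?thesis using p by (simp add: t_def field_simps power2_eq_square)
    qed
    finally show "(\<Sum>j\<le>x. mangoldt (p ^ (j + 2)) / real (p ^ (j + 2))) \<le> 4 / (real p * sqrt (real p))" .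
  qed
  also have "\<dots> \<le> (\<Sum>p=1..x. 4 * (1 / (real p * sqrt (real p))))"
    by (rule order_trans[OF sum_mono2[of "{1..x}"]]) auto
  also have "\<dots> = 4 * (\<Sum>p=1..x. 1 / (real p * sqrt (real p)))" by (rule sum_distrib_left[symmetric])
  also have "\<dots> \<le> 12" using sum_inverse_three_halves_le[of x] by simp
  finally show ?thesis .
qed

lemma sum_norm_le_of_square_mean:
  fixes F :: "nat \<Rightarrow> complex"
  assumes "(\<Sum>m=1..n. (norm (F m))\<^sup>2) \<le> real n"
  shows "(\<Sum>m=1..n. norm (F m)) \<le> real n"
proof -
  have "(\<Sum>m=1..n. norm (F m) * 1)\<^sup>2 \<le> (\<Sum>m=1..n. (norm (F m))\<^sup>2) * (\<Sum>m=1..n. 1\<^sup>2)"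
    by (rule Cauchy_Schwarz_ineq_sum)
  also have "\<dots> \<le> real n * real n" using assms by (simp add: mult_right_mono)
  finally have "(\<Sum>m=1..n. norm (F m))\<^sup>2 \<le> (real n)\<^sup>2" by (simp add: power2_eq_square)
  then show ?thesis by (rule power2_le_imp_le) simp
qed

text \<open>The divisors d in ln k = \<Sum> \<Lambda>(d) are split into primes not dividing q
  (\<open>Q1\<close>, a bilinear sum since F is multiplicative there), other d coprime to q
  (\<open>Q2\<close>, estimated trivially) and d sharing a factor with q (\<open>Q3\<close>, left to
  hypothesis \<open>D\<close>). They contribute 50000, 12 and D to the constant.\<close>

lemma twisted_log_sum_bound:
  fixes F c :: "nat \<Rightarrow> complex" and q x :: nat and \<alpha> V D :: real
  assumes \<alpha>: "0 < \<alpha>" "\<alpha> \<le> 1 / 2" and x: "1 / \<alpha> ^ 4 \<le> real x"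
    and F: "\<And>n. (\<Sum>m=1..n. (norm (F m))\<^sup>2) \<le> real n"
    and mult: "\<And>p m. prime p \<Longrightarrow> \<not> p dvd q \<Longrightarrow> F (p * m) = c p * F m"
    and c: "\<And>p. norm (c p) \<le> 1"
    and D: "(\<Sum>k=1..x. norm (F k) * (\<Sum>d | d dvd k \<and> \<not> coprime d q. mangoldt d)) \<le> D * real x"
    and V: "\<And>h. 0 < h \<Longrightarrow> h \<le> x \<Longrightarrow> inv_totient_ratio (2 * h) \<le> V"
  shows "norm (\<Sum>k=1..x. F k * ee (real k * \<alpha>) * of_real (ln (real k)))
     \<le> (50012 + D) * real x * (1 + ln (real x) * sqrt (\<alpha> * V))"
proof -
  define Q1 where "Q1 d \<longleftrightarrow> prime d \<and> \<not> d dvd q" for d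
  define Q2 where "Q2 d \<longleftrightarrow> \<not> prime d \<and> coprime d q" for d
  define Q3 where "Q3 d \<longleftrightarrow> \<not> coprime d q" for d
  define e where "e k = F k * ee (real k * \<alpha>)" for k
  have ne: "norm (e k) = norm (F k)" for k by (simp add: e_def norm_mult)
  define \<Lambda> :: "nat \<Rightarrow> real" where "\<Lambda> = mangoldt"
  have \<Lambda>0: "\<Lambda> d \<ge> 0" for d by (simp add: \<Lambda>_def mangoldt_real_nonneg)
  define T where "T Q = (\<Sum>k=1..x. \<Sum>d | d dvd k \<and> Q d. of_real (\<Lambda> d) * e k)" for Q
  have "(\<Sum>k=1..x. F k * ee (real k * \<alpha>) * of_real (ln (real k))) = T Q1 + T Q2 + T Q3"
    unfolding T_def sum.distrib[symmetric]
  proof (rule sum.cong[OF refl])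
    fix k assume "k \<in> {1..x}"
    then have k: "k > 0" by simp
    let ?S = "\<lambda>Q. {d. d dvd k \<and> Q d}"
    have fin: "finite (?S Q)" for Q using k by auto
    have "{d. d dvd k} = (?S Q1 \<union> ?S Q2) \<union> ?S Q3"
      by (auto simp: Q1_def Q2_def Q3_def coprime_commute intro: prime_imp_coprime)
    then have "(\<Sum>d | d dvd k. \<Lambda> d) = (\<Sum>d\<in>(?S Q1 \<union> ?S Q2) \<union> ?S Q3. \<Lambda> d)" by (rule arg_cong)
    also have "\<dots> = (\<Sum>d\<in>?S Q1 \<union> ?S Q2. \<Lambda> d) + (\<Sum>d\<in>?S Q3. \<Lambda> d)"
    proof (rule sum.union_disjoint)
      have "coprime d q" if "Q1 d" for d using that by (auto simp: Q1_def prime_imp_coprime)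
      then show "(?S Q1 \<union> ?S Q2) \<inter> ?S Q3 = {}" by (auto simp: Q2_def Q3_def)
    qed (use fin in auto)
    also have "(\<Sum>d\<in>?S Q1 \<union> ?S Q2. \<Lambda> d) = (\<Sum>d\<in>?S Q1. \<Lambda> d) + (\<Sum>d\<in>?S Q2. \<Lambda> d)"
      by (rule sum.union_disjoint) (use fin in \<open>auto simp: Q1_def Q2_def\<close>)
    also have "(\<Sum>d | d dvd k. \<Lambda> d) = ln (real k)" unfolding \<Lambda>_def using mangoldt_sum[of k, where 'a = real] k by simp
    finally have ln: "ln (real k) = (\<Sum>d\<in>?S Q1. \<Lambda> d) + (\<Sum>d\<in>?S Q2. \<Lambda> d) + (\<Sum>d\<in>?S Q3. \<Lambda> d)" .
    have "F k * ee (real k * \<alpha>) * of_real (ln (real k)) = of_real (ln (real k)) * e k" by (simp add: e_def)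
    also have "\<dots> = of_real (\<Sum>d\<in>?S Q1. \<Lambda> d) * e k + of_real (\<Sum>d\<in>?S Q2. \<Lambda> d) * e k + of_real (\<Sum>d\<in>?S Q3. \<Lambda> d) * e k"
      unfolding ln by (simp only: of_real_add distrib_right)
    also have "\<dots> = (\<Sum>d\<in>?S Q1. of_real (\<Lambda> d) * e k) + (\<Sum>d\<in>?S Q2. of_real (\<Lambda> d) * e k) + (\<Sum>d\<in>?S Q3. of_real (\<Lambda> d) * e k)"
      by (simp only: of_real_sum sum_distrib_right)
    finally show "F k * ee (real k * \<alpha>) * of_real (ln (real k)) =
       (\<Sum>d\<in>?S Q1. of_real (\<Lambda> d) * e k) + (\<Sum>d\<in>?S Q2. of_real (\<Lambda> d) * e k) + (\<Sum>d\<in>?S Q3. of_real (\<Lambda> d) * e k)" .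
  qed
  moreover have "norm (T Q1) \<le> 50000 * real x * (1 + ln (real x) * sqrt (\<alpha> * V))"
  proof -
    have "T Q1 = (\<Sum>d | d \<in> {1..x} \<and> Q1 d. \<Sum>m=1..x div d. of_real (\<Lambda> d) * e (d * m))"
      unfolding T_def by (rule sum_divisors_swap)
    also have "\<dots> = (\<Sum>p | prime p \<and> p \<le> x \<and> \<not> p dvd q. \<Sum>m=1..x div p. (of_real (\<Lambda> p) * c p) * F m * ee (real p * real m * \<alpha>))"
    proof (rule sum.cong)
      show "{d. d \<in> {1..x} \<and> Q1 d} = {p. prime p \<and> p \<le> x \<and> \<not> p dvd q}"
        by (auto simp: Q1_def dest: prime_ge_1_nat)
    next
      fix p assume "p \<in> {p. prime p \<and> p \<le> x \<and> \<not> p dvd q}"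
      then show "(\<Sum>m=1..x div p. of_real (\<Lambda> p) * e (p * m)) = (\<Sum>m=1..x div p. (of_real (\<Lambda> p) * c p) * F m * ee (real p * real m * \<alpha>))"
        by (intro sum.cong refl) (simp add: e_def mult)
    qed
    finally have eq: "T Q1 = (\<Sum>p | prime p \<and> p \<le> x \<and> \<not> p dvd q. \<Sum>m=1..x div p. (of_real (\<Lambda> p) * c p) * F m * ee (real p * real m * \<alpha>))" .
    show ?thesis unfolding eq
    proof (rule bilinear_prime_sum_bound[OF \<alpha> x _ F V])
      fix p :: nat
      have "\<Lambda> p \<le> ln (real p)"
      proof (cases "primepow p")
        case True
        then show ?thesis using aprimedivisor_le_nat[of p] primepow_gt_Suc_0[of p] aprimedivisor_pos_nat[of p]
          by (simp add: \<Lambda>_def mangoldt_def)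
      next
        case False
        then show ?thesis by (cases p) (auto simp: \<Lambda>_def mangoldt_def)
      qed
      then show "norm (of_real (\<Lambda> p) * c p) \<le> ln (real p)"
        using mult_mono[of "\<Lambda> p" "ln (real p)" "norm (c p)" 1] c[of p] \<Lambda>0[of p] by (simp add: norm_mult)
    qed
  qed
  moreover have "norm (T Q2) \<le> 12 * real x"
  proof -
    \<comment> \<open>Applying the multiplicativity at p repeatedly gives |F(p^j m)| \<le> |F(m)|,
      so no bound for F along multiples of d is needed beyond the mean square.\<close>
    have pow: "norm (F (p ^ j * m)) \<le> norm (F m)" if "prime p" "\<not> p dvd q" for p j m
    proof (induction j)
      case (Suc j)
      have "norm (F (p ^ Suc j * m)) = norm (c p) * norm (F (p ^ j * m))"
        using mult[OF that, of "p ^ j * m"] by (simp add: norm_mult mult.assoc)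
      also have "\<dots> \<le> 1 * norm (F m)" using c Suc by (intro mult_mono) auto
      finally show ?case by simp
    qed auto
    have "T Q2 = (\<Sum>d | d \<in> {1..x} \<and> Q2 d. \<Sum>m=1..x div d. of_real (\<Lambda> d) * e (d * m))"
      unfolding T_def by (rule sum_divisors_swap)
    also have "norm \<dots> \<le> (\<Sum>d | d \<in> {1..x} \<and> Q2 d. real x * (\<Lambda> d / real d))"
    proof (rule sum_norm_le)
      fix d assume d: "d \<in> {d. d \<in> {1..x} \<and> Q2 d}"
      show "norm (\<Sum>m=1..x div d. of_real (\<Lambda> d) * e (d * m)) \<le> real x * (\<Lambda> d / real d)"
      proof (cases "primepow d")
        case False
        then show ?thesis by (simp add: \<Lambda>_def mangoldt_def)
      next
        case True
        then obtain p k where pk: "prime p" "k > 0" "d = p ^ k" by (auto simp: primepow_def)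
        have pq: "\<not> p dvd q"
        proof
          assume "p dvd q"
          moreover have "p dvd d" using pk by simp
          ultimately show False using d pk by (auto simp: Q2_def dest: coprime_common_divisor)
        qed
        have "norm (\<Sum>m=1..x div d. of_real (\<Lambda> d) * e (d * m)) \<le> (\<Sum>m=1..x div d. \<Lambda> d * norm (F m))"
          using pow[OF pk(1) pq] \<Lambda>0[of d] unfolding pk(3)
          by (intro sum_norm_le) (auto simp: norm_mult ne intro!: mult_left_mono)
        also have "\<dots> = \<Lambda> d * (\<Sum>m=1..x div d. norm (F m))" by (rule sum_distrib_left[symmetric])
        also have "\<dots> \<le> \<Lambda> d * real (x div d)"
          using \<Lambda>0 by (intro mult_left_mono sum_norm_le_of_square_mean F) auto
        also have "\<dots> \<le> \<Lambda> d * (real x / real d)" using \<Lambda>0 by (intro mult_left_mono of_nat_div_le_of_nat) auto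
        finally show ?thesis by (simp add: mult.commute)
      qed
    qed
    also have "\<dots> \<le> (\<Sum>d | d \<in> {1..x} \<and> \<not> prime d. real x * (\<Lambda> d / real d))"
      using \<Lambda>0 by (intro sum_mono2) (auto simp: Q2_def)
    also have "\<dots> = real x * (\<Sum>d | d \<in> {1..x} \<and> \<not> prime d. \<Lambda> d / real d)" by (rule sum_distrib_left[symmetric])
    also have "\<dots> \<le> real x * 12" unfolding \<Lambda>_def by (intro mult_left_mono sum_mangoldt_higher_prime_powers) auto
    finally show ?thesis by simp
  qed
  moreover have "norm (T Q3) \<le> D * real x"
  proof -
    have "norm (T Q3) \<le> (\<Sum>k=1..x. norm (F k) * (\<Sum>d | d dvd k \<and> \<not> coprime d q. mangoldt d))"
      unfolding T_def
    proof (rule sum_norm_le)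
      fix k assume "k \<in> {1..x}"
      have "norm (\<Sum>d | d dvd k \<and> Q3 d. of_real (\<Lambda> d) * e k) \<le> (\<Sum>d | d dvd k \<and> Q3 d. \<Lambda> d * norm (F k))"
        using \<Lambda>0 by (intro sum_norm_le) (simp add: norm_mult ne)
      also have "\<dots> = norm (F k) * (\<Sum>d | d dvd k \<and> \<not> coprime d q. mangoldt d)"
        by (simp add: Q3_def \<Lambda>_def sum_distrib_left mult.commute)
      finally show "norm (\<Sum>d | d dvd k \<and> Q3 d. of_real (\<Lambda> d) * e k) \<le> norm (F k) * (\<Sum>d | d dvd k \<and> \<not> coprime d q. mangoldt d)" .
    qed
    then show ?thesis using D by linarith
  qed
  ultimately have "norm (\<Sum>k=1..x. F k * ee (real k * \<alpha>) * of_real (ln (real k)))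
     \<le> 50000 * real x * (1 + ln (real x) * sqrt (\<alpha> * V)) + 12 * real x + D * real x"
    using norm_triangle_ineq[of "T Q1 + T Q2" "T Q3"] norm_triangle_ineq[of "T Q1" "T Q2"] by simp
  also have "\<dots> \<le> (50012 + D) * real x * (1 + ln (real x) * sqrt (\<alpha> * V))"
  proof -
    define X where "X = ln (real x) * sqrt (\<alpha> * V)"
    have x1: "x \<ge> 1"
    proof -
      have "0 < 1 / \<alpha> ^ 4" using \<alpha> by simp
      then have "0 < real x" using x by linarith
      then show ?thesis by simp
    qed
    have "V \<ge> 1" using V[of 1] inv_totient_ratio_ge_1[of 2] x1 by simp
    then have X0: "X \<ge> 0" unfolding X_def using x1 \<alpha> by (intro mult_nonneg_nonneg) auto
    have D0: "D \<ge> 0"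
    proof (rule ccontr)
      assume "\<not> D \<ge> 0"
      then have "D * real x < 0" using x1 by (simp add: mult_neg_pos)
      moreover have "0 \<le> (\<Sum>k=1..x. norm (F k) * (\<Sum>d | d dvd k \<and> \<not> coprime d q. mangoldt d))"
        by (intro sum_nonneg mult_nonneg_nonneg mangoldt_real_nonneg) auto
      ultimately show False using D by linarith
    qed
    have "0 \<le> (12 + D) * real x * X" using X0 D0 by (intro mult_nonneg_nonneg) auto
    then show ?thesis unfolding X_def[symmetric] by (simp add: algebra_simps)
  qed
  finally show ?thesis .
qed

section \<open>Gauss sums of Dirichlet characters\<close>

lemma dirichlet_character_mult: "dirichlet_character q \<chi> \<Longrightarrow> \<chi> (m * n) = \<chi> m * \<chi> n"
  by (simp add: dirichlet_character_def)

lemma dirichlet_character_nonzero_iff: "dirichlet_character q \<chi> \<Longrightarrow> \<chi> n \<noteq> 0 \<longleftrightarrow> coprime n (int q)"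
  by (simp add: dirichlet_character_def)

lemma dirichlet_character_1:
  assumes "dirichlet_character q \<chi>"
  shows "\<chi> 1 = 1"
  using dirichlet_character_mult[OF assms, of 1 1] dirichlet_character_nonzero_iff[OF assms, of 1] by simp

lemma dirichlet_character_period:
  assumes "dirichlet_character q \<chi>"
  shows "\<chi> (n + int q * k) = \<chi> n"
proof -
  have step: "\<chi> (n + int q) = \<chi> n" for n using assms by (simp add: dirichlet_character_def)
  have nat: "\<chi> (n + int q * int j) = \<chi> n" for n and j :: nat
  proof (induction j)
    case (Suc j)
    then show ?case using step[of "n + int q * int j"] by (simp add: algebra_simps)
  qed auto
  show ?thesis
  proof (cases "k \<ge> 0")
    case True
    then show ?thesis using nat[of n "nat k"] by simp
  next
    case False
    then show ?thesis using nat[of "n + int q * k" "nat (- k)"] by simp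
  qed
qed

lemma dirichlet_character_cong:
  assumes "dirichlet_character q \<chi>" "[m = n] (mod int q)"
  shows "\<chi> m = \<chi> n"
proof -
  obtain k where "n = m + int q * k" using assms(2) cong_iff_lin by blast
  then show ?thesis using dirichlet_character_period[OF assms(1), of m k] by simp
qed

lemma dirichlet_character_power:
  assumes "dirichlet_character q \<chi>"
  shows "\<chi> (n ^ k) = \<chi> n ^ k"
  by (induction k) (simp_all add: dirichlet_character_1[OF assms] dirichlet_character_mult[OF assms])

text \<open>Euler's theorem makes the value a root of unity.\<close>

lemma norm_dirichlet_character:
  assumes "dirichlet_character q \<chi>" "q > 0" "coprime n (int q)"
  shows "norm (\<chi> n) = 1"
proof -
  define a where "a = nat (n mod int q)"
  have a: "int a = n mod int q" using assms by (simp add: a_def)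
  have "coprime (int a) (int q)" unfolding a using assms by (simp add: coprime_mod_left_iff)
  then have "coprime a q" by simp
  then have "[a ^ totient q = 1] (mod q)" by (rule euler_theorem)
  then have "[int a ^ totient q = 1] (mod int q)" by (metis cong_int_iff of_nat_1 of_nat_power)
  then have "\<chi> (int a ^ totient q) = \<chi> 1" by (rule dirichlet_character_cong[OF assms(1)])
  then have "\<chi> (int a) ^ totient q = 1"
    by (simp add: dirichlet_character_power[OF assms(1)] dirichlet_character_1[OF assms(1)])
  moreover have "\<chi> (int a) = \<chi> n" by (rule dirichlet_character_cong[OF assms(1)]) (simp add: a cong_def)
  ultimately have "norm (\<chi> n) ^ totient q = 1" by (simp flip: norm_power)
  then show ?thesis using assms(2) by (intro power_eq_imp_eq_base[of _ "totient q" 1]) auto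
qed

lemma norm_dirichlet_character_le:
  assumes "dirichlet_character q \<chi>" "q > 0"
  shows "norm (\<chi> n) \<le> 1"
  using norm_dirichlet_character[OF assms, of n] dirichlet_character_nonzero_iff[OF assms(1), of n] by (cases "coprime n (int q)") auto

lemma periodic_mod:
  fixes f :: "int \<Rightarrow> 'a"
  assumes "\<And>n. f (n + Q) = f n"
  shows "f (n mod Q) = f n"
proof -
  have nat: "f (n + Q * int j) = f n" for n and j :: nat
  proof (induction j)
    case (Suc j)
    then show ?case using assms[of "n + Q * int j"] by (simp add: algebra_simps)
  qed auto
  have "f (n + Q * k) = f n" for n k
  proof (cases "k \<ge> 0")
    case True
    then show ?thesis using nat[of n "nat k"] by simp
  next
    case False
    then show ?thesis using nat[of "n + Q * k" "nat (- k)"] by simp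
  qed
  from this[of "n mod Q" "n div Q"] show ?thesis by simp
qed

lemma bij_betw_mult_mod:
  fixes Q u :: int
  assumes "Q > 0" "coprime u Q"
  shows "bij_betw (\<lambda>n. (u * n) mod Q) {0..<Q} {0..<Q}"
proof (rule bij_betw_imageI)
  show inj: "inj_on (\<lambda>n. (u * n) mod Q) {0..<Q}"
  proof (rule inj_onI)
    fix a b assume ab: "a \<in> {0..<Q}" "b \<in> {0..<Q}" "(u * a) mod Q = (u * b) mod Q"
    then have "[u * a = u * b] (mod Q)" by (simp add: cong_def)
    then have "[a = b] (mod Q)" using assms(2) by (simp add: cong_mult_lcancel)
    then show "a = b" using ab by (simp add: cong_def)
  qed
  show "(\<lambda>n. (u * n) mod Q) ` {0..<Q} = {0..<Q}"
    by (rule endo_inj_surj[OF _ _ inj]) (use assms in auto)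
qed

lemma sum_periodic_mult_unit:
  fixes f :: "int \<Rightarrow> 'a :: comm_monoid_add"
  assumes "Q > 0" "coprime u Q" and per: "\<And>n. f (n + Q) = f n"
  shows "(\<Sum>n\<in>{0..<Q}. f (u * n)) = (\<Sum>n\<in>{0..<Q}. f n)"
proof -
  have "(\<Sum>n\<in>{0..<Q}. f (u * n)) = (\<Sum>n\<in>{0..<Q}. f ((u * n) mod Q))"
    by (simp add: periodic_mod[of f Q, OF per])
  also have "\<dots> = (\<Sum>n\<in>{0..<Q}. f n)"
    by (rule sum.reindex_bij_betw[OF bij_betw_mult_mod[OF assms(1,2)]])
  finally show ?thesis .
qed

definition gauss_sum :: "nat \<Rightarrow> (int \<Rightarrow> complex) \<Rightarrow> int \<Rightarrow> complex" where
  "gauss_sum q \<chi> k = (\<Sum>n\<in>{0..<int q}. \<chi> n * ee (of_int (n * k) / real q))"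

lemma ee_add_int [simp]: "ee (t + of_int n) = ee t"
  by (simp add: ee_add)

lemma ee_div_period:
  assumes "q > 0" "[a = b] (mod int q)"
  shows "ee (of_int a / real q) = ee (of_int b / real q)"
proof -
  obtain k where k: "b = a + int q * k" using assms(2) cong_iff_lin by blast
  have "of_int b / real q = of_int a / real q + of_int k"
    using assms(1) by (simp add: k add_divide_distrib)
  then show ?thesis by (simp only: ee_add_int)
qed

lemma gauss_sum_cong:
  assumes "q > 0" "[k = l] (mod int q)"
  shows "gauss_sum q \<chi> k = gauss_sum q \<chi> l"
  unfolding gauss_sum_def
  by (intro sum.cong refl arg_cong2[of _ _ _ _ "(*)"] ee_div_period assms(1) cong_mult cong_refl assms(2))

text \<open>Replacing n by u n permutes the residues. This holds for every k, also for those not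
  coprime to q, and is the source of the multiplicativity of F at primes not dividing q.\<close>

lemma gauss_sum_mult_unit:
  assumes \<chi>: "dirichlet_character q \<chi>" and q: "q > 0" and u: "coprime u (int q)"
  shows "\<chi> u * gauss_sum q \<chi> (u * k) = gauss_sum q \<chi> k"
proof -
  define f where "f n = \<chi> n * ee (of_int (n * k) / real q)" for n
  have per: "f (n + int q) = f n" for n
  proof -
    have "ee (of_int ((n + int q) * k) / real q) = ee (of_int (n * k) / real q)"
      by (rule ee_div_period[OF q]) (simp add: cong_def algebra_simps)
    then show ?thesis using dirichlet_character_period[OF \<chi>, of n 1] by (simp add: f_def)
  qed
  have "\<chi> u * gauss_sum q \<chi> (u * k) = (\<Sum>n\<in>{0..<int q}. f (u * n))"
    unfolding gauss_sum_def f_def sum_distrib_left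
    by (intro sum.cong refl) (simp add: dirichlet_character_mult[OF \<chi>] mult_ac)
  also have "\<dots> = gauss_sum q \<chi> k"
    using q u by (subst sum_periodic_mult_unit[where f = f, OF _ _ per]) (auto simp: f_def gauss_sum_def)
  finally show ?thesis .
qed

lemma norm_gauss_sum_mult_unit:
  assumes "dirichlet_character q \<chi>" "q > 0" "coprime u (int q)"
  shows "norm (gauss_sum q \<chi> (u * k)) = norm (gauss_sum q \<chi> k)"
  using arg_cong[OF gauss_sum_mult_unit[OF assms, of k], of norm] norm_dirichlet_character[OF assms]
  by (simp add: norm_mult)

lemma sum_ee_orthogonal:
  assumes "q > 0"
  shows "(\<Sum>k\<in>{0..<int q}. ee (of_int (a * k) / real q)) = (if int q dvd a then of_nat q else 0)"
proof -
  define z where "z = ee (of_int a / real q)"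
  have "(\<Sum>k\<in>{0..<int q}. ee (of_int (a * k) / real q)) = (\<Sum>k<q. z ^ k)"
    by (rule sum.reindex_bij_witness[of _ int nat]) (auto simp: z_def ee_power mult_ac)
  also have "\<dots> = (if int q dvd a then of_nat q else 0)"
  proof (cases "int q dvd a")
    case True
    then obtain b where "a = int q * b" by auto
    then have "z = 1" using assms by (simp add: z_def)
    then show ?thesis using True by simp
  next
    case False
    have zq: "z ^ q = 1" using assms by (simp add: z_def ee_power)
    have "z \<noteq> 1"
    proof
      assume "z = 1"
      then have "cos (2 * pi * (of_int a / real q)) = 1" by (simp add: z_def ee_def complex_eq_iff)
      then obtain n where "2 * pi * (of_int a / real q) = of_int n * 2 * pi" using cos_one_2pi_int by auto
      then have "of_int a = real q * of_int n" using assms by (simp add: field_simps)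
      then have "of_int a = (of_int (int q * n) :: real)" by simp
      then have "a = int q * n" by (simp only: of_int_eq_iff)
      then show False using False by simp
    qed
    then show ?thesis using False zq by (simp add: sum_gp_strict)
  qed
  finally show ?thesis .
qed

lemma gauss_sum_parseval:
  assumes \<chi>: "dirichlet_character q \<chi>" and q: "q > 0"
  shows "(\<Sum>k\<in>{0..<int q}. (norm (gauss_sum q \<chi> k))\<^sup>2) = real q * real (card {n\<in>{0..<int q}. coprime n (int q)})"
proof -
  let ?I = "{0..<int q}"
  have "complex_of_real (\<Sum>k\<in>?I. (norm (gauss_sum q \<chi> k))\<^sup>2) = (\<Sum>k\<in>?I. gauss_sum q \<chi> k * cnj (gauss_sum q \<chi> k))"
    by (simp only: of_real_sum complex_norm_square)
  also have "\<dots> = (\<Sum>k\<in>?I. \<Sum>m\<in>?I. \<Sum>n\<in>?I. \<chi> m * cnj (\<chi> n) * ee (of_int ((m - n) * k) / real q))"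
  proof (rule sum.cong[OF refl])
    fix k
    have "gauss_sum q \<chi> k * cnj (gauss_sum q \<chi> k) = (\<Sum>m\<in>?I. \<Sum>n\<in>?I. (\<chi> m * ee (of_int (m * k) / real q)) * cnj (\<chi> n * ee (of_int (n * k) / real q)))"
      by (simp add: gauss_sum_def sum_product)
    also have "\<dots> = (\<Sum>m\<in>?I. \<Sum>n\<in>?I. \<chi> m * cnj (\<chi> n) * ee (of_int ((m - n) * k) / real q))"
    proof (intro sum.cong refl)
      fix m n
      have "of_int ((m - n) * k) / real q = of_int (m * k) / real q + - (of_int (n * k) / real q)"
        by (simp add: algebra_simps diff_divide_distrib)
      then have "ee (of_int ((m - n) * k) / real q) = ee (of_int (m * k) / real q) * cnj (ee (of_int (n * k) / real q))"
        by (simp only: ee_add ee_uminus)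
      then show "(\<chi> m * ee (of_int (m * k) / real q)) * cnj (\<chi> n * ee (of_int (n * k) / real q)) = \<chi> m * cnj (\<chi> n) * ee (of_int ((m - n) * k) / real q)"
        by simp
    qed
    finally show "gauss_sum q \<chi> k * cnj (gauss_sum q \<chi> k) = (\<Sum>m\<in>?I. \<Sum>n\<in>?I. \<chi> m * cnj (\<chi> n) * ee (of_int ((m - n) * k) / real q))" .
  qed
  also have "\<dots> = (\<Sum>m\<in>?I. \<Sum>k\<in>?I. \<Sum>n\<in>?I. \<chi> m * cnj (\<chi> n) * ee (of_int ((m - n) * k) / real q))"
    by (rule sum.swap)
  also have "\<dots> = (\<Sum>m\<in>?I. \<Sum>n\<in>?I. \<Sum>k\<in>?I. \<chi> m * cnj (\<chi> n) * ee (of_int ((m - n) * k) / real q))"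
    by (rule sum.cong[OF refl], rule sum.swap)
  also have "\<dots> = (\<Sum>m\<in>?I. \<Sum>n\<in>?I. if n = m then \<chi> m * cnj (\<chi> m) * of_nat q else 0)"
  proof (intro sum.cong refl)
    fix m n assume mn: "m \<in> ?I" "n \<in> ?I"
    have "(\<Sum>k\<in>?I. \<chi> m * cnj (\<chi> n) * ee (of_int ((m - n) * k) / real q)) = \<chi> m * cnj (\<chi> n) * (if int q dvd m - n then of_nat q else 0)"
      unfolding sum_ee_orthogonal[OF q, symmetric] by (rule sum_distrib_left[symmetric])
    moreover have "int q dvd m - n \<longleftrightarrow> n = m"
    proof
      assume "int q dvd m - n"
      then have "[m = n] (mod int q)" by (simp add: cong_iff_dvd_diff)
      then show "n = m" using mn by (simp add: cong_def)
    qed auto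
    ultimately show "(\<Sum>k\<in>?I. \<chi> m * cnj (\<chi> n) * ee (of_int ((m - n) * k) / real q)) = (if n = m then \<chi> m * cnj (\<chi> m) * of_nat q else 0)"
      by simp
  qed
  also have "\<dots> = (\<Sum>m\<in>?I. \<chi> m * cnj (\<chi> m) * of_nat q)" by simp
  also have "\<dots> = (\<Sum>m\<in>?I. if coprime m (int q) then of_nat q else 0)"
  proof (intro sum.cong refl)
    fix m
    show "\<chi> m * cnj (\<chi> m) * of_nat q = (if coprime m (int q) then of_nat q else 0)"
      using norm_dirichlet_character[OF \<chi> q, of m] dirichlet_character_nonzero_iff[OF \<chi>, of m]
      by (auto simp flip: complex_norm_square)
  qed
  also have "\<dots> = complex_of_real (real q * real (card {n\<in>?I. coprime n (int q)}))"
    by (simp add: sum.inter_filter[symmetric])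
  finally show ?thesis by (simp only: of_real_eq_iff)
qed

lemma card_units_pos:
  assumes "q > 0"
  shows "card {n\<in>{0..<int q}. coprime n (int q)} > 0"
proof -
  have "1 mod int q \<in> {n\<in>{0..<int q}. coprime n (int q)}" using assms by (simp add: coprime_mod_left_iff)
  moreover have "finite {n\<in>{0..<int q}. coprime n (int q)}" by (rule finite_subset[of _ "{0..<int q}"]) auto
  ultimately show ?thesis using card_gt_0_iff by blast
qed

text \<open>With g = gcd(k, q) and r = q/g, all solutions u of k u = l modulo q are congruent modulo
  r. Hence \<open>u div r\<close>, which takes at most g values, determines u.\<close>

lemma card_unit_solutions_le_gcd:
  fixes k l :: int
  assumes q: "q > 0"
  shows "card {u\<in>{0..<int q}. (k * u) mod int q = l} \<le> nat (gcd k (int q))"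
proof -
  define g where "g = gcd k (int q)"
  have g: "g > 0" using q by (simp add: g_def)
  obtain r where r: "int q = g * r" using gcd_dvd2[of k "int q"] unfolding g_def[symmetric] by auto
  have rpos: "r > 0" using r q g by (metis of_nat_0_less_iff zero_less_mult_pos)
  obtain k' where k': "k = g * k'" using gcd_dvd1[of k "int q"] unfolding g_def[symmetric] by auto
  have cop: "coprime k' r"
  proof -
    have "\<bar>g\<bar> * gcd k' r = gcd (g * k') (g * r)" by (rule gcd_mult_distrib_int)
    also have "\<dots> = g" using g_def k' r by (simp only:)
    finally have "gcd k' r = 1" using g by simp
    then show ?thesis by (simp add: coprime_iff_gcd_eq_1)
  qed
  have "card {u\<in>{0..<int q}. (k * u) mod int q = l} \<le> card {0..<g}"
  proof (rule card_inj_on_le[of "\<lambda>u. u div r"])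
    show "inj_on (\<lambda>u. u div r) {u\<in>{0..<int q}. (k * u) mod int q = l}"
    proof (rule inj_onI)
      fix u v assume uv: "u \<in> {u\<in>{0..<int q}. (k * u) mod int q = l}" "v \<in> {u\<in>{0..<int q}. (k * u) mod int q = l}" "u div r = v div r"
      then have "[k * u = k * v] (mod int q)" by (simp add: cong_def)
      then have "int q dvd k * u - k * v" by (simp add: cong_iff_dvd_diff)
      then have "g * r dvd g * (k' * (u - v))" by (simp add: r k' algebra_simps)
      then have "r dvd k' * (u - v)" using g by simp
      then have "r dvd u - v" using cop by (simp add: coprime_dvd_mult_right_iff coprime_commute)
      then have "u mod r = v mod r" by (simp add: mod_eq_dvd_iff)
      then show "u = v" using uv(3) by (metis div_mult_mod_eq)
    qed
    show "(\<lambda>u. u div r) ` {u\<in>{0..<int q}. (k * u) mod int q = l} \<subseteq> {0..<g}"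
    proof (intro image_subsetI)
      fix u assume "u \<in> {u\<in>{0..<int q}. (k * u) mod int q = l}"
      then have u: "0 \<le> u" "u < g * r" by (auto simp: r)
      have "u div r * r + u mod r = u" by simp
      moreover have "u mod r \<ge> 0" using rpos by simp
      ultimately have "u div r * r < g * r" using u by linarith
      then have "u div r < g" using rpos by (simp add: mult_less_cancel_right)
      then show "u div r \<in> {0..<g}" using u rpos by (simp add: pos_imp_zdiv_nonneg_iff)
    qed
  qed auto
  then show ?thesis by (simp add: g_def)
qed

text \<open>Averaging over the units \<open>u\<close>, which do not change \<open>norm (gauss_sum q \<chi> (k * u))\<close>, spreads
  each \<open>k\<close> over its residue classes so evenly that Parseval's identity gives the mean square bound
  on every initial interval.\<close>

lemma gauss_sum_square_mean:
  assumes \<chi>: "dirichlet_character q \<chi>" and q: "q > 0"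
  shows "(\<Sum>k=1..x. (norm (gauss_sum q \<chi> (int k)))\<^sup>2) \<le> real x * real q"
proof -
  let ?I = "{0..<int q}" and ?U = "{n\<in>{0..<int q}. coprime n (int q)}"
  define G where "G k = (norm (gauss_sum q \<chi> k))\<^sup>2" for k
  define c where "c = real (card ?U)"
  have cpos: "c > 0" using card_units_pos[OF q] by (simp add: c_def)
  have G0: "G k \<ge> 0" for k by (simp add: G_def)
  \<comment> \<open>A unit multiple of k can fall on l only if gcd(k, q) = gcd(l, q) = g. Then g
    divides k, and at most g units do it; the at most x/g multiples of g up to x compensate the
    factor g.\<close>
  have cnt: "(\<Sum>k=1..x. real (card {u\<in>?U. (int k * u) mod int q = l})) \<le> real x" if l: "l \<in> ?I" for l
  proof -
    define g where "g = nat (gcd l (int q))"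
    have g: "g > 0" using q by (simp add: g_def)
    have each: "real (card {u\<in>?U. (int k * u) mod int q = l}) \<le> (if g dvd k then real g else 0)" for k
    proof (cases "{u\<in>?U. (int k * u) mod int q = l} = {}")
      case True
      show ?thesis unfolding True by simp
    next
      case False
      then obtain u where u: "coprime u (int q)" "(int k * u) mod int q = l" by auto
      have "gcd l (int q) = gcd (int k * u) (int q)" using u(2) by (metis gcd_mod_left q of_nat_0_less_iff less_irrefl gcd_red_int gcd.commute)
      also have "\<dots> = gcd (int k) (int q)" using u(1) by (intro gcd_mult_left_right_cancel) (simp add: coprime_commute)
      finally have gk: "gcd l (int q) = gcd (int k) (int q)" .
      have "int g dvd int k" unfolding g_def gk by simp
      then have "g dvd k" by simp
      moreover have "card {u\<in>?U. (int k * u) mod int q = l} \<le> card {u\<in>?I. (int k * u) mod int q = l}"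
        by (intro card_mono) (auto intro: finite_subset[of _ "{0..<int q}"])
      then have "card {u\<in>?U. (int k * u) mod int q = l} \<le> g"
        using card_unit_solutions_le_gcd[OF q, of "int k" l] gk by (simp add: g_def)
      ultimately show ?thesis by simp
    qed
    have "(\<Sum>k=1..x. real (card {u\<in>?U. (int k * u) mod int q = l})) \<le> (\<Sum>k=1..x. if g dvd k then real g else 0)"
      by (intro sum_mono each)
    also have "\<dots> = (\<Sum>k | k \<in> {1..x} \<and> g dvd k. real g)" by (rule sum.inter_filter[symmetric]) auto
    also have "\<dots> = real (card {k \<in> {1..x}. g dvd k}) * real g" by simp
    also have "\<dots> \<le> real (x div g) * real g"
    proof (rule mult_right_mono)
      have "{k \<in> {1..x}. g dvd k} \<subseteq> (\<lambda>j. g * j) ` {1..x div g}"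
      proof
        fix k assume k: "k \<in> {k \<in> {1..x}. g dvd k}"
        then obtain j where j: "k = g * j" by auto
        then have "j \<in> {1..x div g}" using k g by (cases j) (auto simp: less_eq_div_iff_mult_less_eq mult.commute)
        then show "k \<in> (\<lambda>j. g * j) ` {1..x div g}" using j by blast
      qed
      then have "card {k \<in> {1..x}. g dvd k} \<le> card ((\<lambda>j. g * j) ` {1..x div g})" by (intro card_mono) auto
      also have "\<dots> \<le> card {1..x div g}" by (rule card_image_le) auto
      finally show "real (card {k \<in> {1..x}. g dvd k}) \<le> real (x div g)" by simp
    qed auto
    also have "\<dots> = real (x div g * g)" by simp
    also have "\<dots> \<le> real x" by (intro of_nat_mono) (rule div_times_less_eq_dividend)
    finally show ?thesis .
  qed
  have "c * (\<Sum>k=1..x. G (int k)) = (\<Sum>k=1..x. \<Sum>u\<in>?U. G (int k))"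
    by (simp add: c_def sum_distrib_left)
  also have "\<dots> = (\<Sum>k=1..x. \<Sum>u\<in>?U. \<Sum>l\<in>?I. if (int k * u) mod int q = l then G l else 0)"
  proof (intro sum.cong refl)
    fix k u assume u: "u \<in> ?U"
    have "G (int k) = G (u * int k)" unfolding G_def using u by (simp add: norm_gauss_sum_mult_unit[OF \<chi> q])
    also have "\<dots> = G ((int k * u) mod int q)"
      unfolding G_def by (subst gauss_sum_cong[OF q, of "u * int k" "(int k * u) mod int q"]) (auto simp: cong_def mult.commute)
    also have "\<dots> = (\<Sum>l\<in>?I. if (int k * u) mod int q = l then G l else 0)" using q by simp
    finally show "G (int k) = (\<Sum>l\<in>?I. if (int k * u) mod int q = l then G l else 0)" .
  qed
  also have "\<dots> = (\<Sum>k=1..x. \<Sum>l\<in>?I. \<Sum>u\<in>?U. if (int k * u) mod int q = l then G l else 0)"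
    by (rule sum.cong[OF refl], rule sum.swap)
  also have "\<dots> = (\<Sum>l\<in>?I. \<Sum>k=1..x. \<Sum>u\<in>?U. if (int k * u) mod int q = l then G l else 0)"
    by (rule sum.swap)
  also have "\<dots> = (\<Sum>l\<in>?I. G l * (\<Sum>k=1..x. real (card {u\<in>?U. (int k * u) mod int q = l})))"
  proof (rule sum.cong[OF refl])
    fix l
    have "(\<Sum>u\<in>?U. if (int k * u) mod int q = l then G l else 0) = G l * real (card {u\<in>?U. (int k * u) mod int q = l})" for k
    proof -
      have "finite ?U" by (rule finite_subset[of _ ?I]) auto
      from sum.inter_filter[OF this, of "\<lambda>_. G l" "\<lambda>u. (int k * u) mod int q = l"]
      have "(\<Sum>u\<in>?U. if (int k * u) mod int q = l then G l else 0) = (\<Sum>u\<in>{u\<in>?U. (int k * u) mod int q = l}. G l)" ..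
      then show ?thesis by (simp only: sum_constant mult.commute)
    qed
    then show "(\<Sum>k=1..x. \<Sum>u\<in>?U. if (int k * u) mod int q = l then G l else 0) = G l * (\<Sum>k=1..x. real (card {u\<in>?U. (int k * u) mod int q = l}))"
      by (simp add: sum_distrib_left)
  qed
  also have "\<dots> \<le> (\<Sum>l\<in>?I. G l * real x)" by (intro sum_mono mult_left_mono cnt G0)
  also have "\<dots> = (real q * c) * real x" unfolding sum_distrib_right[symmetric] G_def gauss_sum_parseval[OF \<chi> q] c_def ..
  finally have "c * (\<Sum>k=1..x. G (int k)) \<le> c * (real x * real q)" by (simp add: mult_ac)
  then show ?thesis using cpos by (simp add: G_def)
qed

section \<open>Induction on the modulus\<close>

lemma sum_residues_split:
  fixes f :: "int \<Rightarrow> 'a :: comm_monoid_add"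
  assumes m: "m = p * m'" "m' > (0::nat)" "p > (0::nat)"
  shows "(\<Sum>n\<in>{0..<int m}. f n) = (\<Sum>a\<in>{0..<int m'}. \<Sum>j\<in>{0..<int p}. f (a + int m' * j))"
proof -
  have "(\<Sum>n\<in>{0..<int m}. f n) = (\<Sum>(a, j)\<in>{0..<int m'} \<times> {0..<int p}. f (a + int m' * j))"
  proof (rule sum.reindex_bij_witness[of _ "\<lambda>(a, j). a + int m' * j" "\<lambda>n. (n mod int m', n div int m')"])
    fix n assume n: "n \<in> {0..<int m}"
    have "n div int m' * int m' + n mod int m' = n" by simp
    moreover have "n mod int m' \<ge> 0" using m by simp
    ultimately have "n div int m' * int m' < int p * int m'" using n m(1) by (simp only: of_nat_mult atLeastLessThan_iff) linarith
    then have "n div int m' < int p" using m by (simp add: mult_less_cancel_right)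
    then show "(n mod int m', n div int m') \<in> {0..<int m'} \<times> {0..<int p}" using n m by (simp add: pos_imp_zdiv_nonneg_iff)
  next
    fix z assume "z \<in> {0..<int m'} \<times> {0..<int p}"
    then obtain a j where z: "z = (a, j)" "0 \<le> a" "a < int m'" "0 \<le> j" "j \<le> int p - 1" by auto
    have "int m' * j \<le> int m' * (int p - 1)" using z by (intro mult_left_mono) auto
    then have "a + int m' * j < int m" using z m(1) by (simp add: algebra_simps)
    then show "(case z of (a, j) \<Rightarrow> a + int m' * j) \<in> {0..<int m}" using z by simp
    show "((case z of (a, j) \<Rightarrow> a + int m' * j) mod int m', (case z of (a, j) \<Rightarrow> a + int m' * j) div int m') = z"
      using z m by simp
  qed auto
  also have "\<dots> = (\<Sum>a\<in>{0..<int m'}. \<Sum>j\<in>{0..<int p}. f (a + int m' * j))"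
    by (rule sum.cartesian_product[symmetric])
  finally show ?thesis .
qed

text \<open>Write n = a + m' j. The period m' leaves a geometric sum over j modulo p, which vanishes
  unless p divides k.\<close>

lemma gauss_sum_induced:
  assumes m: "m = p * m'" "m' > 0" "p > 0" and per: "\<And>n. \<psi> (n + int m') = \<psi> n"
  shows "gauss_sum m \<psi> k = (if int p dvd k then of_nat p * gauss_sum m' \<psi> (k div int p) else 0)"
proof -
  have per': "\<psi> (a + int m' * j) = \<psi> a" for a j
    using periodic_mod[of \<psi> "int m'", OF per] by (metis mod_mult_self2)
  have "gauss_sum m \<psi> k = (\<Sum>a\<in>{0..<int m'}. \<Sum>j\<in>{0..<int p}. \<psi> a * ee (of_int (a * k) / real m) * ee (of_int (k * j) / real p))"
    unfolding gauss_sum_def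
  proof (subst sum_residues_split[OF m], intro sum.cong refl)
    fix a j
    have "of_int ((a + int m' * j) * k) / real m = of_int (a * k) / real m + of_int (k * j) / real p"
      using m by (simp add: field_simps)
    then show "\<psi> (a + int m' * j) * ee (of_int ((a + int m' * j) * k) / real m) = \<psi> a * ee (of_int (a * k) / real m) * ee (of_int (k * j) / real p)"
      by (simp only: ee_add per' mult.assoc)
  qed
  also have "\<dots> = (\<Sum>a\<in>{0..<int m'}. \<psi> a * ee (of_int (a * k) / real m)) * (\<Sum>j\<in>{0..<int p}. ee (of_int (k * j) / real p))"
    by (rule sum_product[symmetric])
  also have "(\<Sum>j\<in>{0..<int p}. ee (of_int (k * j) / real p)) = (if int p dvd k then of_nat p else 0)"
    by (rule sum_ee_orthogonal[OF m(3)])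
  also have "(\<Sum>a\<in>{0..<int m'}. \<psi> a * ee (of_int (a * k) / real m)) = gauss_sum m' \<psi> (k div int p)" if "int p dvd k"
  proof -
    have "of_int (a * k) / real m = of_int (a * (k div int p)) / real m'" for a
    proof -
      have "k = int p * (k div int p)" using that by simp
      then have eq: "of_int (a * k) = real p * of_int (a * (k div int p))" by (metis mult.left_commute of_int_mult of_int_of_nat_eq)
      show ?thesis unfolding eq using m by simp
    qed
    then show ?thesis by (simp only: gauss_sum_def)
  qed
  ultimately show ?thesis by auto
qed

text \<open>With v the inverse of b, the quotient a v is 1 modulo d, so \<open>triv\<close> applies
  to it. Thus triviality on the units that are 1 modulo d lets \<chi> descend to the modulus d on
  units.\<close>

lemma character_eq_of_cong:
  assumes \<chi>: "dirichlet_character m \<chi>" and m: "m > 0" "d dvd m"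
    and triv: "\<And>u. coprime u (int m) \<Longrightarrow> [u = 1] (mod int d) \<Longrightarrow> \<chi> u = 1"
    and ab: "coprime a (int m)" "coprime b (int m)" "[a = b] (mod int d)"
  shows "\<chi> a = \<chi> b"
proof -
  obtain v where v: "[b * v = 1] (mod int m)" using cong_solve_coprime_int[OF ab(2)] by auto
  have "coprime (b * v) (int m)" using v by (metis cong_imp_coprime cong_sym coprime_1_left)
  then have cv: "coprime v (int m)" by simp
  have "[b * v = 1] (mod int d)" by (rule cong_dvd_modulus[OF v]) (simp add: m(2))
  moreover have "[a * v = b * v] (mod int d)" using ab(3) by (intro cong_mult cong_refl)
  ultimately have "[a * v = 1] (mod int d)" by (rule cong_trans[rotated])
  then have "\<chi> (a * v) = 1" using ab cv by (intro triv) auto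
  moreover have "\<chi> (b * v) = 1" using dirichlet_character_cong[OF \<chi> v] dirichlet_character_1[OF \<chi>] by simp
  ultimately have "\<chi> a * \<chi> v = \<chi> b * \<chi> v" by (simp add: dirichlet_character_mult[OF \<chi>])
  moreover have "\<chi> v \<noteq> 0" using cv dirichlet_character_nonzero_iff[OF \<chi>] by simp
  ultimately show ?thesis by simp
qed

text \<open>For a unit k the products k u run over distinct residues as u runs over the units, all
  with Gauss sums of equal norm, so Parseval's total is shared by at least as many terms as there
  are units.\<close>

lemma gauss_sum_norm_le_of_coprime:
  assumes \<chi>: "dirichlet_character q \<chi>" and q: "q > 0" and k: "coprime k (int q)"
  shows "(norm (gauss_sum q \<chi> k))\<^sup>2 \<le> real q"
proof -
  let ?U = "{n\<in>{0..<int q}. coprime n (int q)}"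
  define c where "c = real (card ?U)"
  have cpos: "c > 0" using card_units_pos[OF q] by (simp add: c_def)
  have "c * (norm (gauss_sum q \<chi> k))\<^sup>2 = (\<Sum>u\<in>?U. (norm (gauss_sum q \<chi> ((k * u) mod int q)))\<^sup>2)"
  proof -
    have "(norm (gauss_sum q \<chi> ((k * u) mod int q)))\<^sup>2 = (norm (gauss_sum q \<chi> k))\<^sup>2" if "u \<in> ?U" for u
      using norm_gauss_sum_mult_unit[OF \<chi> q, of u k] gauss_sum_cong[OF q, of "(k * u) mod int q" "u * k" \<chi>] that
      by (simp add: cong_def mult.commute)
    then show ?thesis by (simp add: c_def)
  qed
  also have "\<dots> = (\<Sum>l\<in>(\<lambda>u. (k * u) mod int q) ` ?U. (norm (gauss_sum q \<chi> l))\<^sup>2)"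
    by (rule sum.reindex_cong[symmetric, OF _ refl refl])
       (use bij_betw_mult_mod[of "int q" k] q k in \<open>auto simp: bij_betw_def intro: inj_on_subset\<close>)
  also have "\<dots> \<le> (\<Sum>l\<in>{0..<int q}. (norm (gauss_sum q \<chi> l))\<^sup>2)"
    using q by (intro sum_mono2) auto
  also have "\<dots> = c * real q" unfolding gauss_sum_parseval[OF \<chi> q] c_def by simp
  finally show ?thesis using cpos by simp
qed

text \<open>The number \<open>s\<close> below is \<open>m\<close> divided by the conductor of \<open>\<chi>\<close>. The induction strips one prime
  factor of \<open>s\<close> at a time from the modulus, so no theory of primitive characters is needed.\<close>

lemma gauss_sum_support:
  assumes "m > 0" "dirichlet_character m \<chi>"
  shows "\<exists>s>0. s dvd m \<and> (\<forall>k. gauss_sum m \<chi> k \<noteq> 0 \<longrightarrow>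
           nat (gcd k (int m)) dvd s \<and> (norm (gauss_sum m \<chi> k))\<^sup>2 * real s \<le> real m * (of_int (gcd k (int m)))\<^sup>2)"
  using assms
proof (induction m arbitrary: \<chi> rule: less_induct)
  case (less m)
  note m = less.prems(1) and \<chi> = less.prems(2)
  show ?case
  proof (cases "\<exists>p. prime p \<and> p dvd m \<and> (\<forall>u. coprime u (int m) \<longrightarrow> [u = 1] (mod int (m div p)) \<longrightarrow> \<chi> u = 1)")
    \<comment> \<open>This is the primitive case, where s = 1. If a prime p divided both k and m,
      every u that is 1 modulo m/p would fix k modulo m, and a nonzero Gauss sum would force \<chi>
      u = 1, contrary to the case assumption.\<close>
    case False
    have "nat (gcd k (int m)) dvd 1 \<and> (norm (gauss_sum m \<chi> k))\<^sup>2 * real 1 \<le> real m * (of_int (gcd k (int m)))\<^sup>2"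
      if nz: "gauss_sum m \<chi> k \<noteq> 0" for k
    proof -
      have "gcd k (int m) = 1"
      proof (rule ccontr)
        assume "gcd k (int m) \<noteq> 1"
        moreover have "gcd k (int m) \<ge> 0" by simp
        ultimately have "nat (gcd k (int m)) \<noteq> 1" by linarith
        then obtain p where p: "prime p" "p dvd nat (gcd k (int m))"
          using prime_factor_nat by blast
        then have "int p dvd gcd k (int m)" by (metis gcd_ge_0_int int_dvd_int_iff int_nat_eq)
        then have pk: "int p dvd k" and pm: "p dvd m" by (auto simp: int_dvd_int_iff[symmetric] simp del: int_dvd_int_iff)
        have "\<chi> u = 1" if u: "coprime u (int m)" "[u = 1] (mod int (m div p))" for u
        proof -
          have "int (m div p) dvd u - 1" using u by (simp add: cong_iff_dvd_diff)
          then have "int (m div p) * int p dvd (u - 1) * k" using pk by (intro mult_dvd_mono)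
          moreover have "int (m div p) * int p = int m" using pm by (simp flip: of_nat_mult)
          ultimately have "[u * k = k] (mod int m)" by (simp add: cong_iff_dvd_diff algebra_simps)
          then have "gauss_sum m \<chi> (u * k) = gauss_sum m \<chi> k" by (rule gauss_sum_cong[OF m])
          then show ?thesis using gauss_sum_mult_unit[OF \<chi> m u(1), of k] nz by simp
        qed
        then show False using False p pm by blast
      qed
      then show ?thesis using gauss_sum_norm_le_of_coprime[OF \<chi> m, of k] by (simp add: coprime_iff_gcd_eq_1)
    qed
    then show ?thesis by (intro exI[of _ 1]) auto
  next
    case True
    then obtain p where p: "prime p" "p dvd m" and triv: "\<And>u. coprime u (int m) \<Longrightarrow> [u = 1] (mod int (m div p)) \<Longrightarrow> \<chi> u = 1"
      by blast
    define m' where "m' = m div p"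
    have mp: "m = p * m'" using p by (simp add: m'_def)
    have ppos: "p > 0" and p2: "p \<ge> 2" using prime_ge_2_nat[OF p(1)] by auto
    have m'pos: "m' > 0" using m mp by (cases m') auto
    have m'less: "m' < m" using mp m'pos p2 by simp
    have pint: "prime (int p)" using p by simp
    have eqc: "\<chi> a = \<chi> b" if "coprime a (int m)" "coprime b (int m)" "[a = b] (mod int m')" for a b
      by (rule character_eq_of_cong[OF \<chi> m _ triv that(1,2)]) (use that p in \<open>auto simp: m'_def div_dvd_iff_mult\<close>)
    have gcd_p: "gcd (int p * k') (int m) = int p * gcd k' (int m')" for k'
      unfolding mp of_nat_mult by (metis abs_of_nat gcd_mult_distrib_int)
    \<comment> \<open>Shared by the two cases below, in which \<psi> is the character modulo m'
      inducing \<chi>. Passing from m' to m multiplies s by p; if p divides k, the gcd gains a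
      factor p and the norm at most a factor p, and otherwise gcd and norm stay the same. In both
      cases the divisibility and the inequality persist.\<close>
    have key: "\<exists>s>0. s dvd m \<and> (\<forall>k. gauss_sum m \<chi> k \<noteq> 0 \<longrightarrow>
           nat (gcd k (int m)) dvd s \<and> (norm (gauss_sum m \<chi> k))\<^sup>2 * real s \<le> real m * (of_int (gcd k (int m)))\<^sup>2)"
      if \<psi>: "dirichlet_character m' \<psi>"
        and dv: "\<And>k'. norm (gauss_sum m \<chi> (int p * k')) \<le> real p * norm (gauss_sum m' \<psi> k')"
        and ndv: "\<And>k. \<not> int p dvd k \<Longrightarrow> gauss_sum m \<chi> k \<noteq> 0 \<Longrightarrow> \<not> p dvd m' \<and> norm (gauss_sum m \<chi> k) = norm (gauss_sum m' \<psi> k)"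
      for \<psi>
    proof -
      obtain s where s: "s > 0" "s dvd m'" and IH: "\<And>k. gauss_sum m' \<psi> k \<noteq> 0 \<Longrightarrow>
           nat (gcd k (int m')) dvd s \<and> (norm (gauss_sum m' \<psi> k))\<^sup>2 * real s \<le> real m' * (of_int (gcd k (int m')))\<^sup>2"
        using less.IH[OF m'less m'pos \<psi>] by blast
      have "nat (gcd k (int m)) dvd p * s \<and> (norm (gauss_sum m \<chi> k))\<^sup>2 * real (p * s) \<le> real m * (of_int (gcd k (int m)))\<^sup>2"
        if nz: "gauss_sum m \<chi> k \<noteq> 0" for k
      proof (cases "int p dvd k")
        case True
        then obtain k' where k: "k = int p * k'" by auto
        have "gauss_sum m' \<psi> k' \<noteq> 0" using dv[of k'] nz ppos by (auto simp: k)
        note IH' = IH[OF this]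
        have "nat (gcd k (int m)) = p * nat (gcd k' (int m'))" unfolding k gcd_p by (simp add: nat_mult_distrib)
        then have d: "nat (gcd k (int m)) dvd p * s" using IH' by simp
        have "(norm (gauss_sum m \<chi> k))\<^sup>2 * real (p * s) \<le> (real p * norm (gauss_sum m' \<psi> k'))\<^sup>2 * real (p * s)"
          unfolding k by (intro mult_right_mono power_mono dv) auto
        also have "\<dots> = real p ^ 3 * ((norm (gauss_sum m' \<psi> k'))\<^sup>2 * real s)" by (simp add: eval_nat_numeral)
        also have "\<dots> \<le> real p ^ 3 * (real m' * (of_int (gcd k' (int m')))\<^sup>2)" using IH' by (intro mult_left_mono) auto
        also have "\<dots> = real m * (of_int (gcd k (int m)))\<^sup>2" unfolding k gcd_p by (simp add: mp eval_nat_numeral)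
        finally show ?thesis using d by simp
      next
        case False
        note nd = ndv[OF False nz]
        then have "gauss_sum m' \<psi> k \<noteq> 0" using nz by auto
        note IH' = IH[OF this]
        have "coprime (int p) k" using False pint by (simp add: prime_imp_coprime)
        then have "gcd k (int m) = gcd k (int m')"
          unfolding mp of_nat_mult by (simp add: gcd_mult_right_left_cancel coprime_commute)
        moreover have "(norm (gauss_sum m' \<psi> k))\<^sup>2 * real (p * s) \<le> real m * (of_int (gcd k (int m')))\<^sup>2"
        proof -
          have "(norm (gauss_sum m' \<psi> k))\<^sup>2 * real (p * s) = real p * ((norm (gauss_sum m' \<psi> k))\<^sup>2 * real s)" by simp
          also have "\<dots> \<le> real p * (real m' * (of_int (gcd k (int m')))\<^sup>2)" using IH' by (intro mult_left_mono) auto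
          finally show ?thesis by (simp add: mp)
        qed
        moreover have "nat (gcd k (int m')) dvd p * s" using IH' by simp
        ultimately show ?thesis using nd by (simp only:)
      qed
      then show ?thesis using s ppos by (intro exI[of _ "p * s"]) (auto simp: mp)
    qed
    show ?thesis
    proof (cases "p dvd m'")
      case True
      \<comment> \<open>Since p still divides m', the moduli m and m' have the same prime factors,
        and \<chi> itself is a character modulo m'.\<close>
      have cop: "coprime n (int m) \<longleftrightarrow> coprime n (int m')" for n
      proof -
        obtain t where "m' = p * t" using True by auto
        then show ?thesis by (auto simp: mp)
      qed
      have cop_add: "coprime (n + int m') (int m') \<longleftrightarrow> coprime n (int m')" for n
        by (simp only: coprime_iff_gcd_eq_1 gcd_add1)
      have per: "\<chi> (n + int m') = \<chi> n" for n
      proof (cases "coprime n (int m)")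
        case True
        have c2: "coprime (n + int m') (int m)" using True unfolding cop cop_add .
        show ?thesis by (rule eqc[OF c2 True]) (simp add: cong_def)
      next
        case False
        then have "\<not> coprime (n + int m') (int m)" unfolding cop cop_add .
        then have "\<chi> (n + int m') = 0" using dirichlet_character_nonzero_iff[OF \<chi>] by blast
        moreover have "\<chi> n = 0" using False dirichlet_character_nonzero_iff[OF \<chi>] by blast
        ultimately show ?thesis by simp
      qed
      have \<psi>: "dirichlet_character m' \<chi>"
        unfolding dirichlet_character_def using per cop dirichlet_character_mult[OF \<chi>] dirichlet_character_nonzero_iff[OF \<chi>] by auto
      show ?thesis
      proof (rule key[OF \<psi>])
        fix k'
        have "gauss_sum m \<chi> (int p * k') = of_nat p * gauss_sum m' \<chi> k'"
          using gauss_sum_induced[of m p m' \<chi> "int p * k'", OF mp m'pos ppos per] ppos by simp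
        then show "norm (gauss_sum m \<chi> (int p * k')) \<le> real p * norm (gauss_sum m' \<chi> k')" by (simp add: norm_mult)
      next
        fix k assume "\<not> int p dvd k" "gauss_sum m \<chi> k \<noteq> 0"
        then show "\<not> p dvd m' \<and> norm (gauss_sum m \<chi> k) = norm (gauss_sum m' \<chi> k)"
          using gauss_sum_induced[of m p m' \<chi> k, OF mp m'pos ppos per] by simp
      qed
    next
      case False
      \<comment> \<open>Here \<chi> vanishes at multiples of p whereas the inducing character need
        not. As p does not divide m', adding m' to a multiple of p gives a representative of the
        same class modulo m' that is prime to p, where \<chi> shows the value of \<psi>.\<close>
      define l where "l n = (if int p dvd n then n + int m' else n)" for n
      have npm: "\<not> int p dvd int m'" using False by simp
      have lp: "\<not> int p dvd l n" for n unfolding l_def using npm by (auto simp: dvd_add_right_iff)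
      have lc: "[l n = n] (mod int m')" for n unfolding l_def by (auto simp: cong_def)
      define \<psi> where "\<psi> n = \<chi> (l n)" for n
      have cop: "coprime a (int m) \<longleftrightarrow> coprime a (int m')" if "\<not> int p dvd a" for a
      proof -
        have "coprime (int p) a" by (rule prime_imp_coprime[OF pint that])
        then show ?thesis by (simp add: mp coprime_commute)
      qed
      have eqW: "\<chi> a = \<chi> b" if "\<not> int p dvd a" "\<not> int p dvd b" "[a = b] (mod int m')" for a b
      proof (cases "coprime a (int m')")
        case True
        then have "coprime b (int m')" using cong_imp_coprime[OF that(3)] by blast
        then show ?thesis using True that by (intro eqc) (auto simp: cop)
      next
        case nc: False
        then have "\<not> coprime b (int m')" using cong_imp_coprime[OF cong_sym[OF that(3)]] by blast
        then have "\<chi> b = 0" using cop[OF that(2)] dirichlet_character_nonzero_iff[OF \<chi>] by blast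
        moreover have "\<chi> a = 0" using nc cop[OF that(1)] dirichlet_character_nonzero_iff[OF \<chi>] by blast
        ultimately show ?thesis by simp
      qed
      have \<psi>: "dirichlet_character m' \<psi>"
        unfolding dirichlet_character_def
      proof (intro conjI allI)
        fix a b
        have "\<chi> (l (a * b)) = \<chi> (l a * l b)"
        proof (rule eqW)
          show "\<not> int p dvd l a * l b" using lp pint by (simp add: prime_dvd_mult_iff)
          have "[l a * l b = a * b] (mod int m')" by (intro cong_mult lc)
          then show "[l (a * b) = l a * l b] (mod int m')" by (rule cong_trans[OF lc cong_sym])
        qed (rule lp)
        then show "\<psi> (a * b) = \<psi> a * \<psi> b" by (simp add: \<psi>_def dirichlet_character_mult[OF \<chi>])
      next
        fix n
        have "[n + int m' = n] (mod int m')" by (simp add: cong_def)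
        then have "[l (n + int m') = l n] (mod int m')" by (rule cong_trans[OF cong_trans[OF lc] cong_sym[OF lc]])
        then show "\<psi> (n + int m') = \<psi> n" unfolding \<psi>_def by (intro eqW lp)
      next
        fix n
        have "\<psi> n \<noteq> 0 \<longleftrightarrow> coprime (l n) (int m')" unfolding \<psi>_def dirichlet_character_nonzero_iff[OF \<chi>] by (rule cop[OF lp])
        also have "\<dots> \<longleftrightarrow> coprime n (int m')" using cong_imp_coprime[OF lc[of n]] cong_imp_coprime[OF cong_sym[OF lc[of n]]] by blast
        finally show "\<psi> n \<noteq> 0 \<longleftrightarrow> coprime n (int m')" .
      qed
      have per: "\<psi> (n + int m') = \<psi> n" for n using \<psi> by (simp add: dirichlet_character_def)
      have pcop: "coprime (int p) (int m')" by (rule prime_imp_coprime[OF pint npm])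
      \<comment> \<open>\<chi> is \<psi> with its values at the multiples of p removed. The full sum
        falls under \<open>gauss_sum_induced\<close>; the removed terms n = p a form a Gauss sum
        modulo m' with the factor \<psi>(p).\<close>
      have form: "gauss_sum m \<chi> k = (if int p dvd k then of_nat p * gauss_sum m' \<psi> (k div int p) else 0) - \<psi> (int p) * gauss_sum m' \<psi> k" for k
      proof -
        have "gauss_sum m \<chi> k = (\<Sum>n\<in>{0..<int m}. \<psi> n * ee (of_int (n * k) / real m) - (if int p dvd n then \<psi> n * ee (of_int (n * k) / real m) else 0))"
          unfolding gauss_sum_def
        proof (rule sum.cong[OF refl])
          fix n
          show "\<chi> n * ee (of_int (n * k) / real m) = \<psi> n * ee (of_int (n * k) / real m) - (if int p dvd n then \<psi> n * ee (of_int (n * k) / real m) else 0)"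
          proof (cases "int p dvd n")
            case True
            then have "\<not> coprime n (int m)" using pint by (auto simp: mp coprime_commute prime_imp_coprime dest: coprime_common_divisor)
            then show ?thesis using True dirichlet_character_nonzero_iff[OF \<chi>, of n] by auto
          next
            case False
            then show ?thesis by (simp add: \<psi>_def l_def)
          qed
        qed
        also have "\<dots> = gauss_sum m \<psi> k - (\<Sum>n\<in>{0..<int m}. if int p dvd n then \<psi> n * ee (of_int (n * k) / real m) else 0)"
          by (simp add: sum_subtractf gauss_sum_def)
        also have "(\<Sum>n\<in>{0..<int m}. if int p dvd n then \<psi> n * ee (of_int (n * k) / real m) else 0) = (\<Sum>n | n \<in> {0..<int m} \<and> int p dvd n. \<psi> n * ee (of_int (n * k) / real m))"
          by (rule sum.inter_filter[symmetric]) auto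
        also have "\<dots> = (\<Sum>a\<in>{0..<int m'}. \<psi> (int p * a) * ee (of_int (int p * a * k) / real m))"
        proof (rule sum.reindex_bij_witness[of _ "\<lambda>a. int p * a" "\<lambda>n. n div int p"])
          fix n assume "n \<in> {n. n \<in> {0..<int m} \<and> int p dvd n}"
          then obtain a where "n = int p * a" "0 \<le> int p * a" "int p * a < int p * int m'" by (auto simp: mp)
          then show "n div int p \<in> {0..<int m'}" using ppos by (auto simp: zero_le_mult_iff)
        next
          fix a assume "a \<in> {0..<int m'}"
          then show "int p * a \<in> {n. n \<in> {0..<int m} \<and> int p dvd n}" using ppos by (auto simp: mp)
        qed (use ppos in auto)
        also have "\<dots> = \<psi> (int p) * gauss_sum m' \<psi> k"
          unfolding gauss_sum_def sum_distrib_left using ppos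
          by (intro sum.cong refl) (simp add: dirichlet_character_mult[OF \<psi>] mp mult.assoc)
        finally show ?thesis using gauss_sum_induced[of m p m' \<psi> k, OF mp m'pos ppos per] by simp
      qed
      show ?thesis
      proof (rule key[OF \<psi>])
        fix k'
        have "\<psi> (int p) * gauss_sum m' \<psi> (int p * k') = gauss_sum m' \<psi> k'"
          by (rule gauss_sum_mult_unit[OF \<psi> m'pos pcop])
        then have "gauss_sum m \<chi> (int p * k') = of_nat p * gauss_sum m' \<psi> k' - gauss_sum m' \<psi> k'"
          using form[of "int p * k'"] ppos by simp
        also have "\<dots> = of_real (real p - 1) * gauss_sum m' \<psi> k'" by (simp add: algebra_simps)
        finally have "norm (gauss_sum m \<chi> (int p * k')) = (real p - 1) * norm (gauss_sum m' \<psi> k')"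
          using ppos by (simp add: norm_mult del: of_real_diff)
        then show "norm (gauss_sum m \<chi> (int p * k')) \<le> real p * norm (gauss_sum m' \<psi> k')"
          by (simp add: mult_right_mono)
      next
        fix k assume "\<not> int p dvd k" "gauss_sum m \<chi> k \<noteq> 0"
        then show "\<not> p dvd m' \<and> norm (gauss_sum m \<chi> k) = norm (gauss_sum m' \<psi> k)"
          using form[of k] False norm_dirichlet_character[OF \<psi> m'pos pcop] by (simp add: norm_mult)
      qed
    qed
  qed
qed

section \<open>Primes dividing the modulus\<close>

lemma card_divisors_prime_power_mult:
  fixes n :: nat
  assumes p: "prime p" and n: "n > 0"
  shows "card {d. d dvd p ^ k * n} \<le> (k + 1) * card {d. d dvd n}"
proof -
  have fin: "finite {d. d dvd n}" using n by simp
  have "{d. d dvd p ^ k * n} \<subseteq> (\<lambda>(i, d). p ^ i * d) ` ({..k} \<times> {d. d dvd n})"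
  proof
    fix d assume "d \<in> {d. d dvd p ^ k * n}"
    then obtain a b where ab: "d = a * b" "a dvd p ^ k" "b dvd n" using division_decomp by blast
    obtain i where "i \<le> k" "a = p ^ i" using ab(2) p divides_primepow_nat by blast
    then show "d \<in> (\<lambda>(i, d). p ^ i * d) ` ({..k} \<times> {d. d dvd n})" using ab by force
  qed
  then have "card {d. d dvd p ^ k * n} \<le> card ((\<lambda>(i, d). p ^ i * d) ` ({..k} \<times> {d. d dvd n}))"
    using fin by (intro card_mono) auto
  also have "\<dots> \<le> card ({..k} \<times> {d. d dvd n})" using fin by (intro card_image_le) auto
  finally show ?thesis by (simp add: card_cartesian_product)
qed

lemma power_powr:
  assumes "a > (0::real)"
  shows "(a ^ n) powr x = a powr (real n * x)"
  using assms by (simp add: powr_powr flip: powr_realpow)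

text \<open>Each prime factor p \<ge> 5 at most doubles the number of divisors, and 2 \<le> 5^(9/20)
  because 2^20 \<le> 5^9.\<close>

lemma card_divisors_le_aux:
  fixes n :: nat
  assumes "n > 0" "\<not> 2 dvd n" "\<not> 3 dvd n"
  shows "real (card {d. d dvd n}) \<le> real n powr (9 / 20)"
  using assms
proof (induction n rule: prime_divisors_induct)
  case (unit n)
  then show ?case by simp
next
  case (factor p n)
  have p: "prime p" "p \<noteq> 2" "p \<noteq> 3" using factor by auto
  have "p \<ge> 5"
  proof (rule ccontr)
    assume "\<not> p \<ge> 5"
    then have "p = 0 \<or> p = 1 \<or> p = 4" using p by linarith
    moreover have "\<not> prime (4::nat)" using prime_product[of 2 2] by auto
    ultimately show False using p by auto
  qed
  have n: "n > 0" "\<not> 2 dvd n" "\<not> 3 dvd n" using factor by auto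
  have "card {d. d dvd p * n} \<le> 2 * card {d. d dvd n}"
    using card_divisors_prime_power_mult[OF p(1) n(1), of 1] by simp
  then have "real (card {d. d dvd p * n}) \<le> 2 * real (card {d. d dvd n})" by linarith
  also have "\<dots> \<le> real p powr (9 / 20) * real n powr (9 / 20)"
  proof (intro mult_mono)
    have "(2::real) = (2 ^ 20) powr (1 / 20)" by (subst power_powr) simp_all
    also have "\<dots> \<le> (5 ^ 9) powr (1 / 20)" by (intro powr_mono2) auto
    also have "\<dots> = 5 powr (9 / 20)" by (subst power_powr) simp_all
    also have "\<dots> \<le> real p powr (9 / 20)" using \<open>p \<ge> 5\<close> by (intro powr_mono2) auto
    finally show "2 \<le> real p powr (9 / 20)" .
    show "real (card {d. d dvd n}) \<le> real n powr (9 / 20)" using factor.IH n by auto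
  qed auto
  also have "\<dots> = real (p * n) powr (9 / 20)" by (simp add: powr_mult)
  finally show ?case .
qed auto

text \<open>For the primes 2 and 3 the factor k + 1 is at most 3 (4/3)^k by Bernoulli's inequality,
  and 4/3 \<le> 2^(9/20). Two such primes account for the constant 9.\<close>

lemma card_divisors_le:
  fixes n :: nat
  assumes "n > 0"
  shows "real (card {d. d dvd n}) \<le> 9 * real n powr (9 / 20)"
proof -
  define r :: real where "r = 9 / 20"
  have lin: "real (k + 1) \<le> 3 * real (p ^ k) powr r" if "p \<ge> 2" for p k :: nat
  proof -
    have "(4 / 3 :: real) = ((4 / 3) ^ 20) powr (1 / 20)" by (subst power_powr) simp_all
    also have "\<dots> \<le> (2 ^ 9) powr (1 / 20)" by (intro powr_mono2) (auto simp: power_divide)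
    also have "\<dots> = 2 powr r" by (subst power_powr) (simp_all add: r_def)
    also have "\<dots> \<le> real p powr r" using that by (intro powr_mono2) (auto simp: r_def)
    finally have b: "4 / 3 \<le> real p powr r" .
    have "1 + real k * (1 / 3) \<le> (1 + 1 / 3) ^ k" by (rule Bernoulli_inequality) simp
    also have "\<dots> \<le> (real p powr r) ^ k" using b by (intro power_mono) auto
    also have "\<dots> = real (p ^ k) powr r" using that by (simp add: power_powr powr_power mult.commute)
    finally show ?thesis by simp
  qed
  obtain y where "n = 2 ^ multiplicity 2 n * y" "\<not> 2 dvd y"
    using multiplicity_decompose'[of n 2] assms by auto
  then obtain a where y: "n = 2 ^ a * y" "\<not> 2 dvd y" by blast
  have "y > 0" using y assms by (cases y) auto
  obtain z where "y = 3 ^ multiplicity 3 y * z" "\<not> 3 dvd z"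
    using multiplicity_decompose'[of y 3] \<open>y > 0\<close> by auto
  then obtain b where z: "y = 3 ^ b * z" "\<not> 3 dvd z" by blast
  have "z > 0" using z \<open>y > 0\<close> by (cases z) auto
  have z2: "\<not> 2 dvd z" using y(2) z by auto
  have p3: "prime (3::nat)" by simp
  have "card {d. d dvd n} \<le> (a + 1) * ((b + 1) * card {d. d dvd z})"
  proof -
    have "card {d. d dvd n} \<le> (a + 1) * card {d. d dvd y}"
      unfolding y(1) by (rule card_divisors_prime_power_mult[OF two_is_prime_nat \<open>y > 0\<close>])
    also have "\<dots> \<le> (a + 1) * ((b + 1) * card {d. d dvd z})"
      unfolding z(1) by (intro mult_left_mono card_divisors_prime_power_mult p3 \<open>z > 0\<close>) auto
    finally show ?thesis .
  qed
  then have "real (card {d. d dvd n}) \<le> real (a + 1) * (real (b + 1) * real (card {d. d dvd z}))"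
    by (simp only: of_nat_le_iff flip: of_nat_mult)
  also have "\<dots> \<le> (3 * real (2 ^ a) powr r) * ((3 * real (3 ^ b) powr r) * real z powr r)"
    using card_divisors_le_aux[OF \<open>z > 0\<close> z2 z(2)] lin[of 2 a] lin[of 3 b] by (intro mult_mono) (auto simp: r_def)
  also have "\<dots> = 9 * real n powr r" unfolding y z by (simp add: powr_mult)
  finally show ?thesis by (simp add: r_def)
qed

text \<open>The gap between 9/20 and 1/2 absorbs the logarithm: ln s \<le> 20 s^(1/20), and 468 = 9
  * (2 * 20 + 12).\<close>

lemma card_divisors_ln_le:
  fixes s :: nat
  assumes "s > 0"
  shows "real (card {d. d dvd s}) * (2 * ln (real s) + 12) \<le> 468 * sqrt (real s)"
proof -
  have s1: "real s \<ge> 1" using assms by simp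
  define t where "t = real s powr (1 / 20)"
  have t: "t \<ge> 1" unfolding t_def using s1 by (simp add: ge_one_powr_ge_zero)
  have "ln t \<le> t" using ln_le_minus_one[of t] t by simp
  then have "ln (real s) \<le> 20 * t" using s1 by (simp add: t_def ln_powr)
  then have "2 * ln (real s) + 12 \<le> 52 * t" using t by linarith
  then have "real (card {d. d dvd s}) * (2 * ln (real s) + 12) \<le> (9 * real s powr (9 / 20)) * (52 * t)"
    using card_divisors_le[OF assms] s1 by (intro mult_mono) auto
  also have "\<dots> = 468 * (real s powr (9 / 20) * real s powr (1 / 20))" by (simp add: t_def)
  also have "real s powr (9 / 20) * real s powr (1 / 20) = sqrt (real s)"
    using s1 by (simp add: powr_half_sqrt flip: powr_add)
  finally show ?thesis .
qed

text \<open>For k > 0, the logarithm of the part of k composed of the primes dividing g.\<close>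

definition mangoldt_part :: "nat \<Rightarrow> nat \<Rightarrow> real" where
  "mangoldt_part g k = (\<Sum>d | d dvd k \<and> \<not> coprime d g. mangoldt d)"

text \<open>The complementary sum, over divisors coprime to g, can only grow from k to g k, while
  the total ln(g k) exceeds ln k by ln g.\<close>

lemma mangoldt_part_mult_le:
  assumes "g > 0" "k > 0"
  shows "mangoldt_part g (g * k) \<le> ln (real g) + mangoldt_part g k"
proof -
  have split: "ln (real n) = mangoldt_part g n + (\<Sum>d | d dvd n \<and> coprime d g. mangoldt d)" if "n > 0" for n
  proof -
    have "{d. d dvd n} = {d. d dvd n \<and> \<not> coprime d g} \<union> {d. d dvd n \<and> coprime d g}" by auto
    then have "(\<Sum>d | d dvd n. mangoldt d :: real) = (\<Sum>d\<in>{d. d dvd n \<and> \<not> coprime d g} \<union> {d. d dvd n \<and> coprime d g}. mangoldt d)"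
      by (rule arg_cong)
    also have "\<dots> = mangoldt_part g n + (\<Sum>d | d dvd n \<and> coprime d g. mangoldt d)"
      unfolding mangoldt_part_def using that by (intro sum.union_disjoint) auto
    finally show ?thesis using mangoldt_sum[of n, where 'a = real] that by simp
  qed
  have "(\<Sum>d | d dvd k \<and> coprime d g. mangoldt d :: real) \<le> (\<Sum>d | d dvd g * k \<and> coprime d g. mangoldt d)"
    using assms by (intro sum_mono2) (auto simp: mangoldt_real_nonneg)
  moreover have "ln (real (g * k)) = ln (real g) + ln (real k)" using assms by (simp add: ln_mult)
  ultimately show ?thesis using split[of k] split[of "g * k"] assms by simp
qed

text \<open>On average over k a divisor d counts \<Lambda>(d)/d. The primes dividing g give at most
  the sum of their logarithms, hence at most ln g, and everything that is not prime gives at most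
  12.\<close>

lemma sum_mangoldt_part_le:
  assumes g: "g > 0"
  shows "(\<Sum>k=1..y. mangoldt_part g k) \<le> real y * (ln (real g) + 12)"
proof -
  let ?Q = "\<lambda>d. \<not> coprime d g"
  have "(\<Sum>k=1..y. mangoldt_part g k) = (\<Sum>d | d \<in> {1..y} \<and> ?Q d. \<Sum>m=1..y div d. mangoldt d)"
    unfolding mangoldt_part_def by (rule sum_divisors_swap)
  also have "\<dots> \<le> (\<Sum>d | d \<in> {1..y} \<and> ?Q d. real y * (mangoldt d / real d))"
  proof (rule sum_mono)
    fix d
    have "(\<Sum>m=1..y div d. mangoldt d :: real) = real (y div d) * mangoldt d" by simp
    also have "\<dots> \<le> (real y / real d) * mangoldt d" by (intro mult_right_mono of_nat_div_le_of_nat mangoldt_real_nonneg)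
    finally show "(\<Sum>m=1..y div d. mangoldt d :: real) \<le> real y * (mangoldt d / real d)" by simp
  qed
  also have "\<dots> = real y * (\<Sum>d | d \<in> {1..y} \<and> ?Q d. mangoldt d / real d)" by (rule sum_distrib_left[symmetric])
  also have "\<dots> \<le> real y * (ln (real g) + 12)"
  proof (rule mult_left_mono)
    let ?A = "{d. d \<in> {1..y} \<and> prime d \<and> ?Q d}" and ?B = "{d. d \<in> {1..y} \<and> \<not> prime d}"
    have "(\<Sum>d | d \<in> {1..y} \<and> ?Q d. mangoldt d / real d :: real) \<le> (\<Sum>d\<in>?A \<union> ?B. mangoldt d / real d)"
      by (intro sum_mono2) (auto simp: mangoldt_real_nonneg)
    also have "\<dots> = (\<Sum>d\<in>?A. mangoldt d / real d) + (\<Sum>d\<in>?B. mangoldt d / real d)"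
      by (intro sum.union_disjoint) auto
    finally have split: "(\<Sum>d | d \<in> {1..y} \<and> ?Q d. mangoldt d / real d :: real) \<le> (\<Sum>d\<in>?A. mangoldt d / real d) + (\<Sum>d\<in>?B. mangoldt d / real d)" .
    have "(\<Sum>d\<in>?A. mangoldt d / real d :: real) \<le> (\<Sum>p\<in>?A. ln (real p))"
    proof (rule sum_mono)
      fix p assume p: "p \<in> ?A"
      then have "ln (real p) * 1 \<le> ln (real p) * real p" by (intro mult_left_mono) auto
      then show "mangoldt p / real p \<le> ln (real p)" using p by (simp add: divide_le_eq)
    qed
    also have "\<dots> = ln (real (\<Prod>?A))"
    proof -
      have "ln (\<Prod>p\<in>?A. real p) = (\<Sum>p\<in>?A. ln (real p))" by (intro ln_prod) auto
      then show ?thesis by simp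
    qed
    also have "\<dots> \<le> ln (real g)"
    proof -
      have "\<Prod>?A dvd g"
      proof (rule prod_primes_dvd)
        fix p assume "p \<in> ?A"
        then show "p dvd g" using prime_imp_coprime by blast
      qed auto
      then have le: "\<Prod>?A \<le> g" using g by (rule dvd_imp_le)
      have pos: "\<Prod>?A > 0" by (intro prod_pos) auto
      have "ln (real n) \<le> ln (real g)" if "n > 0" "n \<le> g" for n using that by simp
      from this[OF pos le] show ?thesis .
    qed
    finally show "(\<Sum>d | d \<in> {1..y} \<and> ?Q d. mangoldt d / real d) \<le> ln (real g) + 12"
      using split sum_mangoldt_higher_prime_powers[of y] by linarith
  qed auto
  finally show ?thesis .
qed

text \<open>Sorting by g = gcd(k, q): g must divide s, the Gauss sum is at most g sqrt(q/s), and the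
  factor g is compensated by the density 1/g of the multiples of g. Every divisor g of s thus costs
  x sqrt(q/s) (2 ln s + 12), and the number of divisors times this logarithm is O(sqrt s).\<close>

lemma gauss_sum_mangoldt_mean:
  assumes \<chi>: "dirichlet_character q \<chi>" and q: "q > 0"
  shows "(\<Sum>k=1..x. norm (gauss_sum q \<chi> (int k)) * (\<Sum>d | d dvd k \<and> \<not> coprime d q. mangoldt d))
      \<le> 468 * sqrt (real q) * real x"
proof -
  obtain s where s: "s > 0" "s dvd q" and supp: "\<And>k. gauss_sum q \<chi> k \<noteq> 0 \<Longrightarrow>
           nat (gcd k (int q)) dvd s \<and> (norm (gauss_sum q \<chi> k))\<^sup>2 * real s \<le> real q * (of_int (gcd k (int q)))\<^sup>2"
    using gauss_sum_support[OF q \<chi>] by blast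
  have sp: "sqrt (real s) > 0" using s by simp
  have each: "norm (gauss_sum q \<chi> (int k)) * (\<Sum>d | d dvd k \<and> \<not> coprime d q. mangoldt d)
      \<le> (\<Sum>g | g dvd s \<and> g dvd k. sqrt (real q) / sqrt (real s) * (real g * mangoldt_part g k))" if k: "k \<in> {1..x}" for k
  proof (cases "gauss_sum q \<chi> (int k) = 0")
    case True
    have "0 \<le> (\<Sum>g | g dvd s \<and> g dvd k. sqrt (real q) / sqrt (real s) * (real g * mangoldt_part g k))"
      unfolding mangoldt_part_def by (intro sum_nonneg mult_nonneg_nonneg divide_nonneg_nonneg) (auto simp: mangoldt_real_nonneg)
    then show ?thesis using True by simp
  next
    case False
    define g where "g = gcd k q"
    have gi: "gcd (int k) (int q) = int g" by (simp add: g_def)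
    have g: "g dvd s" "(norm (gauss_sum q \<chi> (int k)))\<^sup>2 * real s \<le> real q * (real g)\<^sup>2"
      using supp[OF False] unfolding gi by auto
    have gk: "g dvd k" by (simp add: g_def)
    have "(norm (gauss_sum q \<chi> (int k)) * sqrt (real s))\<^sup>2 \<le> (sqrt (real q) * real g)\<^sup>2"
      using g(2) by (simp add: power_mult_distrib)
    then have "norm (gauss_sum q \<chi> (int k)) * sqrt (real s) \<le> sqrt (real q) * real g"
      by (rule power2_le_imp_le) simp
    then have n: "norm (gauss_sum q \<chi> (int k)) \<le> sqrt (real q) / sqrt (real s) * real g"
      using sp by (simp add: field_simps)
    have "(\<Sum>d | d dvd k \<and> \<not> coprime d q. mangoldt d) \<le> mangoldt_part g k"
      unfolding mangoldt_part_def
    proof (rule sum_mono2)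
      \<comment> \<open>For d dividing k, a common factor of d and q divides g = gcd(k, q), so q may
        be replaced by g in the coprimality condition.\<close>
      show "{d. d dvd k \<and> \<not> coprime d q} \<subseteq> {d. d dvd k \<and> \<not> coprime d g}"
      proof clarify
        fix d assume d: "d dvd k" "\<not> coprime d q" "coprime d g"
        have "coprime d q"
        proof (rule coprimeI)
          fix e assume "e dvd d" "e dvd q"
          then have "e dvd g" using d(1) dvd_trans unfolding g_def by (intro gcd_greatest) blast
          then show "is_unit e" using d(3) \<open>e dvd d\<close> by (meson coprime_common_divisor)
        qed
        then show False using d(2) by simp
      qed
      show "finite {d. d dvd k \<and> \<not> coprime d g}" using k by simp
    qed (auto simp: mangoldt_real_nonneg)
    then have "norm (gauss_sum q \<chi> (int k)) * (\<Sum>d | d dvd k \<and> \<not> coprime d q. mangoldt d)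
       \<le> (sqrt (real q) / sqrt (real s) * real g) * mangoldt_part g k"
      using n by (intro mult_mono sum_nonneg) (auto simp: mangoldt_real_nonneg)
    also have "\<dots> = sqrt (real q) / sqrt (real s) * (real g * mangoldt_part g k)" by (simp only: mult.assoc)
    also have "\<dots> \<le> (\<Sum>g | g dvd s \<and> g dvd k. sqrt (real q) / sqrt (real s) * (real g * mangoldt_part g k))"
    proof (rule member_le_sum)
      show "g \<in> {g. g dvd s \<and> g dvd k}" using g gk by simp
      show "finite {g. g dvd s \<and> g dvd k}" using s by simp
    qed (auto simp: mangoldt_part_def mangoldt_real_nonneg intro!: sum_nonneg mult_nonneg_nonneg divide_nonneg_nonneg)
    finally show ?thesis .
  qed
  have "(\<Sum>k=1..x. norm (gauss_sum q \<chi> (int k)) * (\<Sum>d | d dvd k \<and> \<not> coprime d q. mangoldt d))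
     \<le> (\<Sum>k=1..x. \<Sum>g | g dvd s \<and> g dvd k. sqrt (real q) / sqrt (real s) * (real g * mangoldt_part g k))"
    by (intro sum_mono each)
  also have "\<dots> = (\<Sum>k=1..x. \<Sum>g | g dvd k \<and> g dvd s. sqrt (real q) / sqrt (real s) * (real g * mangoldt_part g k))"
    by (simp only: conj_commute)
  also have "\<dots> = (\<Sum>g | g \<in> {1..x} \<and> g dvd s. \<Sum>j=1..x div g. sqrt (real q) / sqrt (real s) * (real g * mangoldt_part g (g * j)))"
    by (rule sum_divisors_swap)
  also have "\<dots> \<le> (\<Sum>g | g \<in> {1..x} \<and> g dvd s. sqrt (real q) / sqrt (real s) * (real x * (2 * ln (real s) + 12)))"
  proof (rule sum_mono)
    fix g assume "g \<in> {g. g \<in> {1..x} \<and> g dvd s}"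
    then have g: "g > 0" "g dvd s" by auto
    have gs: "g \<le> s" using g s by (intro dvd_imp_le)
    have "(\<Sum>j=1..x div g. sqrt (real q) / sqrt (real s) * (real g * mangoldt_part g (g * j)))
       = sqrt (real q) / sqrt (real s) * (real g * (\<Sum>j=1..x div g. mangoldt_part g (g * j)))"
      by (simp only: sum_distrib_left)
    also have "\<dots> \<le> sqrt (real q) / sqrt (real s) * (real g * (real (x div g) * (2 * ln (real s) + 12)))"
    proof (intro mult_left_mono)
      have "(\<Sum>j=1..x div g. mangoldt_part g (g * j)) \<le> (\<Sum>j=1..x div g. ln (real g) + mangoldt_part g j)"
        using g by (intro sum_mono mangoldt_part_mult_le) auto
      also have "\<dots> = real (x div g) * ln (real g) + (\<Sum>j=1..x div g. mangoldt_part g j)" by (simp add: sum.distrib)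
      also have "\<dots> \<le> real (x div g) * ln (real g) + real (x div g) * (ln (real g) + 12)"
        by (intro add_left_mono sum_mangoldt_part_le g)
      also have "\<dots> = real (x div g) * (2 * ln (real g) + 12)" by (simp add: algebra_simps)
      also have "\<dots> \<le> real (x div g) * (2 * ln (real s) + 12)" using g gs by (intro mult_left_mono) auto
      finally show "(\<Sum>j=1..x div g. mangoldt_part g (g * j)) \<le> real (x div g) * (2 * ln (real s) + 12)" .
    qed auto
    also have "\<dots> \<le> sqrt (real q) / sqrt (real s) * (real x * (2 * ln (real s) + 12))"
    proof (intro mult_left_mono)
      have "real (x div g) * real g \<le> real x" by (simp flip: of_nat_mult)
      then have "real (x div g) * real g * (2 * ln (real s) + 12) \<le> real x * (2 * ln (real s) + 12)"
        using s by (intro mult_right_mono) auto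
      then show "real g * (real (x div g) * (2 * ln (real s) + 12)) \<le> real x * (2 * ln (real s) + 12)" by (simp add: mult_ac)
    qed auto
    finally show "(\<Sum>j=1..x div g. sqrt (real q) / sqrt (real s) * (real g * mangoldt_part g (g * j)))
       \<le> sqrt (real q) / sqrt (real s) * (real x * (2 * ln (real s) + 12))" .
  qed
  also have "\<dots> \<le> (\<Sum>g | g dvd s. sqrt (real q) / sqrt (real s) * (real x * (2 * ln (real s) + 12)))"
    using s by (intro sum_mono2) auto
  also have "\<dots> = sqrt (real q) / sqrt (real s) * real x * (real (card {g. g dvd s}) * (2 * ln (real s) + 12))"
    by simp
  also have "\<dots> \<le> sqrt (real q) / sqrt (real s) * real x * (468 * sqrt (real s))"
    using s by (intro mult_left_mono card_divisors_ln_le) auto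
  also have "\<dots> = 468 * sqrt (real q) * real x" using sp by simp
  finally show ?thesis .
qed

section \<open>Finite Fourier expansion\<close>

lemma gauss_sum_0:
  assumes \<chi>: "dirichlet_character q \<chi>" and q: "q > 0" and np: "\<chi> \<noteq> principal_character q"
  shows "gauss_sum q \<chi> 0 = 0"
proof -
  obtain u where u: "\<chi> u \<noteq> principal_character q u" using np by blast
  then have cu: "coprime u (int q)" using dirichlet_character_nonzero_iff[OF \<chi>, of u] by (auto simp: principal_character_def split: if_splits)
  then have "\<chi> u \<noteq> 1" using u by (simp add: principal_character_def)
  then show ?thesis using gauss_sum_mult_unit[OF \<chi> q cu, of 0] by simp
qed

lemma gauss_sum_inversion:
  assumes \<chi>: "dirichlet_character q \<chi>" and q: "q > 0"
  shows "of_nat q * \<chi> n = (\<Sum>k\<in>{0..<int q}. gauss_sum q \<chi> k * ee (- (of_int (n * k) / real q)))"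
proof -
  let ?I = "{0..<int q}"
  have "(\<Sum>k\<in>?I. gauss_sum q \<chi> k * ee (- (of_int (n * k) / real q))) = (\<Sum>k\<in>?I. \<Sum>m\<in>?I. \<chi> m * ee (of_int ((m - n) * k) / real q))"
  proof (rule sum.cong[OF refl])
    fix k
    have "of_int ((m - n) * k) / real q = of_int (m * k) / real q + - (of_int (n * k) / real q)" for m
      by (simp add: algebra_simps diff_divide_distrib)
    then have "ee (of_int ((m - n) * k) / real q) = ee (of_int (m * k) / real q) * ee (- (of_int (n * k) / real q))" for m
      by (simp only: ee_add)
    then show "gauss_sum q \<chi> k * ee (- (of_int (n * k) / real q)) = (\<Sum>m\<in>?I. \<chi> m * ee (of_int ((m - n) * k) / real q))"
      by (simp only: gauss_sum_def sum_distrib_right mult.assoc)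
  qed
  also have "\<dots> = (\<Sum>m\<in>?I. \<Sum>k\<in>?I. \<chi> m * ee (of_int ((m - n) * k) / real q))" by (rule sum.swap)
  also have "\<dots> = (\<Sum>m\<in>?I. if m = n mod int q then of_nat q * \<chi> n else 0)"
  proof (rule sum.cong[OF refl])
    fix m assume m: "m \<in> ?I"
    have "(\<Sum>k\<in>?I. \<chi> m * ee (of_int ((m - n) * k) / real q)) = \<chi> m * (if int q dvd m - n then of_nat q else 0)"
      unfolding sum_ee_orthogonal[OF q, symmetric] by (rule sum_distrib_left[symmetric])
    moreover have "int q dvd m - n \<longleftrightarrow> m = n mod int q"
      using m by (simp add: mod_eq_dvd_iff[symmetric])
    moreover have "\<chi> m = \<chi> n" if "m = n mod int q"
      using that by (intro dirichlet_character_cong[OF \<chi>]) (simp add: cong_def)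
    ultimately show "(\<Sum>k\<in>?I. \<chi> m * ee (of_int ((m - n) * k) / real q)) = (if m = n mod int q then of_nat q * \<chi> n else 0)"
      by auto
  qed
  also have "\<dots> = of_nat q * \<chi> n" using q by simp
  finally show ?thesis by simp
qed

definition cos_sum :: "nat \<Rightarrow> real \<Rightarrow> real" where
  "cos_sum N \<theta> = (\<Sum>n=1..N. cos (real n * \<theta>))"

lemma cos_sum_formula: "2 * sin (\<theta> / 2) * cos_sum N \<theta> = sin (real N * \<theta> + \<theta> / 2) - sin (\<theta> / 2)"
proof (induction N)
  case (Suc N)
  have "2 * sin (\<theta> / 2) * cos_sum (Suc N) \<theta> = 2 * sin (\<theta> / 2) * cos_sum N \<theta> + 2 * cos (real (Suc N) * \<theta>) * sin (\<theta> / 2)"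
    by (simp add: cos_sum_def algebra_simps)
  also have "2 * cos (real (Suc N) * \<theta>) * sin (\<theta> / 2) = sin (real (Suc N) * \<theta> + \<theta> / 2) - sin (real (Suc N) * \<theta> - \<theta> / 2)"
    by (simp add: sin_add sin_diff)
  also have "real (Suc N) * \<theta> - \<theta> / 2 = real N * \<theta> + \<theta> / 2" by (simp add: algebra_simps)
  finally show ?case using Suc by simp
qed (simp add: cos_sum_def)

text \<open>The closed form is S cot(\<phi>)/2 + (C - 1)/2, with S and C the sine and cosine of
  2N\<phi>. Replacing cot \<phi> by 1/\<phi> changes it by at most 1/2, since 1/\<phi> - cot \<phi>
  lies between 0 and 1; the second summand is at most 1 in absolute value.\<close>

lemma cos_sum_approx:
  assumes \<phi>: "0 < \<phi>" "\<phi> < pi / 2"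
  shows "\<bar>cos_sum N (2 * \<phi>) - sin (real N * (2 * \<phi>)) / (2 * \<phi>)\<bar> \<le> 3 / 2"
proof -
  define s c where "s = sin \<phi>" and "c = cos \<phi>"
  have s: "s > 0" using \<phi> unfolding s_def by (intro sin_gt_zero) auto
  have c: "c > 0" using \<phi> unfolding c_def by (intro cos_gt_zero) auto
  define S C where "S = sin (real N * (2 * \<phi>))" and "C = cos (real N * (2 * \<phi>))"
  have bd: "\<bar>S\<bar> \<le> 1" "\<bar>C\<bar> \<le> 1" by (auto simp: S_def C_def)
  have "2 * s * cos_sum N (2 * \<phi>) = S * c + C * s - s"
    using cos_sum_formula[of "2 * \<phi>" N] by (simp add: s_def c_def S_def C_def sin_add)
  then have "cos_sum N (2 * \<phi>) = S * (c / s) / 2 + (C - 1) / 2"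
    using s by (simp add: field_simps)
  then have eq: "cos_sum N (2 * \<phi>) - S / (2 * \<phi>) = (C - 1) / 2 - S * (1 / \<phi> - c / s) / 2"
    by (simp add: algebra_simps diff_divide_distrib)
  have "\<bar>S * (1 / \<phi> - c / s)\<bar> \<le> 1"
  proof -
    have low: "\<phi> * c \<le> s"
    proof -
      obtain y where y: "y > 0" "y < \<phi>" "sin \<phi> - sin 0 = (\<phi> - 0) * cos y"
        using MVT2[of 0 \<phi> sin cos] \<phi> by (auto intro: derivative_eq_intros)
      have "cos \<phi> \<le> cos y" using y \<phi> by (intro cos_monotone_0_pi_le) auto
      then show ?thesis using y \<phi> by (simp add: s_def c_def)
    qed
    have s\<phi>: "s \<le> \<phi>" unfolding s_def using \<phi> by (intro sin_x_le_x) auto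
    have sc: "1 - c \<le> s"
    proof -
      have "s\<^sup>2 = (1 - c) * (1 + c)" using sin_cos_squared_add[of \<phi>] by (simp add: s_def c_def power2_eq_square algebra_simps)
      moreover have "(1 - c) * (1 - c) \<le> (1 - c) * (1 + c)" using c by (intro mult_left_mono) (auto simp: c_def)
      ultimately have "(1 - c)\<^sup>2 \<le> s\<^sup>2" by (simp add: power2_eq_square)
      then show ?thesis by (rule power2_le_imp_le) (use s in auto)
    qed
    have eq: "1 / \<phi> - c / s = (s - \<phi> * c) / (\<phi> * s)" using \<phi> s by (simp add: field_simps)
    have "s - \<phi> * c \<le> \<phi> * (1 - c)" using s\<phi> by (simp add: algebra_simps)
    also have "\<dots> \<le> \<phi> * s" using sc \<phi> by (intro mult_left_mono) auto
    finally have "0 \<le> 1 / \<phi> - c / s" "1 / \<phi> - c / s \<le> 1" unfolding eq using low \<phi> s by (auto simp: divide_le_eq_1)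
    then have "\<bar>S\<bar> * \<bar>1 / \<phi> - c / s\<bar> \<le> 1 * 1" using bd by (intro mult_mono) auto
    then show ?thesis by (simp add: abs_mult)
  qed
  moreover have "\<bar>C - 1\<bar> \<le> 2" using bd by linarith
  moreover have "\<bar>v / 2 - u / 2\<bar> \<le> 3 / 2" if "\<bar>u\<bar> \<le> 1" "\<bar>v\<bar> \<le> 2" for u v :: real
    using that by linarith
  ultimately show ?thesis unfolding S_def[symmetric] eq by blast
qed

lemma gauss_sum_even:
  assumes \<chi>: "dirichlet_character q \<chi>" and q: "q > 0" and ev: "even_character \<chi>"
  shows "gauss_sum q \<chi> (- k) = gauss_sum q \<chi> k"
  using gauss_sum_mult_unit[OF \<chi> q, of "-1" k] ev by (simp add: even_character_def)

text \<open>Evenness allows the inversion formulas at n and -n to be averaged, which turns the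
  exponentials into cosines.\<close>

lemma character_sum_cos_expansion:
  assumes \<chi>: "dirichlet_character q \<chi>" and q: "q > 0" and ev: "even_character \<chi>"
  shows "of_nat q * (\<Sum>n=1..N. \<chi> (int n)) = (\<Sum>k\<in>{0..<int q}. gauss_sum q \<chi> k * of_real (cos_sum N (2 * pi * (of_int k / real q))))"
proof -
  let ?I = "{0..<int q}"
  have avg: "of_nat q * \<chi> n = (\<Sum>k\<in>?I. gauss_sum q \<chi> k * of_real (cos (of_int n * (2 * pi * (of_int k / real q)))))" for n
  proof -
    have "\<chi> (- n) = \<chi> n" using dirichlet_character_mult[OF \<chi>, of "-1" n] ev by (simp add: even_character_def)
    then have "of_nat q * \<chi> n + of_nat q * \<chi> n = (\<Sum>k\<in>?I. gauss_sum q \<chi> k * (ee (- (of_int (n * k) / real q)) + ee (of_int (n * k) / real q)))"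
      using gauss_sum_inversion[OF \<chi> q, of n] gauss_sum_inversion[OF \<chi> q, of "- n"]
      by (simp add: distrib_left sum.distrib)
    also have "\<dots> = (\<Sum>k\<in>?I. 2 * (gauss_sum q \<chi> k * of_real (cos (of_int n * (2 * pi * (of_int k / real q))))))"
    proof (intro sum.cong refl)
      fix k
      have "ee (- t) + ee t = 2 * of_real (cos (2 * pi * t))" for t by (simp add: ee_def complex_eq_iff)
      from this[of "of_int (n * k) / real q"]
      show "gauss_sum q \<chi> k * (ee (- (of_int (n * k) / real q)) + ee (of_int (n * k) / real q)) = 2 * (gauss_sum q \<chi> k * of_real (cos (of_int n * (2 * pi * (of_int k / real q)))))"
        by (simp add: mult_ac)
    qed
    also have "\<dots> = 2 * (\<Sum>k\<in>?I. gauss_sum q \<chi> k * of_real (cos (of_int n * (2 * pi * (of_int k / real q)))))" by (rule sum_distrib_left[symmetric])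
    finally show ?thesis by simp
  qed
  have "of_nat q * (\<Sum>n=1..N. \<chi> (int n)) = (\<Sum>n=1..N. \<Sum>k\<in>?I. gauss_sum q \<chi> k * of_real (cos (real n * (2 * pi * (of_int k / real q)))))"
    unfolding sum_distrib_left avg by simp
  also have "\<dots> = (\<Sum>k\<in>?I. \<Sum>n=1..N. gauss_sum q \<chi> k * of_real (cos (real n * (2 * pi * (of_int k / real q)))))" by (rule sum.swap)
  also have "\<dots> = (\<Sum>k\<in>?I. gauss_sum q \<chi> k * of_real (cos_sum N (2 * pi * (of_int k / real q))))"
    by (simp only: cos_sum_def of_real_sum sum_distrib_left)
  finally show ?thesis .
qed

lemma cos_sum_reflect: "cos_sum N (2 * pi - \<theta>) = cos_sum N \<theta>"
  unfolding cos_sum_def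
proof (intro sum.cong refl)
  fix n
  have "cos (real n * (2 * pi - \<theta>)) = cos (- (real n * \<theta>) + real n * (2 * pi))" by (simp add: algebra_simps)
  also have "\<dots> = cos (- (real n * \<theta>))"
  proof -
    have "cos (real n * (2 * pi)) = 1" "sin (real n * (2 * pi)) = 0"
      using cos_int_2pin[of "int n"] sin_int_2pin[of "int n"] by (simp_all add: mult.commute)
    then show ?thesis unfolding cos_add by simp
  qed
  finally show "cos (real n * (2 * pi - \<theta>)) = cos (real n * \<theta>)" by simp
qed

lemma abs_cos_sum_pi: "\<bar>cos_sum N pi\<bar> \<le> 1"
proof -
  have "sin (real N * pi + pi / 2) - 1 = 2 * cos_sum N pi" using cos_sum_formula[of pi N] by simp
  moreover have "\<bar>sin (real N * pi + pi / 2)\<bar> \<le> 1" by simp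
  ultimately show ?thesis by linarith
qed

text \<open>The terms \<open>k\<close> and \<open>q - k\<close> of the expansion agree; for even \<open>q\<close> the middle term \<open>k = q / 2\<close> is left over.\<close>

lemma character_sum_le_sine_sum:
  assumes \<chi>: "dirichlet_character q \<chi>" and q: "q > 0" and ev: "even_character \<chi>"
    and np: "\<chi> \<noteq> principal_character q"
  defines "F \<equiv> \<lambda>k. gauss_sum q \<chi> (int k) / of_real (sqrt (real q))"
  shows "norm (\<Sum>n=1..N. \<chi> (int n))
     \<le> sqrt (real q) * (3 + norm (\<Sum>k=1..(q - 1) div 2. F k * of_real (sin (2 * pi * (real k * (real N / real q))) / real k)))"
proof -
  define G where "G k = gauss_sum q \<chi> (int k)" for k
  define K where "K = (q - 1) div 2"
  define D where "D k = G k * of_real (cos_sum N (2 * pi * (real k / real q)))" for k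
  have sq: "sqrt (real q) > 0" using q by simp
  have G0: "G 0 = 0" using gauss_sum_0[OF \<chi> q np] by (simp add: G_def)
  have "of_nat q * (\<Sum>n=1..N. \<chi> (int n)) = (\<Sum>k<q. D k)"
    unfolding character_sum_cos_expansion[OF \<chi> q ev] D_def G_def
    by (rule sum.reindex_bij_witness[of _ int nat]) auto
  also have "(\<Sum>k<q. D k) = (\<Sum>k=1..<q. D k)"
    by (rule sum.mono_neutral_right) (auto simp: D_def G0 not_less_eq_eq Suc_le_eq)
  also have "\<dots> = (\<Sum>k=1..K. D k) + (\<Sum>k=Suc K..<q. D k)"
    using q by (subst sum.union_disjoint[symmetric]) (auto intro!: sum.cong simp: K_def)
  also have "(\<Sum>k=Suc K..<q. D k) = (\<Sum>k=1..K. D k) + (if even q then D (q div 2) else 0)"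
  proof -
    have refl: "D (q - k) = D k" if "k \<in> {1..K}" for k
    proof -
      have kq: "k \<le> q" using that by (auto simp: K_def)
      have "G (q - k) = gauss_sum q \<chi> (- int k)" unfolding G_def
        using kq by (intro gauss_sum_cong[OF q]) (simp add: of_nat_diff cong_def)
      then have "G (q - k) = G k" by (simp add: gauss_sum_even[OF \<chi> q ev] G_def)
      moreover have "2 * pi * (real (q - k) / real q) = 2 * pi - 2 * pi * (real k / real q)"
        using kq q by (simp add: of_nat_diff field_simps)
      ultimately show ?thesis by (simp only: D_def cos_sum_reflect)
    qed
    have "D (q - a) = D a" if "a \<in> {q - K..<q}" for a
    proof -
      have "q - a \<in> {1..K}" "q - (q - a) = a" using that by auto
      then show ?thesis using refl[of "q - a"] by simp
    qed
    then have "(\<Sum>k=q-K..<q. D k) = (\<Sum>k=1..K. D k)"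
      by (intro sum.reindex_bij_witness[of _ "\<lambda>k. q - k" "\<lambda>k. q - k"]) (auto simp: K_def)
    moreover have "(\<Sum>k=Suc K..<q. D k) = (if even q then D (q div 2) else 0) + (\<Sum>k=q-K..<q. D k)"
    proof (cases "even q")
      case True
      then obtain r where r: "q = 2 * r" by auto
      then have "r > 0" using q by simp
      then have K: "K = r - 1" by (simp add: K_def r)
      have "{Suc K..<q} = insert r {q - K..<q}" using \<open>r > 0\<close> by (auto simp: K r)
      moreover have "r \<notin> {q - K..<q}" using \<open>r > 0\<close> by (auto simp: K r)
      ultimately show ?thesis using True by (simp add: r)
    next
      case False
      then obtain r where r: "q = 2 * r + 1" by (elim oddE)
      then have "K = r" by (simp add: K_def)
      then have "Suc K = q - K" by (simp add: r)
      then show ?thesis using False by simp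
    qed
    ultimately show ?thesis by simp
  qed
  finally have main: "of_nat q * (\<Sum>n=1..N. \<chi> (int n)) = 2 * (\<Sum>k=1..K. D k) + (if even q then D (q div 2) else 0)" by simp
  have Gsq: "(\<Sum>k=1..x. (norm (G k / of_real (sqrt (real q))))\<^sup>2) \<le> real x" for x
    using gauss_sum_square_mean[OF \<chi> q, of x] q by (simp add: G_def norm_divide power_divide flip: sum_divide_distrib) (simp add: divide_le_eq)
  have Gsum: "(\<Sum>k=1..K. norm (G k)) \<le> sqrt (real q) * real K"
  proof -
    have "(\<Sum>k=1..K. norm (G k / of_real (sqrt (real q)))) \<le> real K" by (rule sum_norm_le_of_square_mean[OF Gsq])
    then show ?thesis using sq by (simp add: norm_divide flip: sum_divide_distrib) (simp add: divide_le_eq mult.commute)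
  qed
  define E where "E = (\<Sum>k=1..K. G k * of_real (sin (2 * pi * (real k * (real N / real q))) / real k))"
  \<comment> \<open>Applied with \<phi> = pi k / q, which is below pi/2 exactly because k \<le> K.
    The mean square bound makes the sum of |G k| at most sqrt q times K, so the kernel error is
    affordable.\<close>
  have approx: "norm (2 * (\<Sum>k=1..K. D k) - of_real (real q / pi) * E) \<le> 3 * (sqrt (real q) * real K)"
  proof -
    have "2 * (\<Sum>k=1..K. D k) - of_real (real q / pi) * E = (\<Sum>k=1..K. G k * of_real (2 * (cos_sum N (2 * (pi * (real k / real q))) - sin (real N * (2 * (pi * (real k / real q)))) / (2 * (pi * (real k / real q))))))"
      unfolding E_def D_def sum_distrib_left sum_subtractf[symmetric]
    proof (intro sum.cong refl)
      fix k assume "k \<in> {1..K}"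
      have e: "real q / pi * (sin (2 * pi * (real k * (real N / real q))) / real k) = 2 * (sin (real N * (2 * (pi * (real k / real q)))) / (2 * (pi * (real k / real q))))"
        using q by (simp add: mult_ac)
      have "2 * (G k * of_real (cos_sum N (2 * pi * (real k / real q)))) - of_real (real q / pi) * (G k * of_real (sin (2 * pi * (real k * (real N / real q))) / real k))
        = G k * (of_real (2 * cos_sum N (2 * pi * (real k / real q))) - of_real (real q / pi * (sin (2 * pi * (real k * (real N / real q))) / real k)))"
        by (simp add: algebra_simps)
      also have "\<dots> = G k * of_real (2 * cos_sum N (2 * (pi * (real k / real q))) - 2 * (sin (real N * (2 * (pi * (real k / real q)))) / (2 * (pi * (real k / real q)))))"
        unfolding e by (simp only: of_real_diff mult.assoc)
      finally show "2 * (G k * of_real (cos_sum N (2 * pi * (real k / real q)))) - of_real (real q / pi) * (G k * of_real (sin (2 * pi * (real k * (real N / real q))) / real k))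
        = G k * of_real (2 * (cos_sum N (2 * (pi * (real k / real q))) - sin (real N * (2 * (pi * (real k / real q)))) / (2 * (pi * (real k / real q)))))"
        by (simp only: right_diff_distrib)
    qed
    also have "norm \<dots> \<le> (\<Sum>k=1..K. norm (G k) * 3)"
    proof (rule sum_norm_le)
      have double: "\<bar>2 * y\<bar> \<le> 3" if "\<bar>y\<bar> \<le> 3 / 2" for y :: real using that by linarith
      fix k assume k: "k \<in> {1..K}"
      have "2 * k < q" using k q by (auto simp: K_def)
      then have "2 * real k < real q" by linarith
      then have "pi * (real k / real q) < pi / 2" using q by (simp add: field_simps)
      moreover have "0 < pi * (real k / real q)" using k q by simp
      ultimately have "\<bar>cos_sum N (2 * (pi * (real k / real q))) - sin (real N * (2 * (pi * (real k / real q)))) / (2 * (pi * (real k / real q)))\<bar> \<le> 3 / 2"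
        by (intro cos_sum_approx)
      then have "\<bar>2 * (cos_sum N (2 * (pi * (real k / real q))) - sin (real N * (2 * (pi * (real k / real q)))) / (2 * (pi * (real k / real q))))\<bar> \<le> 3"
        by (rule double)
      then show "norm (G k * of_real (2 * (cos_sum N (2 * (pi * (real k / real q))) - sin (real N * (2 * (pi * (real k / real q)))) / (2 * (pi * (real k / real q)))))) \<le> norm (G k) * 3"
        by (simp only: norm_mult norm_of_real) (intro mult_left_mono, auto)
    qed
    also have "\<dots> = 3 * (\<Sum>k=1..K. norm (G k))" by (simp add: sum_distrib_left mult.commute)
    also have "\<dots> \<le> 3 * (sqrt (real q) * real K)" using Gsum by simp
    finally show ?thesis .
  qed
  \<comment> \<open>A single Gauss sum is bounded by the whole mean square up to q/2. The crude
    result q suffices, being divided by q in the end.\<close>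
  have mid: "norm (if even q then D (q div 2) else 0) \<le> real q"
  proof (cases "even q")
    case True
    define r where "r = q div 2"
    have r: "q = 2 * r" "r > 0" using True q by (auto simp: r_def)
    have "(norm (G r))\<^sup>2 \<le> (\<Sum>k=1..r. (norm (G k))\<^sup>2)" using r by (intro member_le_sum) auto
    also have "\<dots> \<le> real r * real q" unfolding G_def by (rule gauss_sum_square_mean[OF \<chi> q])
    also have "\<dots> \<le> (real q)\<^sup>2" using r by (simp add: power2_eq_square)
    finally have "norm (G r) \<le> real q" by (rule power2_le_imp_le) simp
    moreover have "2 * pi * (real r / real q) = pi" using r by simp
    then have "norm (D r) = norm (G r) * \<bar>cos_sum N pi\<bar>" by (simp add: D_def norm_mult)
    moreover have "\<dots> \<le> norm (G r) * 1" by (intro mult_left_mono abs_cos_sum_pi) auto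
    ultimately show ?thesis using True by (simp add: r_def)
  qed auto
  have "norm (of_nat q * (\<Sum>n=1..N. \<chi> (int n))) \<le> 3 * (sqrt (real q) * real K) + norm (of_real (real q / pi) * E) + real q"
  proof -
    have "of_nat q * (\<Sum>n=1..N. \<chi> (int n)) = (2 * (\<Sum>k=1..K. D k) - of_real (real q / pi) * E) + of_real (real q / pi) * E + (if even q then D (q div 2) else 0)"
      unfolding main by simp
    also have "norm \<dots> \<le> norm (2 * (\<Sum>k=1..K. D k) - of_real (real q / pi) * E) + norm (of_real (real q / pi) * E) + norm (if even q then D (q div 2) else 0)"
      by (intro order_trans[OF norm_triangle_ineq] add_mono norm_triangle_ineq order_refl)
    finally show ?thesis using approx mid by linarith
  qed
  moreover have "norm (of_real (real q / pi) * E) \<le> real q * norm E"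
  proof -
    have "norm (of_real (real q / pi) * E) = real q / pi * norm E" by (simp add: norm_mult norm_divide)
    also have "\<dots> \<le> real q / 1 * norm E" using pi_ge_two by (intro mult_right_mono divide_left_mono) auto
    finally show ?thesis by simp
  qed
  moreover have "E = of_real (sqrt (real q)) * (\<Sum>k=1..K. F k * of_real (sin (2 * pi * (real k * (real N / real q))) / real k))"
    unfolding E_def sum_distrib_left F_def G_def using sq by (intro sum.cong refl) simp
  then have "norm E = sqrt (real q) * norm (\<Sum>k=1..K. F k * of_real (sin (2 * pi * (real k * (real N / real q))) / real k))"
    using sq by (simp add: norm_mult del: of_real_divide)
  \<comment> \<open>Origin of the constant 3 of the statement: 2 comes from the kernel error, as K <
    q/2, and 1 from the middle term.\<close>
  moreover have "3 * (sqrt (real q) * real K) \<le> 2 * (sqrt (real q) * real q)"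
  proof -
    have "3 * K \<le> 2 * q" by (simp add: K_def)
    then have "3 * real K \<le> 2 * real q" by linarith
    from mult_left_mono[OF this, of "sqrt (real q)"] show ?thesis using sq by (simp add: algebra_simps)
  qed
  moreover have "real q \<le> sqrt (real q) * real q"
    using q mult_right_mono[of 1 "sqrt (real q)" "real q"] by simp
  ultimately have "real q * norm (\<Sum>n=1..N. \<chi> (int n)) \<le> real q * (sqrt (real q) * (3 + norm (\<Sum>k=1..K. F k * of_real (sin (2 * pi * (real k * (real N / real q))) / real k))))"
    by (simp add: norm_mult algebra_simps)
  then show ?thesis using q unfolding K_def by simp
qed

section \<open>Summation by parts\<close>

text \<open>Summation by parts as an induction: the deficit n - (a 1 + ... + a n), divided by n, is
  carried along, because the a k may individually exceed 1.\<close>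

lemma sum_divided_le:
  fixes a :: "nat \<Rightarrow> real"
  assumes A: "\<And>n. (\<Sum>k=1..n. a k) \<le> real n"
  shows "(\<Sum>k=1..n. a k / real k) \<le> (\<Sum>k=1..n. 1 / real k)"
proof -
  have "(\<Sum>k=1..n. a k / real k) \<le> (\<Sum>k=1..n. 1 / real k) - (real n - (\<Sum>k=1..n. a k)) / real n"
  proof (induction n)
    case (Suc n)
    define S where "S = (\<Sum>k=1..n. a k)"
    have S: "S \<le> real n" unfolding S_def by (rule A)
    show ?case
    proof (cases "n = 0")
      case False
      have key: "S / real n \<le> 1 / (real n + 1) + S / (real n + 1)"
      proof -
        have "S * (real n + 1) \<le> (1 + S) * real n" using S by (simp add: algebra_simps)
        then show ?thesis using False by (simp add: field_simps)
      qed
      have IH: "(\<Sum>k=1..n. a k / real k) \<le> (\<Sum>k=1..n. 1 / real k) - 1 + S / real n"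
        using Suc.IH False by (simp add: S_def diff_divide_distrib)
      have "(real (Suc n) - (\<Sum>k=1..Suc n. a k)) / real (Suc n) = 1 - S / (real n + 1) - a (Suc n) / (real n + 1)"
      proof -
        have "(t - (u + v)) / t = 1 - u / t - v / t" if "t > 0" for t u v :: real
          using that by (simp add: diff_divide_distrib add_divide_distrib)
        from this[of "real (Suc n)" S "a (Suc n)"] show ?thesis by (simp add: S_def add.commute)
      qed
      then show ?thesis using IH key by (simp add: add.commute)
    qed (use A[of 1] in auto)
  qed auto
  also have "\<dots> \<le> (\<Sum>k=1..n. 1 / real k)" using A[of n] by simp
  finally show ?thesis .
qed

text \<open>The weight 1/(k ln k) takes out the factor ln k and supplies 1/k. Summation by parts
  needs its decrement, its monotonicity and its comparison with the increments of ln ln.\<close>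

lemma inverse_ln_diff_le:
  fixes k :: nat
  assumes "k \<ge> 3"
  shows "1 / (real k * ln (real k)) - 1 / (real (Suc k) * ln (real (Suc k))) \<le> 2 / ((real k)\<^sup>2 * ln (real k))"
    and "1 / (real (Suc k) * ln (real (Suc k))) \<le> 1 / (real k * ln (real k))"
    and "1 / (real (Suc k) * ln (real (Suc k))) \<le> ln (ln (real (Suc k))) - ln (ln (real k))"
proof -
  define x a b where "x = real k" and "a = ln x" and "b = ln (x + 1)"
  have x: "x \<ge> 3" using assms by (simp add: x_def)
  have "exp 1 \<le> x" using exp_le x by linarith
  then have a: "a \<ge> 1" unfolding a_def using x by (subst ln_ge_iff) auto
  have ab: "a \<le> b" unfolding a_def b_def using x by simp
  have S: "real (Suc k) = x + 1" by (simp add: x_def)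
  have lnq: "b - a = ln (1 + 1 / x)"
  proof -
    have "1 + 1 / x = (x + 1) / x" using x by (simp add: field_simps)
    then show ?thesis using x by (simp add: a_def b_def ln_div)
  qed
  have up: "x * (b - a) \<le> 1"
  proof -
    have "b - a \<le> 1 / x" unfolding lnq using x by (intro ln_add_one_self_le_self) auto
    then show ?thesis using x by (simp add: field_simps)
  qed
  have low: "b - a \<ge> 1 / (x + 1)"
  proof -
    have "ln (x / (x + 1)) \<le> x / (x + 1) - 1" using x by (intro ln_le_minus_one) auto
    also have "\<dots> = - (1 / (x + 1))" using x by (simp add: field_simps)
    finally show ?thesis using x by (simp add: ln_div a_def b_def)
  qed
  have "1 / (x * a) - 1 / ((x + 1) * b) = ((x + 1) * b - x * a) / (x * a * ((x + 1) * b))"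
    using x a ab by (simp add: diff_frac_eq)
  also have "\<dots> \<le> (2 * b) / (x * a * ((x + 1) * b))"
  proof (rule divide_right_mono)
    show "(x + 1) * b - x * a \<le> 2 * b" using up a ab by (simp add: algebra_simps)
  qed (use x a ab in auto)
  also have "\<dots> = 2 / (x * a * (x + 1))" using a ab by simp
  also have "\<dots> \<le> 2 / (x * a * x)" using x a by (intro divide_left_mono mult_left_mono mult_pos_pos) auto
  finally show "1 / (real k * ln (real k)) - 1 / (real (Suc k) * ln (real (Suc k))) \<le> 2 / ((real k)\<^sup>2 * ln (real k))"
    unfolding S by (simp add: x_def a_def b_def power2_eq_square mult_ac)
  show "1 / (real (Suc k) * ln (real (Suc k))) \<le> 1 / (real k * ln (real k))"
    unfolding S x_def[symmetric] a_def[symmetric] b_def[symmetric] using x a ab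
    by (intro divide_left_mono mult_mono mult_pos_pos) auto
  have "1 / ((x + 1) * b) = (1 / (x + 1)) / b" by simp
  also have "\<dots> \<le> (b - a) / b" using low a ab by (intro divide_right_mono) auto
  also have "\<dots> = 1 - a / b" using a ab by (simp add: field_simps)
  also have "\<dots> \<le> - ln (a / b)" using ln_le_minus_one[of "a / b"] a ab by simp
  also have "\<dots> = ln b - ln a" using a ab by (simp add: ln_div)
  finally show "1 / (real (Suc k) * ln (real (Suc k))) \<le> ln (ln (real (Suc k))) - ln (ln (real k))"
    unfolding S by (simp add: x_def a_def b_def)
qed

text \<open>The decrement of 1/(k ln k), about 1/(k^2 ln k), times B k (1 + \<delta> ln k) leaves
  1/(k ln k) and \<delta>/k, whose sums are ln ln X and \<delta> ln X up to constants.\<close>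

lemma abel_summation_bound:
  fixes e :: "nat \<Rightarrow> complex" and B \<delta> :: real
  assumes Y: "Y \<ge> 3" "Y \<le> X" and B: "B \<ge> 0" and \<delta>: "\<delta> \<ge> 0"
    and T: "\<And>n. Y \<le> n \<Longrightarrow> n \<le> X \<Longrightarrow> norm (\<Sum>k=1..n. e k * of_real (ln (real k))) \<le> B * real n * (1 + ln (real n) * \<delta>)"
  shows "norm (\<Sum>k=Suc Y..X. e k / of_nat k) \<le> B * (4 + 2 * ln (ln (real X)) + \<delta> * (4 + 2 * ln (real X + 1)))"
proof -
  define g where "g k = 1 / (real k * ln (real k))" for k
  define S where "S n = (\<Sum>k=1..n. e k * of_real (ln (real k)))" for n
  define U where "U n = (\<Sum>k=Suc Y..n. e k / of_nat k)" for n
  have lnk: "ln (real k) \<ge> 1" if "k \<ge> 3" for k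
  proof -
    have "exp 1 \<le> real k" using exp_le that by linarith
    then show ?thesis using that by (subst ln_ge_iff) auto
  qed
  have lnlnY: "ln (ln (real Y)) \<ge> 0" using lnk[OF Y(1)] by simp
  have gS: "g n * norm (S n) \<le> B * (1 + \<delta>)" if n: "Y \<le> n" "n \<le> X" for n
  proof -
    have n3: "n \<ge> 3" using n Y by simp
    have g0: "g n \<ge> 0" using lnk[OF n3] by (simp add: g_def)
    have "g n * norm (S n) \<le> g n * (B * real n * (1 + ln (real n) * \<delta>))"
      unfolding S_def by (intro mult_left_mono T n g0)
    also have "\<dots> = B * (1 / ln (real n) + \<delta>)" using n3 lnk[OF n3] by (simp add: g_def field_simps)
    also have "\<dots> \<le> B * (1 + \<delta>)" using lnk[OF n3] B by (intro mult_left_mono add_right_mono) auto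
    finally show ?thesis .
  qed
  have step_bound: "norm (S k) * (g k - g (Suc k)) \<le> 2 * B * (1 / (real k * ln (real k)) + \<delta> / real k)" if k: "Y \<le> k" "k \<le> X" for k
  proof -
    have k3: "k \<ge> 3" using k Y by simp
    have lk: "ln (real k) > 0" using lnk[OF k3] by linarith
    have "norm (S k) * (g k - g (Suc k)) \<le> (B * real k * (1 + ln (real k) * \<delta>)) * (2 / ((real k)\<^sup>2 * ln (real k)))"
      unfolding S_def g_def using inverse_ln_diff_le[OF k3] B \<delta> lk
      by (intro mult_mono T k) (auto intro!: mult_nonneg_nonneg add_nonneg_nonneg)
    also have "\<dots> = 2 * B * (1 / (real k * ln (real k)) + \<delta> / real k)"
      using k3 lk by (simp add: field_simps power2_eq_square)
    finally show ?thesis .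
  qed
  \<comment> \<open>The partial sums \<open>S\<close> start at 1 although their bound holds only
    from Y on, so the boundary term at Y is kept. The term g Y - g n corrects an index shift: the
    increment of ln ln from k to k + 1 dominates g (k + 1), not g k.\<close>
  have main: "norm (U n - of_real (g n) * S n) \<le> B * (1 + \<delta>) + 2 * B * (g Y - g n + (ln (ln (real n)) - ln (ln (real Y)))) + 2 * B * \<delta> * (\<Sum>k=Y..<n. 1 / real k)"
    if "Y \<le> n" "n \<le> X" for n
    using that
  proof (induction n rule: dec_induct)
    case base
    have "norm (U Y - of_real (g Y) * S Y) = g Y * norm (S Y)"
    proof -
      have "g Y \<ge> 0" using lnk[OF Y(1)] by (simp add: g_def)
      then show ?thesis by (simp add: U_def norm_mult)
    qed
    also have "\<dots> \<le> B * (1 + \<delta>)" using gS Y by auto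
    finally show ?case by simp
  next
    case (step n)
    have n3: "n \<ge> 3" using step Y by simp
    have nX: "Y \<le> n" "n \<le> X" using step by auto
    have "U (Suc n) - of_real (g (Suc n)) * S (Suc n) = (U n - of_real (g n) * S n) + S n * of_real (g n - g (Suc n))"
    proof -
      have "U (Suc n) = U n + e (Suc n) / of_nat (Suc n)" using step by (simp add: U_def)
      moreover have "e (Suc n) / of_nat (Suc n) = of_real (g (Suc n)) * (S (Suc n) - S n)"
      proof -
        have "ln (real (Suc n)) \<noteq> 0" using lnk[of "Suc n"] n3 by simp
        then have "complex_of_real (ln (real (Suc n))) \<noteq> 0" using of_real_eq_0_iff by blast
        moreover have "S (Suc n) - S n = e (Suc n) * of_real (ln (real (Suc n)))" by (simp add: S_def)
        moreover have "of_real (g (Suc n)) = (1 :: complex) / (of_nat (Suc n) * of_real (ln (real (Suc n))))"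
          by (simp only: g_def of_real_divide of_real_mult of_real_1 of_real_of_nat_eq)
        ultimately show ?thesis by (simp only:) (simp del: of_nat_Suc)
      qed
      ultimately show ?thesis by (simp add: algebra_simps)
    qed
    then have "norm (U (Suc n) - of_real (g (Suc n)) * S (Suc n)) \<le> norm (U n - of_real (g n) * S n) + norm (S n) * \<bar>g n - g (Suc n)\<bar>"
      by (metis norm_mult norm_of_real norm_triangle_ineq)
    also have "\<bar>g n - g (Suc n)\<bar> = g n - g (Suc n)" using inverse_ln_diff_le(2)[OF n3] by (simp add: g_def)
    finally have "norm (U (Suc n) - of_real (g (Suc n)) * S (Suc n)) \<le> norm (U n - of_real (g n) * S n) + norm (S n) * (g n - g (Suc n))" .
    moreover have "norm (S n) * (g n - g (Suc n)) \<le> 2 * B * (g n + \<delta> / real n)"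
      using step_bound[OF nX] by (simp add: g_def)
    moreover have "2 * B * (g n + \<delta> / real n) \<le> 2 * B * ((g n - g (Suc n)) + (ln (ln (real (Suc n))) - ln (ln (real n))) + \<delta> / real n)"
      using inverse_ln_diff_le(3)[OF n3] B by (intro mult_left_mono add_right_mono) (auto simp: g_def)
    moreover have "(\<Sum>k=Y..<Suc n. 1 / real k) = (\<Sum>k=Y..<n. 1 / real k) + 1 / real n" using nX by simp
    moreover have "norm (U n - of_real (g n) * S n) \<le> B * (1 + \<delta>) + 2 * B * (g Y - g n + (ln (ln (real n)) - ln (ln (real Y)))) + 2 * B * \<delta> * (\<Sum>k=Y..<n. 1 / real k)"
      using step.IH nX by simp
    ultimately show ?case by (simp add: algebra_simps)
  qed
  have X3: "X \<ge> 3" using Y by simp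
  define H where "H = (\<Sum>k=Y..<X. 1 / real k)"
  have H: "H \<le> 1 + ln (real X + 1)"
  proof -
    have "H \<le> (\<Sum>k=1..X. 1 / real k)" unfolding H_def using Y by (intro sum_mono2) auto
    then show ?thesis using sum_inverse_le_ln[of X] by linarith
  qed
  have gY: "g Y \<le> 1"
  proof -
    have "1 * 1 \<le> real Y * ln (real Y)" using lnk[OF Y(1)] Y by (intro mult_mono) auto
    then show ?thesis by (simp add: g_def divide_le_eq)
  qed
  have gX: "g X \<ge> 0" using lnk[OF X3] by (simp add: g_def)
  have "norm (U X) \<le> norm (U X - of_real (g X) * S X) + norm (of_real (g X) * S X)"
    by (metis diff_add_cancel norm_triangle_ineq)
  also have "norm (of_real (g X) * S X) = g X * norm (S X)" using gX by (simp add: norm_mult)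
  finally have "norm (U X) \<le> B * (1 + \<delta>) + 2 * B * (g Y - g X + (ln (ln (real X)) - ln (ln (real Y)))) + 2 * B * \<delta> * H + B * (1 + \<delta>)"
    using main[of X] gS[of X] Y unfolding H_def by linarith
  also have "2 * B * (g Y - g X + (ln (ln (real X)) - ln (ln (real Y)))) \<le> 2 * B * (1 + ln (ln (real X)))"
    using gY gX lnlnY B by (intro mult_left_mono) auto
  also have "2 * B * \<delta> * H \<le> 2 * B * \<delta> * (1 + ln (real X + 1))"
    using H B \<delta> by (intro mult_left_mono) auto
  finally have "norm (U X) \<le> B * (1 + \<delta>) + 2 * B * (1 + ln (ln (real X))) + 2 * B * \<delta> * (1 + ln (real X + 1)) + B * (1 + \<delta>)"
    by simp
  then show ?thesis by (simp add: U_def algebra_simps)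
qed

section \<open>The character sum\<close>

lemma ln_ge_half: "ln x \<ge> 1 / 2" if "x \<ge> 2" for x :: real
proof -
  have "ln (1 / x) \<le> 1 / x - 1" using that by (intro ln_le_minus_one) simp
  moreover have "1 / x \<le> 1 / 2" using that by (intro divide_left_mono) auto
  moreover have "ln (1 / x) = - ln x" using that by (simp add: ln_div)
  ultimately show ?thesis by linarith
qed

lemma exponential_sum_bound:
  fixes F u :: "nat \<Rightarrow> complex" and q X :: nat and \<alpha> c :: real
  assumes q: "q \<ge> 16" and X: "X < q" and c: "c > 0"
    and \<alpha>: "0 < \<alpha>" "\<alpha> \<le> 1 / (2 * (ln (real q))\<^sup>2)" "1 / \<alpha> \<le> ln (real q) powr (c + 2)"
    and F: "\<And>n. (\<Sum>m=1..n. (norm (F m))\<^sup>2) \<le> real n"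
    and mult: "\<And>p m. prime p \<Longrightarrow> \<not> p dvd q \<Longrightarrow> F (p * m) = u p * F m"
    and u: "\<And>p. norm (u p) \<le> 1"
    and D: "\<And>x. (\<Sum>k=1..x. norm (F k) * (\<Sum>d | d dvd k \<and> \<not> coprime d q. mangoldt d)) \<le> 468 * real x"
  shows "norm (\<Sum>k=1..X. F k * ee (real k * \<alpha>) / of_nat k)
      \<le> (12 + 4 * c + 50480 * (10 + 4 * sqrt (32 * exp (13 / 2)))) * ln (ln (real q))"
proof -
  define L where "L = ln (real q)"
  define l where "l = ln L"
  have "ln (16::real) = 4 * ln 2" using ln_realpow[of 2 4] by simp
  then have "ln (16::real) \<ge> 2" using ln_ge_half[of 2] by simp
  moreover have "ln 16 \<le> ln (real q)" using q by simp
  ultimately have L: "L \<ge> 2" by (simp add: L_def)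
  have l: "l \<ge> 1 / 2" unfolding l_def by (rule ln_ge_half[OF L])
  have \<alpha>8: "\<alpha> \<le> 1 / 8"
  proof -
    have "2 * 2\<^sup>2 \<le> 2 * L\<^sup>2" using L by (intro mult_left_mono power_mono) auto
    then have "1 / (2 * L\<^sup>2) \<le> 1 / 8" by (intro divide_left_mono) auto
    then show ?thesis using \<alpha>(2) by (simp add: L_def)
  qed
  \<comment> \<open>The cut: from Y on the bilinear estimate applies, and ln Y = O(ln ln q) because
    1/\<alpha> is at most a power of ln q.\<close>
  define Y where "Y = nat \<lceil>1 / \<alpha> ^ 4\<rceil>"
  have Y1: "1 / \<alpha> ^ 4 \<le> real Y" unfolding Y_def by linarith
  have Y2: "real Y \<le> 1 / \<alpha> ^ 4 + 1" unfolding Y_def using \<alpha>(1) by (simp add: ceiling_le_iff)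
  have big: "1 / \<alpha> ^ 4 \<ge> 4096"
  proof -
    have "\<alpha> ^ 4 \<le> (1 / 8) ^ 4" using \<alpha>(1) \<alpha>8 by (intro power_mono) auto
    then have "1 / (1 / 8) ^ 4 \<le> 1 / \<alpha> ^ 4" using \<alpha>(1) by (intro divide_left_mono) auto
    then show ?thesis by (simp add: power_one_over)
  qed
  have Y3: "Y \<ge> 3" using Y1 big by linarith
  have lnY: "ln (real Y + 1) \<le> 1 + 4 * (c + 2) * l"
  proof -
    have "real Y + 1 \<le> 2 * (1 / \<alpha>) ^ 4" using Y2 big by (simp add: power_one_over)
    then have "ln (real Y + 1) \<le> ln (2 * (1 / \<alpha>) ^ 4)" using \<alpha>(1) by (subst ln_le_cancel_iff) auto
    also have "\<dots> = ln 2 + 4 * ln (1 / \<alpha>)" using \<alpha>(1) by (subst ln_mult) (simp_all add: ln_realpow)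
    also have "\<dots> \<le> 1 + 4 * ((c + 2) * l)"
    proof (intro add_mono mult_left_mono)
      show "ln 2 \<le> (1 :: real)" using ln_le_minus_one[of "2::real"] by simp
      have "ln (1 / \<alpha>) \<le> ln (L powr (c + 2))"
        using \<alpha>(1) \<alpha>(3) L by (subst ln_le_cancel_iff) (auto simp: L_def)
      then show "ln (1 / \<alpha>) \<le> (c + 2) * l" using L by (simp add: ln_powr l_def)
    qed auto
    finally show ?thesis by (simp add: algebra_simps)
  qed
  define e where "e k = F k * ee (real k * \<alpha>)" for k
  have first: "norm (\<Sum>k=1..n. e k / of_nat k) \<le> (12 + 4 * c) * l" if "n \<le> Y" for n
  proof -
    have "norm (\<Sum>k=1..n. e k / of_nat k) \<le> (\<Sum>k=1..n. norm (F k) / real k)"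
      by (intro sum_norm_le) (simp add: e_def norm_mult norm_divide)
    also have "\<dots> \<le> (\<Sum>k=1..n. 1 / real k)" by (intro sum_divided_le sum_norm_le_of_square_mean F)
    also have "\<dots> \<le> 1 + ln (real n + 1)" by (rule sum_inverse_le_ln)
    also have "\<dots> \<le> 1 + ln (real Y + 1)" using that by simp
    also have "\<dots> \<le> 2 + 4 * (c + 2) * l" using lnY by simp
    also have "\<dots> \<le> (12 + 4 * c) * l" using l by (simp add: algebra_simps)
    finally show ?thesis .
  qed
  show ?thesis
  proof (cases "X \<le> Y")
    case True
    have "norm (\<Sum>k=1..X. e k / of_nat k) \<le> (12 + 4 * c) * l" by (rule first[OF True])
    also have "\<dots> \<le> (12 + 4 * c + 50480 * (10 + 4 * sqrt (32 * exp (13 / 2)))) * l"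
      using l by (intro mult_right_mono) auto
    finally show ?thesis by (simp add: e_def l_def L_def)
  next
    case False
    \<comment> \<open>The pointwise bound for 2h/phi(2h). With \<alpha> \<le> 1/(2 L^2) the product
      \<alpha> V is at most 32 exp(13/2) (l/L)^2, so that \<delta> times ln q is a multiple of
      l.\<close>
    define V where "V = 64 * exp (13 / 2) * l\<^sup>2"
    define \<delta> where "\<delta> = sqrt (\<alpha> * V)"
    define \<kappa> :: real where "\<kappa> = sqrt (32 * exp (13 / 2))"
    have \<delta>: "\<delta> \<le> \<kappa> * l / L"
    proof -
      have "\<alpha> * V \<le> 1 / (2 * L\<^sup>2) * V" using \<alpha>(2) by (intro mult_right_mono) (auto simp: V_def L_def)
      also have "\<dots> = (32 * exp (13 / 2)) * (l / L)\<^sup>2" by (simp add: V_def power_divide)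
      finally have "\<delta> \<le> sqrt ((32 * exp (13 / 2)) * (l / L)\<^sup>2)" unfolding \<delta>_def by (rule real_sqrt_le_mono)
      also have "\<dots> = \<kappa> * (l / L)" using l L by (simp add: \<kappa>_def real_sqrt_mult)
      finally show ?thesis by simp
    qed
    have \<delta>0: "\<delta> \<ge> 0" using \<alpha>(1) by (simp add: \<delta>_def V_def)
    have "norm (\<Sum>k=Suc Y..X. e k / of_nat k) \<le> 50480 * (4 + 2 * ln (ln (real X)) + \<delta> * (4 + 2 * ln (real X + 1)))"
    proof (rule abel_summation_bound[OF Y3])
      show "Y \<le> X" using False by simp
      show "\<delta> \<ge> 0" by (rule \<delta>0)
      fix n assume n: "Y \<le> n" "n \<le> X"
      have "norm (\<Sum>k=1..n. F k * ee (real k * \<alpha>) * of_real (ln (real k))) \<le> (50012 + 468) * real n * (1 + ln (real n) * sqrt (\<alpha> * V))"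
      proof (rule twisted_log_sum_bound[OF \<alpha>(1) _ _ F mult u D])
        show "\<alpha> \<le> 1 / 2" using \<alpha>8 by simp
        show "1 / \<alpha> ^ 4 \<le> real n" using Y1 n(1) by linarith
        fix h :: nat assume "0 < h" "h \<le> n"
        then show "inv_totient_ratio (2 * h) \<le> V"
          unfolding V_def l_def L_def using q X n by (intro inv_totient_ratio_le_ln_ln_square) auto
      qed
      then show "norm (\<Sum>k=1..n. e k * of_real (ln (real k))) \<le> 50480 * real n * (1 + ln (real n) * \<delta>)"
        by (simp add: e_def \<delta>_def)
    qed simp
    \<comment> \<open>The additive constants are absorbed by l \<ge> 1/2, which rests on q \<ge>
      16.\<close>
    also have "\<dots> \<le> 50480 * (8 * l + 2 * l + 4 * (\<kappa> * l))"
    proof (rule mult_left_mono, intro add_mono)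
      show "4 \<le> 8 * l" using l by simp
      have X3: "X \<ge> 3" using False Y3 by simp
      then have "exp 1 \<le> real X" using exp_le by linarith
      then have lnX: "ln (real X) \<ge> 1" using X3 by (subst ln_ge_iff) auto
      have "ln (real X) \<le> L" using X X3 by (simp add: L_def)
      then show "2 * ln (ln (real X)) \<le> 2 * l" using lnX L by (simp add: l_def)
      have "ln (real X + 1) \<le> ln (real q)" using X by (subst ln_le_cancel_iff) auto
      then have "4 + 2 * ln (real X + 1) \<le> 4 * L" using L by (simp add: L_def)
      then have "\<delta> * (4 + 2 * ln (real X + 1)) \<le> (\<kappa> * l / L) * (4 * L)"
        using \<delta> \<delta>0 lnX L l by (intro mult_mono) (auto simp: \<kappa>_def)
      also have "\<dots> = 4 * (\<kappa> * l)" using L by simp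
      finally show "\<delta> * (4 + 2 * ln (real X + 1)) \<le> 4 * (\<kappa> * l)" .
    qed simp
    finally have second: "norm (\<Sum>k=Suc Y..X. e k / of_nat k) \<le> 50480 * (10 + 4 * \<kappa>) * l" by (simp add: algebra_simps)
    have "{1..X} = {1..Y} \<union> {Suc Y..X}" using False by auto
    then have "(\<Sum>k=1..X. e k / of_nat k) = (\<Sum>k\<in>{1..Y} \<union> {Suc Y..X}. e k / of_nat k)" by (rule arg_cong)
    also have "\<dots> = (\<Sum>k=1..Y. e k / of_nat k) + (\<Sum>k=Suc Y..X. e k / of_nat k)" by (rule sum.union_disjoint) auto
    finally have "norm (\<Sum>k=1..X. e k / of_nat k) \<le> (12 + 4 * c) * l + 50480 * (10 + 4 * \<kappa>) * l"
      using first[of Y] second norm_triangle_ineq[of "\<Sum>k=1..Y. e k / of_nat k" "\<Sum>k=Suc Y..X. e k / of_nat k"] by simp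
    also have "\<dots> = (12 + 4 * c + 50480 * (10 + 4 * \<kappa>)) * l" by (simp add: algebra_simps)
    finally show ?thesis by (simp add: e_def l_def L_def \<kappa>_def)
  qed
qed

lemma even_character_sum_bound:
  fixes \<alpha> c :: real
  assumes q: "q \<ge> 16" and c: "c > 0" and \<chi>: "dirichlet_character q \<chi>" and ev: "even_character \<chi>"
    and np: "\<chi> \<noteq> principal_character q"
    and N: "real q / ln (real q) powr (c + 2) < real N" "real N < real q / (2 * (ln (real q))\<^sup>2)"
  shows "norm (\<Sum>n=1..N. \<chi> (int n)) \<le> (18 + 4 * c + 50480 * (10 + 4 * sqrt (32 * exp (13 / 2)))) * (sqrt (real q) * ln (ln (real q)))"
proof -
  define \<alpha> where "\<alpha> = real N / real q"
  define F where "F k = gauss_sum q \<chi> (int k) / of_real (sqrt (real q))" for k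
  define X where "X = (q - 1) div 2"
  define C where "C = 12 + 4 * c + 50480 * (10 + 4 * sqrt (32 * exp (13 / 2)))"
  define l where "l = ln (ln (real q))"
  have q0: "q > 0" using q by simp
  have sq: "sqrt (real q) > 0" using q0 by simp
  have "exp 1 \<le> real q" using exp_le q by linarith
  then have lnq: "ln (real q) \<ge> 1" using q0 by (subst ln_ge_iff) auto
  have "real q / ln (real q) powr (c + 2) > 0" using q0 lnq by (intro divide_pos_pos) auto
  then have N0: "real N > 0" using N(1) by linarith
  have \<alpha>0: "0 < \<alpha>" using N0 q0 by (simp add: \<alpha>_def)
  have \<alpha>1: "\<alpha> \<le> 1 / (2 * (ln (real q))\<^sup>2)"
    using N(2) q0 lnq by (simp add: \<alpha>_def field_simps)
  have \<alpha>2: "1 / \<alpha> \<le> ln (real q) powr (c + 2)"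
  proof -
    have "0 < ln (real q) powr (c + 2)" using lnq by simp
    then show ?thesis using N(1) N0 by (simp add: \<alpha>_def field_simps)
  qed
  have Fsq: "(\<Sum>m=1..n. (norm (F m))\<^sup>2) \<le> real n" for n
  proof -
    have "(\<Sum>m=1..n. (norm (F m))\<^sup>2) = (\<Sum>m=1..n. (norm (gauss_sum q \<chi> (int m)))\<^sup>2) / real q"
      by (simp add: F_def norm_divide power_divide sum_divide_distrib)
    also have "\<dots> \<le> (real n * real q) / real q" by (intro divide_right_mono gauss_sum_square_mean[OF \<chi> q0]) simp
    finally show ?thesis using q0 by simp
  qed
  \<comment> \<open>The value 0 away from the admissible primes keeps |u p| \<le> 1 for all p, as
    required of the multiplier.\<close>
  define u where "u p = (if p dvd q \<or> \<not> prime p then 0 else inverse (\<chi> (int p)))" for p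
  have cop: "coprime (int p) (int q)" if "prime p" "\<not> p dvd q" for p
    using prime_imp_coprime[OF that] by simp
  have mult: "F (p * m) = u p * F m" if p: "prime p" "\<not> p dvd q" for p m
  proof -
    have "\<chi> (int p) \<noteq> 0" using cop[OF p] dirichlet_character_nonzero_iff[OF \<chi>] by blast
    moreover have "\<chi> (int p) * gauss_sum q \<chi> (int (p * m)) = gauss_sum q \<chi> (int m)"
      using gauss_sum_mult_unit[OF \<chi> q0 cop[OF p], of "int m"] by (simp add: mult.commute)
    ultimately have "gauss_sum q \<chi> (int (p * m)) = inverse (\<chi> (int p)) * gauss_sum q \<chi> (int m)"
      by (metis left_inverse mult.assoc mult_1)
    then show ?thesis using p by (simp add: F_def u_def)
  qed
  have u: "norm (u p) \<le> 1" for p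
    using norm_dirichlet_character[OF \<chi> q0 cop[of p]] by (auto simp: u_def norm_inverse)
  have D: "(\<Sum>k=1..x. norm (F k) * (\<Sum>d | d dvd k \<and> \<not> coprime d q. mangoldt d)) \<le> 468 * real x" for x
  proof -
    have "(\<Sum>k=1..x. norm (F k) * (\<Sum>d | d dvd k \<and> \<not> coprime d q. mangoldt d))
       = (\<Sum>k=1..x. norm (gauss_sum q \<chi> (int k)) * (\<Sum>d | d dvd k \<and> \<not> coprime d q. mangoldt d)) / sqrt (real q)"
      by (simp add: F_def norm_divide sum_divide_distrib)
    also have "\<dots> \<le> (468 * sqrt (real q) * real x) / sqrt (real q)"
      by (intro divide_right_mono gauss_sum_mangoldt_mean[OF \<chi> q0]) simp
    finally show ?thesis using sq by simp
  qed
  have Xq: "X < q" using q by (simp add: X_def)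
  have S1: "norm (\<Sum>k=1..X. F k * ee (real k * \<alpha>) / of_nat k) \<le> C * l"
    unfolding C_def l_def by (rule exponential_sum_bound[OF q Xq c \<alpha>0 \<alpha>1 \<alpha>2 Fsq mult u D])
  \<comment> \<open>The sine also needs the frequency -\<alpha>, whereas the estimate is for
    positive \<alpha>. The conjugate of F satisfies the same hypotheses with the conjugate
    multiplier, and conjugating the result gives \<open>S3\<close>.\<close>
  have S2: "norm (\<Sum>k=1..X. cnj (F k) * ee (real k * \<alpha>) / of_nat k) \<le> C * l"
    unfolding C_def l_def
    by (rule exponential_sum_bound[OF q Xq c \<alpha>0 \<alpha>1 \<alpha>2, where u = "\<lambda>p. cnj (u p)"]) (use Fsq mult u D in auto)
  have S3: "norm (\<Sum>k=1..X. F k * ee (- (real k * \<alpha>)) / of_nat k) \<le> C * l"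
  proof -
    have "cnj (\<Sum>k=1..X. cnj (F k) * ee (real k * \<alpha>) / of_nat k) = (\<Sum>k=1..X. F k * ee (- (real k * \<alpha>)) / of_nat k)"
      by (simp add: ee_uminus)
    then have "(\<Sum>k=1..X. F k * ee (- (real k * \<alpha>)) / of_nat k) = cnj (\<Sum>k=1..X. cnj (F k) * ee (real k * \<alpha>) / of_nat k)"
      by (rule sym)
    then show ?thesis using S2 by (simp only: complex_mod_cnj)
  qed
  have "(\<Sum>k=1..X. F k * of_real (sin (2 * pi * (real k * (real N / real q))) / real k))
     = ((\<Sum>k=1..X. F k * ee (real k * \<alpha>) / of_nat k) - (\<Sum>k=1..X. F k * ee (- (real k * \<alpha>)) / of_nat k)) / (2 * \<i>)"
    unfolding sum_subtractf[symmetric] sum_divide_distrib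
  proof (intro sum.cong refl)
    fix k
    have sin: "of_real (sin (2 * pi * t)) = (ee t - ee (- t)) / (2 * \<i>)" for t
      by (simp add: ee_def complex_eq_iff)
    show "F k * of_real (sin (2 * pi * (real k * (real N / real q))) / real k)
       = (F k * ee (real k * \<alpha>) / of_nat k - F k * ee (- (real k * \<alpha>)) / of_nat k) / (2 * \<i>)"
      unfolding of_real_divide sin \<alpha>_def[symmetric]
      by (simp add: diff_divide_distrib right_diff_distrib mult_ac)
  qed
  then have "norm (\<Sum>k=1..X. F k * of_real (sin (2 * pi * (real k * (real N / real q))) / real k)) \<le> C * l"
    using S1 S3 norm_triangle_ineq4[of "\<Sum>k=1..X. F k * ee (real k * \<alpha>) / of_nat k" "\<Sum>k=1..X. F k * ee (- (real k * \<alpha>)) / of_nat k"]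
    by (simp add: norm_divide norm_mult)
  moreover have "norm (\<Sum>n=1..N. \<chi> (int n)) \<le> sqrt (real q) * (3 + norm (\<Sum>k=1..X. F k * of_real (sin (2 * pi * (real k * (real N / real q))) / real k)))"
    unfolding F_def X_def by (rule character_sum_le_sine_sum[OF \<chi> q0 ev np])
  ultimately have "norm (\<Sum>n=1..N. \<chi> (int n)) \<le> sqrt (real q) * (3 + C * l)"
    using sq by (meson add_left_mono mult_left_mono less_imp_le order_trans)
  also have "\<dots> \<le> sqrt (real q) * (6 * l + C * l)"
  proof -
    have "ln (16::real) = 4 * ln 2" using ln_realpow[of 2 4] by simp
    then have "ln (16::real) \<ge> 2" using ln_ge_half[of 2] by simp
    moreover have "ln 16 \<le> ln (real q)" using q by simp
    ultimately have "l \<ge> 1 / 2" unfolding l_def by (intro ln_ge_half) linarith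
    then show ?thesis using sq by (intro mult_left_mono) auto
  qed
  also have "\<dots> = (C + 6) * (sqrt (real q) * l)" by (simp add: algebra_simps)
  also have "C + 6 = 18 + 4 * c + 50480 * (10 + 4 * sqrt (32 * exp (13 / 2)))" by (simp add: C_def)
  finally show ?thesis by (simp only: l_def)
qed

text \<open>Modulo q < 5 every unit is 1 or -1, where an even character is 1. This disposes of the
  moduli for which ln ln q fails to be positive.\<close>

lemma even_character_small_modulus:
  assumes \<chi>: "dirichlet_character q \<chi>" and ev: "even_character \<chi>" and q: "0 < q" "q < 5"
  shows "\<chi> = principal_character q"
proof
  fix n
  show "\<chi> n = principal_character q n"
  proof (cases "coprime n (int q)")
    case True
    have "q \<in> {1, 2, 3, 4}" using q by auto
    then have "[n = 1] (mod int q) \<or> [n = -1] (mod int q)"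
    proof (elim insertE emptyE)
      assume q2: "q = 2"
      then have "odd n" using True by (simp add: coprime_right_2_iff_odd)
      then show ?thesis by (simp add: q2 cong_def odd_iff_mod_2_eq_one)
    next
      assume q3: "q = 3"
      have "\<not> 3 dvd n"
      proof
        assume "3 dvd n"
        then have "is_unit (3::int)" using True q3 by (intro coprime_common_divisor[of n 3]) auto
        then show False by simp
      qed
      then have "n mod 3 = 1 \<or> n mod 3 = 2" by presburger
      then show ?thesis by (auto simp: q3 cong_def)
    next
      assume q4: "q = 4"
      have "\<not> 2 dvd n"
      proof
        assume "2 dvd n"
        then have "is_unit (2::int)" using True q4 by (intro coprime_common_divisor[of n 4]) auto
        then show False by simp
      qed
      then have "n mod 4 = 1 \<or> n mod 4 = 3" by presburger
      then show ?thesis by (auto simp: q4 cong_def)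
    qed (simp add: cong_def)
    then have "\<chi> n = 1"
      using dirichlet_character_cong[OF \<chi>, of n] dirichlet_character_1[OF \<chi>] ev by (auto simp: even_character_def)
    then show ?thesis using True by (simp add: principal_character_def)
  next
    case False
    then show ?thesis using dirichlet_character_nonzero_iff[OF \<chi>, of n] by (auto simp: principal_character_def)
  qed
qed

theorem theorem1:
  fixes c :: real
  assumes "c > 0"
  shows "\<exists>K::real. \<forall>(q::nat) (N::int) (\<chi>::int \<Rightarrow> complex).
           q > 0 \<longrightarrow>
           real q / ln (real q) powr (c + 2) < real_of_int N \<longrightarrow>
           real_of_int N < real q / (2 * (ln (real q)) ^ 2) \<longrightarrow>
           dirichlet_character q \<chi> \<longrightarrow>
           even_character \<chi> \<longrightarrow>
           \<chi> \<noteq> principal_character q \<longrightarrow>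
           norm (\<Sum>n=1..N. \<chi> n) \<le> K * (sqrt (real q) * ln (ln (real q)))"
proof -
  define K1 where "K1 = 18 + 4 * c + 50480 * (10 + 4 * sqrt (32 * exp (13 / 2)))"
  \<comment> \<open>For 5 \<le> q < 16 the sum is at most N < q/(2 (ln q)^2) \<le> 8, since ln q >
    1, while ln ln q is at least the positive number ln(ln 5).\<close>
  define K2 where "K2 = 8 / ln (ln (5::real))"
  have "exp 1 < (5::real)" using exp_le by linarith
  then have "ln (exp 1) < ln (5::real)" by (subst ln_less_cancel_iff) auto
  then have ln5: "ln 5 > (1::real)" by simp
  then have l5: "ln (ln (5::real)) > 0" by simp
  have K: "K1 \<ge> 0" "K2 \<ge> 0" using assms l5 by (auto simp: K1_def K2_def intro!: add_nonneg_nonneg)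
  show ?thesis
  proof (intro exI[of _ "K1 + K2"] allI impI)
    fix q :: nat and N :: int and \<chi> :: "int \<Rightarrow> complex"
    assume q0: "q > 0" and N1: "real q / ln (real q) powr (c + 2) < real_of_int N"
      and N2: "real_of_int N < real q / (2 * (ln (real q)) ^ 2)"
      and \<chi>: "dirichlet_character q \<chi>" and ev: "even_character \<chi>" and np: "\<chi> \<noteq> principal_character q"
    have q5: "q \<ge> 5"
    proof (rule ccontr)
      assume "\<not> q \<ge> 5"
      then show False using even_character_small_modulus[OF \<chi> ev q0] np by simp
    qed
    have lq: "ln 5 \<le> ln (real q)" using q5 by simp
    then have llq: "ln (ln 5) \<le> ln (ln (real q))" using ln5 by simp
    have "0 \<le> real q / ln (real q) powr (c + 2)" by simp
    then have N0: "N > 0" using N1 by linarith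
    define M where "M = nat N"
    have NM: "N = int M" using N0 by (simp add: M_def)
    have sum: "(\<Sum>n=1..N. \<chi> n) = (\<Sum>n=1..M. \<chi> (int n))"
      by (rule sum.reindex_bij_witness[of _ int nat]) (auto simp: NM)
    have "0 \<le> ln (ln (real q))" using llq l5 by linarith
    then have nn: "0 \<le> sqrt (real q) * ln (ln (real q))" by simp
    show "norm (\<Sum>n=1..N. \<chi> n) \<le> (K1 + K2) * (sqrt (real q) * ln (ln (real q)))"
    proof (cases "q \<ge> 16")
      case True
      have "norm (\<Sum>n=1..N. \<chi> n) \<le> K1 * (sqrt (real q) * ln (ln (real q)))"
        unfolding sum K1_def by (rule even_character_sum_bound[OF True assms \<chi> ev np]) (use N1 N2 in \<open>simp_all add: NM\<close>)
      also have "\<dots> \<le> (K1 + K2) * (sqrt (real q) * ln (ln (real q)))"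
        using K nn by (intro mult_right_mono) auto
      finally show ?thesis .
    next
      case False
      have "norm (\<Sum>n=1..N. \<chi> n) \<le> (\<Sum>n=1..M. 1)"
        unfolding sum by (intro sum_norm_le norm_dirichlet_character_le[OF \<chi> q0])
      then have "norm (\<Sum>n=1..N. \<chi> n) \<le> real_of_int N" by (simp only: sum_constant) (simp add: NM)
      also have "\<dots> \<le> real q / (2 * (ln (real q))\<^sup>2)" using N2 by simp
      also have "\<dots> \<le> 16 / (2 * 1)"
      proof (intro frac_le)
        show "2 * 1 \<le> 2 * (ln (real q))\<^sup>2" using lq ln5 by (intro mult_left_mono one_le_power) auto
      qed (use False in auto)
      also have "\<dots> = K2 * (1 * ln (ln 5))" using l5 by (simp add: K2_def)
      also have "\<dots> \<le> K2 * (sqrt (real q) * ln (ln (real q)))"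
        using K llq l5 q5 by (intro mult_left_mono mult_mono) auto
      also have "\<dots> \<le> (K1 + K2) * (sqrt (real q) * ln (ln (real q)))"
        using K nn by (intro mult_right_mono) auto
      finally show ?thesis .
    qed
  qed
qed

end
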